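(* If $\Gamma$ is a closed convex curve in the plane bounding area greater than $\pi$, then the bicycle monodromy of $\Gamma$ (for a bicycle of length $1$) is hyperbolic.
   Context: A bicycle of length $1$ in the plane is an oriented unit segment $AB$ ($A$ is the rear wheel, $B$ the front wheel) moving so that the velocity of $A$ is always parallel to $AB$. Let the front wheel trace a closed curve $\Gamma$ of length $L$, parametrized by arc length $x\in[0,L]$ (a closed convex curve, i.e. the boundary of a compact convex set with nonempty interior, is rectifiable, and its arc length parametrization is Lipschitz and differentiable almost everywhere). Recording the position by the unit vector $u$ from $A$ to $B$, so that $A=\Gamma-u$, the motion is governed by $u'(x)=\Gamma'(x)-(\Gamma'(x)\cdot u(x))u(x)$ (for almost every $x$ with $u$ absolutely continuous, if $\Gamma$ is not smooth). The monodromy $M:S^1\to S^1$ sends $u(0)$ to $u(L)$. It is a Möbius transformation of the circle (the boundary action of an orientation-preserving isometry of the hyperbolic plane), and, up to conjugation, it does not depend on the starting point on $\Gamma$. $M$ is called hyperbolic if it is not the identity and has exactly two fixed points on $S^1$ (then one is exponentially attracting and the other exponentially repelling). *)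

theory Defs
  imports "HOL-Analysis.Analysis"
begin

text \<open>The plane is the type of complex numbers, with the inner product of its structure as a
  real Euclidean space and with Lebesgue measure as area; the circle of directions is
  \<^term>\<open>sphere (0 :: complex) 1\<close>.\<close>

text \<open>Length as the supremum of the lengths of inscribed polygons (the members of a division of
  a real interval are closed intervals without common interior points).\<close>

definition curve_length :: "(real \<Rightarrow> complex) \<Rightarrow> real \<Rightarrow> real \<Rightarrow> ereal" where
  "curve_length \<gamma> s t =
     (SUP d \<in> {d. d division_of {s..t}}. ereal (\<Sum>k\<in>d. norm (\<gamma> (Sup k) - \<gamma> (Inf k))))"

text \<open>\<^term>\<open>\<gamma>\<close> runs exactly once around the closed curve \<^term>\<open>C\<close> of length \<^term>\<open>L\<close>, starting at an
  arbitrary point and in either direction. Its values outside \<^term>\<open>{0..L}\<close> are irrelevant.\<close>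

definition closed_arclength_parametrization ::
    "(real \<Rightarrow> complex) \<Rightarrow> real \<Rightarrow> complex set \<Rightarrow> bool" where
  "closed_arclength_parametrization \<gamma> L C \<longleftrightarrow>
     0 < L \<and> continuous_on {0..L} \<gamma> \<and> \<gamma> ` {0..L} = C \<and> \<gamma> L = \<gamma> 0 \<and> inj_on \<gamma> {0..<L} \<and>
     (\<forall>s t. 0 \<le> s \<and> s \<le> t \<and> t \<le> L \<longrightarrow> curve_length \<gamma> s t = ereal (t - s))"

definition abs_continuous_on :: "real \<Rightarrow> real \<Rightarrow> (real \<Rightarrow> complex) \<Rightarrow> bool" where
  "abs_continuous_on a b u \<longleftrightarrow>
     (\<forall>\<epsilon>>0. \<exists>\<delta>>0. \<forall>d T. d division_of T \<and> T \<subseteq> {a..b} \<and> (\<Sum>k\<in>d. Sup k - Inf k) < \<delta> \<longrightarrow>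
        (\<Sum>k\<in>d. norm (u (Sup k) - u (Inf k))) < \<epsilon>)"

text \<open>Motion of a bicycle of length 1: the front wheel is at \<^term>\<open>\<gamma> x\<close>, the rear wheel at
  \<^term>\<open>\<gamma> x - u x\<close>.\<close>

definition bicycle_motion :: "(real \<Rightarrow> complex) \<Rightarrow> real \<Rightarrow> (real \<Rightarrow> complex) \<Rightarrow> bool" where
  "bicycle_motion \<gamma> L u \<longleftrightarrow>
     abs_continuous_on 0 L u \<and> (\<forall>x\<in>{0..L}. u x \<in> sphere 0 1) \<and>
     (AE x in lebesgue. x \<in> {0<..<L} \<longrightarrow>
        \<gamma> differentiable (at x) \<and>
        (u has_vector_derivative
           vector_derivative \<gamma> (at x) - (vector_derivative \<gamma> (at x) \<bullet> u x) *\<^sub>R u x) (at x))"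

definition bicycle_monodromy :: "(real \<Rightarrow> complex) \<Rightarrow> real \<Rightarrow> complex \<Rightarrow> complex" where
  "bicycle_monodromy \<gamma> L v = (THE w. \<exists>u. bicycle_motion \<gamma> L u \<and> u 0 = v \<and> u L = w)"

definition hyperbolic_on_circle :: "(complex \<Rightarrow> complex) \<Rightarrow> bool" where
  "hyperbolic_on_circle M \<longleftrightarrow>
     (\<exists>v\<in>sphere 0 1. M v \<noteq> v) \<and> card {v \<in> sphere 0 1. M v = v} = 2"

end

theory Submission
  imports Defs
begin

text \<open>
  Write \<open>p = \<gamma>'\<close>. In homogeneous coordinates on the circle the motion is the linear system
  \<open>A' = p B\<^sup>* / 2\<close>, \<open>B' = p A\<^sup>* / 2\<close> with values in \<open>SU(1,1)\<close>, whose action on Minkowski vectors \<open>(C, V)\<close> is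
  \<open>V' = C p\<close>, \<open>C' = V \<bullet> p\<close>: the hyperbolic plane rolls along \<open>\<gamma>\<close>. If the monodromy is not hyperbolic, it fixes
  a timelike or lightlike vector, that is, there is a closed solution with \<open>C\<^sup>2 - |V|\<^sup>2 = \<epsilon> \<ge> 0\<close> and \<open>C > 0\<close>. The
  closed curve \<open>V\<close> has the tangent directions of \<open>\<gamma>\<close>, so it is convex, and since \<open>\<gamma>\<close>, with \<open>\<gamma>' = V' / C\<close>, closes up
  as well, \<open>V\<close> surrounds the origin. With \<open>u = V / |V| = e\<^sup>i\<^sup>\<alpha>\<close>, \<open>T = |V| / C \<le> 1\<close> and \<open>\<eta> = ln (C + |V|)\<close>, the curve
  \<open>\<gamma> - \<eta> u\<close> has normal \<open>u\<close>, and Wirtinger's inequality for its support function in the variable \<open>\<alpha>\<close> bounds the area enclosed by \<open>\<gamma>\<close> by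
  half the integral of \<open>T\<^sup>2 d\<alpha>\<close>, hence by \<open>\<pi>\<close>.

  The tangent angle of a convex curve is monotone, so \<open>\<gamma>\<close> is differentiable off a countable set, and
  the fundamental theorem of calculus with countable exceptions suffices throughout.
\<close>

section \<open>Calculus with exceptional sets\<close>

text \<open>The constant \<pi> is half the total turning 2\<pi> of \<open>V\<close>, weighted by
  \<open>T\<^sup>2 \<le> 1\<close>. The choice of \<open>\<eta>\<close> is forced: its derivative is
  the component of \<open>\<gamma>'\<close> along \<open>u\<close>, so subtracting
  \<open>\<eta> u\<close> removes the radial motion and leaves a curve with tangents orthogonal to
  \<open>u\<close>. For \<epsilon> = 1, \<open>\<eta>\<close> is the hyperbolic distance of
  \<open>(C, V)\<close> from \<open>(1, 0)\<close> and \<open>T\<close> its hyperbolic tangent. Some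
  degeneracies shape the proof. That weight is nonnegative only because of the position of the
  origin relative to \<open>V\<close>, which is the global part of the argument. The monodromy is
  defined through absolutely continuous motions, whose equation may fail on a null set that need not
  be countable; their uniqueness therefore needs a monotonicity criterion of its own. Finally, the
  direction of traversal is arbitrary, and complex conjugation reduces it to the counterclockwise
  one.\<close>

lemma countable_imp_negligible:
  fixes D :: "'a::euclidean_space set"
  assumes "countable D"
  shows "negligible D"
  using assms by (simp add: negligible_iff_null_sets countable_imp_null_set_lborel null_sets_completionI)

text \<open>The tag \<open>x\<close> lies between \<open>u\<close> and \<open>v\<close>, so the
  linearization errors on its two sides add up to a multiple of \<open>v - u\<close>. This is the
  form in which a derivative enters Riemann sums.\<close>

lemma straddle:
  fixes f :: "real \<Rightarrow> 'a::banach"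
  assumes "(f has_vector_derivative D) (at x within S)" "e > 0"
  shows "\<exists>d>0. \<forall>u v. u \<le> x \<and> x \<le> v \<and> u \<in> S \<and> v \<in> S \<and> {u..v} \<subseteq> ball x d \<longrightarrow>
           norm ((v - u) *\<^sub>R D - (f v - f u)) \<le> e * (v - u)"
proof -
  obtain d where d: "d > 0"
    "\<And>y. y \<in> S \<Longrightarrow> norm (y - x) < d \<Longrightarrow> norm (f y - f x - (y - x) *\<^sub>R D) \<le> e * norm (y - x)"
    using assms unfolding has_vector_derivative_def has_derivative_within_alt by metis
  have "norm ((v - u) *\<^sub>R D - (f v - f u)) \<le> e * (v - u)"
    if uv: "u \<le> x" "x \<le> v" "u \<in> S" "v \<in> S" "{u..v} \<subseteq> ball x d" for u v
  proof -
    have "u \<in> {u..v}" "v \<in> {u..v}" using uv by auto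
    then have "u \<in> ball x d" "v \<in> ball x d" using uv by blast+
    then have nu: "norm (u - x) < d" and nv: "norm (v - x) < d" by (auto simp: dist_real_def)
    have "norm ((v - u) *\<^sub>R D - (f v - f u)) =
        norm ((f u - f x - (u - x) *\<^sub>R D) - (f v - f x - (v - x) *\<^sub>R D))"
      by (auto simp: algebra_simps)
    also have "\<dots> \<le> e * norm (u - x) + e * norm (v - x)"
      by (intro order_trans[OF norm_triangle_ineq4] add_mono d nu nv uv)
    also have "\<dots> = e * (v - u)" using uv by (simp add: algebra_simps)
    finally show ?thesis .
  qed
  then show ?thesis using d(1) by blast
qed

text \<open>Each point of \<open>D\<close> gets a geometric weight, and \<open>J\<close> collects
  the weights of the points already passed. A tag may be either endpoint of its interval, so each
  point carries two equal jumps, one seen from the left (\<open>d \<le> x\<close>) and one from the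
  right (\<open>d < x\<close>); hence the bound 4, twice the sum of the geometric series.\<close>

lemma countable_jump_function:
  fixes D :: "real set"
  assumes "countable D"
  obtains c :: "real \<Rightarrow> real" and J :: "real \<Rightarrow> real"
  where "mono J" "\<And>x. 0 \<le> J x" "\<And>x. J x \<le> 4"
    "\<And>x. x \<in> D \<Longrightarrow> c x > 0"
    "\<And>x u v. x \<in> D \<Longrightarrow> u \<le> x \<Longrightarrow> x \<le> v \<Longrightarrow> u < v \<Longrightarrow> c x \<le> J v - J u"
proof -
  define n where "n = to_nat_on D"
  define t where "t x m = (1/2)^m * (if \<exists>d\<in>D. n d = m \<and> d < x then 1 else 0) +
     (1/2)^m * (if \<exists>d\<in>D. n d = m \<and> d \<le> x then 1 else (0::real))" for x m
  have t0: "0 \<le> t x m" for x m by (simp add: t_def)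
  have tb: "t x m \<le> 2 * (1/2)^m" for x m by (simp add: t_def)
  have s2: "(\<lambda>m. 2 * (1/2::real)^m) sums 4"
    using sums_mult[OF geometric_sums[of "1/2::real"], of 2] by simp
  have st: "summable (t x)" for x
    by (rule summable_comparison_test'[OF sums_summable[OF s2], of 0]) (use t0 tb in auto)
  have tm: "t u m \<le> t v m" if "u \<le> v" for u v m
    unfolding t_def using that by (intro add_mono mult_left_mono) (auto dest: order.trans)
  define J where "J x = suminf (t x)" for x
  show ?thesis
  proof
    show "mono J" by (auto simp: mono_def J_def intro!: suminf_le st tm)
    show "0 \<le> J x" for x unfolding J_def by (intro suminf_nonneg st t0)
    show "J x \<le> 4" for x
      unfolding J_def sums_unique[OF s2] by (intro suminf_le st tb sums_summable[OF s2])
    show "(1/2::real)^n x > 0" for x by simp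
    fix x u v :: real assume x: "x \<in> D" "u \<le> x" "x \<le> v" "u < v"
    have inj: "inj_on n D" using assms unfolding n_def by (rule inj_on_to_nat_on)
    have ex: "(\<exists>d\<in>D. n d = n x \<and> P d) \<longleftrightarrow> P x" for P
      using inj x(1) unfolding inj_on_def by blast
    have "(1/2)^n x \<le> t v (n x) - t u (n x)"
      unfolding t_def ex using x by auto
    also have "\<dots> = (\<Sum>m\<in>{n x}. t v m - t u m)" by simp
    also have "\<dots> \<le> (\<Sum>m. t v m - t u m)"
      by (intro sum_le_suminf summable_diff st) (use tm[of u v] x in auto)
    also have "\<dots> = J v - J u" unfolding J_def by (intro suminf_diff[symmetric] st)
    finally show "(1/2)^n x \<le> J v - J u" .
  qed
qed

text \<open>The summable jumps of \<open>J\<close> pay for the intervals tagged by exceptional points.\<close>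

theorem fundamental_theorem_of_calculus_countable:
  fixes f :: "real \<Rightarrow> 'a::banach"
  assumes ab: "a \<le> b" and D: "countable D" and cont: "continuous_on {a..b} f"
    and der: "\<And>x. x \<in> {a<..<b} - D \<Longrightarrow> (f has_vector_derivative f' x) (at x)"
  shows "(f' has_integral (f b - f a)) {a..b}"
proof -
  \<comment> \<open>The endpoints are exceptional too, since the derivative is assumed only
    inside.\<close>
  define E where "E = D \<union> {a,b}"
  have E: "countable E" using D by (simp add: E_def)
  define g where "g x = (if x \<in> E then 0 else f' x)" for x
  obtain c J where J: "mono J" "\<And>x. 0 \<le> J x" "\<And>x. J x \<le> (4::real)"
    and c: "\<And>x. x \<in> E \<Longrightarrow> c x > (0::real)"
    "\<And>x u v. x \<in> E \<Longrightarrow> u \<le> x \<Longrightarrow> x \<le> v \<Longrightarrow> u < v \<Longrightarrow> c x \<le> J v - J u"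
    using countable_jump_function[OF E] by metis
  have "(g has_integral (f b - f a)) {a..b}"
    unfolding has_integral_real
  proof (intro allI impI)
    fix e :: real assume "e > 0"
    \<comment> \<open>The total error is at most \<open>e'\<close> times the length plus
      \<open>e'\<close> times the rise of \<open>J\<close>, which is at most 4; the fifth unit makes
      the inequality strict.\<close>
    define e' where "e' = e / (b - a + 5)"
    have e': "e' > 0" using \<open>e > 0\<close> ab by (simp add: e'_def)
    have "\<exists>d>0. \<forall>u v. u \<le> x \<and> x \<le> v \<and> u \<in> {a..b} \<and> v \<in> {a..b} \<and> {u..v} \<subseteq> ball x d \<longrightarrow>
           norm ((v - u) *\<^sub>R g x - (f v - f u)) \<le> e' * (v - u) + e' * (J v - J u)"
      if x: "x \<in> {a..b}" for x
    proof (cases "x \<in> E")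
      case True
      have ec: "e' * c x / 2 > 0" using e' c True by simp
      obtain d where d: "d > 0" "\<And>y. y \<in> {a..b} \<Longrightarrow> dist y x < d \<Longrightarrow> dist (f y) (f x) < e' * c x / 2"
        using cont x ec unfolding continuous_on_iff by metis
      have "norm ((v - u) *\<^sub>R g x - (f v - f u)) \<le> e' * (v - u) + e' * (J v - J u)"
        if uv: "u \<le> x" "x \<le> v" "u \<in> {a..b}" "v \<in> {a..b}" "{u..v} \<subseteq> ball x d" for u v
      proof (cases "u < v")
        case True2: True
        have "u \<in> {u..v}" "v \<in> {u..v}" using uv by auto
    then have "u \<in> ball x d" "v \<in> ball x d" using uv by blast+
        then have "dist (f u) (f x) < e' * c x / 2" "dist (f v) (f x) < e' * c x / 2"
          using d(2)[OF uv(3)] d(2)[OF uv(4)] by (simp_all add: dist_commute)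
        then have "dist (f v) (f u) \<le> e' * c x"
          by (smt (verit, best) dist_triangle2 field_sum_of_halves)
        also have "\<dots> \<le> e' * (J v - J u)" using c(2)[OF True uv(1,2) True2] e' by simp
        also have "\<dots> \<le> e' * (v - u) + e' * (J v - J u)" using uv e' by simp
        finally show ?thesis using True by (simp add: g_def dist_norm norm_minus_commute)
      next
        case False
        then have "u = v" using uv by simp
        then show ?thesis by simp
      qed
      then show ?thesis using d(1) by blast
    next
      case False
      then have "x \<in> {a<..<b} - D" using x by (auto simp: E_def)
      then have dv: "(f has_vector_derivative g x) (at x within {a..b})"
        using has_vector_derivative_at_within[OF der[OF \<open>x \<in> {a<..<b} - D\<close>]] False by (simp only: g_def if_False)
      obtain d where d: "d > 0" "\<And>u v. u \<le> x \<and> x \<le> v \<and> u \<in> {a..b} \<and> v \<in> {a..b} \<and> {u..v} \<subseteq> ball x d \<longrightarrow>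
           norm ((v - u) *\<^sub>R g x - (f v - f u)) \<le> e' * (v - u)"
        using straddle[OF dv e'] by blast
      show ?thesis
        using d monoD[OF J(1)] e' by (smt (verit) mult_nonneg_nonneg)
    qed
    then obtain d where d: "\<And>x. x \<in> {a..b} \<Longrightarrow> d x > 0"
      "\<And>x u v. x \<in> {a..b} \<Longrightarrow> u \<le> x \<Longrightarrow> x \<le> v \<Longrightarrow> u \<in> {a..b} \<Longrightarrow> v \<in> {a..b} \<Longrightarrow> {u..v} \<subseteq> ball x (d x) \<Longrightarrow>
           norm ((v - u) *\<^sub>R g x - (f v - f u)) \<le> e' * (v - u) + e' * (J v - J u)"
      by metis
    define G where "G x = ball x (if x \<in> {a..b} then d x else 1)" for x
    have "gauge G" unfolding G_def by (rule gauge_ball_dependent) (use d in auto)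
    moreover have "norm ((\<Sum>(x,k)\<in>p. measure lborel k *\<^sub>R g x) - (f b - f a)) < e"
      if p: "p tagged_division_of {a..b}" "G fine p" for p
    proof -
      have "norm ((\<Sum>(x,k)\<in>p. measure lborel k *\<^sub>R g x) - (f b - f a))
          = norm (\<Sum>(x,k)\<in>p. measure lborel k *\<^sub>R g x - (f (Sup k) - f (Inf k)))"
        by (simp add: additive_tagged_division_1[OF ab p(1), of f, symmetric] sum_subtractf split_def)
      also have "\<dots> \<le> (\<Sum>(x,k)\<in>p. e' * (Sup k - Inf k) + e' * (J (Sup k) - J (Inf k)))"
      proof (rule sum_norm_le, clarify)
        fix x k assume xk: "(x,k) \<in> p"
        obtain u v where k: "k = {u..v}" using tagged_division_ofD(4)[OF p(1) xk] by auto
        have xk': "x \<in> k" "k \<subseteq> {a..b}" using tagged_division_ofD(2,3)[OF p(1) xk] by auto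
        have uv: "u \<le> x" "x \<le> v" "u \<in> {a..b}" "v \<in> {a..b}" "x \<in> {a..b}" using xk' k by auto
        have "{u..v} \<subseteq> ball x (d x)" using p(2) xk k uv(5) by (force simp: fine_def G_def)
        from d(2)[OF uv(5,1-4) this] uv
        show "norm (measure lborel k *\<^sub>R g x - (f (Sup k) - f (Inf k)))
            \<le> e' * (Sup k - Inf k) + e' * (J (Sup k) - J (Inf k))"
          by (simp add: k)
      qed
      also have "\<dots> = e' * (b - a) + e' * (J b - J a)"
        using additive_tagged_division_1[OF ab p(1), of "\<lambda>x. x"] additive_tagged_division_1[OF ab p(1), of J]
        by (simp add: split_def sum.distrib flip: sum_distrib_left)
      also have "\<dots> \<le> e' * (b - a + 4)"
        using e' J(2)[of a] J(3)[of b] by (simp flip: distrib_left)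
      also have "\<dots> < e' * (b - a + 5)" using e' by simp
      also have "\<dots> = e" using ab by (simp add: e'_def)
      finally show ?thesis .
    qed
    ultimately show "\<exists>\<gamma>. gauge \<gamma> \<and> (\<forall>\<D>. \<D> tagged_division_of {a..b} \<and> \<gamma> fine \<D> \<longrightarrow>
        norm ((\<Sum>(x,k)\<in>\<D>. measure lborel k *\<^sub>R g x) - (f b - f a)) < e)" by (intro exI[of _ G]) simp
  qed
  then show ?thesis
    by (rule has_integral_spike[OF countable_imp_negligible[OF E], rotated]) (auto simp: g_def)
qed

lemma nondecreasing_off_countable:
  fixes f :: "real \<Rightarrow> real"
  assumes "a \<le> b" "countable D" "continuous_on {a..b} f"
    and "\<And>x. x \<in> {a<..<b} - D \<Longrightarrow> (f has_vector_derivative f' x) (at x)"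
    and "\<And>x. x \<in> {a<..<b} - D \<Longrightarrow> f' x \<ge> 0"
  shows "f a \<le> f b"
proof -
  define E where "E = D \<union> {a,b}"
  have E: "negligible E" using assms(2) by (auto simp: E_def intro: countable_imp_negligible)
  have "(f' has_integral (f b - f a)) {a..b}"
    by (rule fundamental_theorem_of_calculus_countable[OF assms(1-4)])
  then have "((\<lambda>x. if x \<in> E then 0 else f' x) has_integral (f b - f a)) {a..b}"
    by (rule has_integral_spike[OF E, rotated]) auto
  then have "f b - f a \<ge> 0"
    by (rule has_integral_nonneg) (use assms(5) in \<open>auto simp: E_def\<close>)
  then show ?thesis by simp
qed

lemma constant_off_countable:
  fixes f :: "real \<Rightarrow> 'a::banach"
  assumes "a \<le> b" "countable D" "continuous_on {a..b} f"
    and "\<And>x. x \<in> {a<..<b} - D \<Longrightarrow> (f has_vector_derivative 0) (at x)"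
  shows "f b = f a"
  using fundamental_theorem_of_calculus_countable[OF assms] has_integral_0 has_integral_unique
  by (metis right_minus_eq)

lemma lipschitz_off_countable:
  fixes f :: "real \<Rightarrow> 'a::euclidean_space"
  assumes "a \<le> b" "countable D" "continuous_on {a..b} f"
    and "\<And>x. x \<in> {a<..<b} - D \<Longrightarrow> (f has_vector_derivative f' x) (at x)"
    and "\<And>x. x \<in> {a<..<b} - D \<Longrightarrow> norm (f' x) \<le> B" and "B \<ge> 0"
  shows "norm (f b - f a) \<le> B * (b - a)"
proof -
  define E where "E = D \<union> {a,b}"
  have E: "negligible E" using assms(2) by (auto simp: E_def intro: countable_imp_negligible)
  have "(f' has_integral (f b - f a)) (cbox a b)"
    using fundamental_theorem_of_calculus_countable[OF assms(1-4)] by simp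
  then have "((\<lambda>x. if x \<in> E then 0 else f' x) has_integral (f b - f a)) (cbox a b)"
    by (rule has_integral_spike[OF E, rotated]) auto
  then have "norm (f b - f a) \<le> B * measure lborel (cbox a b)"
    by (rule has_integral_bound[OF assms(6)]) (use assms(5,6) in \<open>auto simp: E_def\<close>)
  then show ?thesis using assms(1) by simp
qed

text \<open>Intervals tagged in \<open>N\<close> lie in an open set of small measure, where absolute continuity bounds their
  contribution; the others obey the estimate given by the derivative.\<close>

lemma nonincreasing_of_absolutely_continuous:
  fixes f :: "real \<Rightarrow> real"
  assumes ab: "a \<le> b" and N: "negligible N"
    and ac: "\<And>\<epsilon>. \<epsilon> > 0 \<Longrightarrow> \<exists>\<delta>>0. \<forall>d T. d division_of T \<and> T \<subseteq> {a..b} \<and> (\<Sum>k\<in>d. Sup k - Inf k) < \<delta> \<longrightarrow>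
        (\<Sum>k\<in>d. \<bar>f (Sup k) - f (Inf k)\<bar>) < \<epsilon>"
    and der: "\<And>x. x \<in> {a<..<b} - N \<Longrightarrow> \<exists>D\<le>0. (f has_vector_derivative D) (at x)"
  shows "f b \<le> f a"
proof -
  define E where "E = N \<union> {a,b}"
  have E: "negligible E" using N by (simp add: E_def)
  have "f b - f a \<le> e * (b - a + 1)" if e: "e > 0" for e
  proof -
    obtain \<delta> where \<delta>: "\<delta> > 0" and ac': "\<And>d T. d division_of T \<Longrightarrow> T \<subseteq> {a..b} \<Longrightarrow> (\<Sum>k\<in>d. Sup k - Inf k) < \<delta> \<Longrightarrow>
        (\<Sum>k\<in>d. \<bar>f (Sup k) - f (Inf k)\<bar>) < e"
      using ac[OF e] by metis
    have El: "E \<in> sets lebesgue" "emeasure lebesgue E = 0"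
      using E by (auto simp: negligible_iff_null_sets)
    obtain U where U: "open U" "E \<subseteq> U" "emeasure lebesgue (U - E) < ennreal \<delta>"
      using sets_lebesgue_outer_open[OF El(1) \<delta>] by metis
    have Um: "U \<in> lmeasurable" "measure lebesgue U < \<delta>"
    proof -
      have "emeasure lebesgue U \<le> emeasure lebesgue (U - E) + emeasure lebesgue E"
        by (smt (verit) Diff_partition El(1) U(1) U(2) borel_open emeasure_subadditive inf_sup_aci(5) sets.Diff sets_completionI_sets sets_lborel)
      then have lt: "emeasure lebesgue U < ennreal \<delta>" using U(3) El by simp
      then show "U \<in> lmeasurable"
        using U(1) by (intro fmeasurableI) (auto intro: order.strict_trans)
      then show "measure lebesgue U < \<delta>"
        using lt \<delta> by (simp add: emeasure_eq_measure2 ennreal_less_iff)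
    qed
    have "\<exists>d>0. (x \<in> E \<longrightarrow> ball x d \<subseteq> U) \<and> (x \<notin> E \<longrightarrow> (\<forall>u v. u \<le> x \<and> x \<le> v \<and> u \<in> {a..b} \<and> v \<in> {a..b} \<and>
             {u..v} \<subseteq> ball x d \<longrightarrow> f v - f u \<le> e * (v - u)))"
      if x: "x \<in> {a..b}" for x
    proof (cases "x \<in> E")
      case True
      then show ?thesis using U openE by blast
    next
      case False
      then have "x \<in> {a<..<b} - N" using x by (auto simp: E_def)
      then obtain D where D: "D \<le> 0" "(f has_vector_derivative D) (at x)"
        using der by blast
      then have dv: "(f has_vector_derivative D) (at x within {a..b})"
        using has_vector_derivative_at_within by blast
      obtain d where d: "d > 0" "\<And>u v. u \<le> x \<and> x \<le> v \<and> u \<in> {a..b} \<and> v \<in> {a..b} \<and> {u..v} \<subseteq> ball x d \<longrightarrow>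
           norm ((v - u) *\<^sub>R D - (f v - f u)) \<le> e * (v - u)"
        using straddle[OF dv e] by blast
      have "f v - f u \<le> e * (v - u)"
        if "u \<le> x" "x \<le> v" "u \<in> {a..b}" "v \<in> {a..b}" "{u..v} \<subseteq> ball x d" for u v
      proof -
        have "\<bar>(v - u) * D - (f v - f u)\<bar> \<le> e * (v - u)" using d(2)[of u v] that by simp
        moreover have "(v - u) * D \<le> 0" using that D by (simp add: mult_nonneg_nonpos)
        ultimately show ?thesis by linarith
      qed
      then show ?thesis using d(1) False by blast
    qed
    then obtain d where d: "\<And>x. x \<in> {a..b} \<Longrightarrow> d x > 0"
      "\<And>x. x \<in> {a..b} \<Longrightarrow> x \<in> E \<Longrightarrow> ball x (d x) \<subseteq> U"
      "\<And>x u v. x \<in> {a..b} \<Longrightarrow> x \<notin> E \<Longrightarrow> u \<le> x \<Longrightarrow> x \<le> v \<Longrightarrow> u \<in> {a..b} \<Longrightarrow> v \<in> {a..b} \<Longrightarrow>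
         {u..v} \<subseteq> ball x (d x) \<Longrightarrow> f v - f u \<le> e * (v - u)"
      by metis
    define G where "G x = ball x (if x \<in> {a..b} then d x else 1)" for x
    have "gauge G" unfolding G_def by (rule gauge_ball_dependent) (use d in auto)
    then obtain p where p: "p tagged_division_of {a..b}" "G fine p"
      using fine_division_exists_real by metis
    have pk: "\<exists>u v. k = {u..v} \<and> u \<le> x \<and> x \<le> v \<and> u \<in> {a..b} \<and> v \<in> {a..b} \<and> x \<in> {a..b} \<and> {u..v} \<subseteq> ball x (d x)"
      if xk: "(x,k) \<in> p" for x k
    proof -
      obtain u v where k: "k = {u..v}" using tagged_division_ofD(4)[OF p(1) xk] by auto
      have xk': "x \<in> k" "k \<subseteq> {a..b}" using tagged_division_ofD(2,3)[OF p(1) xk] by auto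
      have uv: "u \<le> x" "x \<le> v" "u \<in> {a..b}" "v \<in> {a..b}" "x \<in> {a..b}" using xk' k by auto
      have "{u..v} \<subseteq> ball x (d x)" using p(2) xk k uv(5) by (force simp: fine_def G_def)
      then show ?thesis using k uv by blast
    qed
    define q where "q = {xk \<in> p. fst xk \<in> E}"
    have finp: "finite p" using p(1) by blast
    have ne: "k \<noteq> {}" if "(x,k) \<in> q" for x k
      using tagged_division_ofD(2)[OF p(1), of x k] that unfolding q_def by blast
    have qp: "q tagged_partial_division_of {a..b}"
      using p(1) tagged_partial_division_subset[of p _ q] by (auto simp: q_def tagged_division_of_def)
    note qd = tagged_partial_division_of_Union_self[OF qp]
    define T where "T = \<Union>(snd ` q)"
    have qdiv: "snd ` q division_of T"
      unfolding T_def by (rule division_of_tagged_division[OF qd])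
    have TU: "T \<subseteq> U"
    proof
      fix y assume "y \<in> T"
      then obtain x k where xk: "(x,k) \<in> p" "x \<in> E" "y \<in> k" by (auto simp: T_def q_def)
      then obtain u v where "k = {u..v}" "x \<in> {a..b}" "{u..v} \<subseteq> ball x (d x)" using pk by metis
      then show "y \<in> U" using d(2)[of x] xk by blast
    qed
    have Tab: "T \<subseteq> {a..b}" using qp unfolding T_def tagged_partial_division_of_def by force
    have "(\<Sum>k\<in>snd ` q. Sup k - Inf k) = (\<Sum>k\<in>snd ` q. measure lebesgue k)"
    proof (rule sum.cong[OF refl])
      fix k assume "k \<in> snd ` q"
      then obtain x where "(x,k) \<in> p" by (auto simp: q_def)
      then obtain u v where "k = {u..v}" "u \<le> v" using pk by (meson order.trans)
      then show "Sup k - Inf k = measure lebesgue k" by simp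
    qed
    also have "\<dots> = measure lebesgue T" using content_division[OF qdiv] by simp
    also have "\<dots> \<le> measure lebesgue U"
      by (rule measure_mono_fmeasurable[OF TU _ Um(1)]) (use qdiv lmeasurable_division in blast)
    finally have len: "(\<Sum>k\<in>snd ` q. Sup k - Inf k) < \<delta>" using Um(2) by linarith
    have "(\<Sum>(x,k)\<in>q. f (Sup k) - f (Inf k)) \<le> (\<Sum>(x,k)\<in>q. \<bar>f (Sup k) - f (Inf k)\<bar>)"
      by (rule sum_mono) auto
    \<comment> \<open>For an empty interval \<open>Sup\<close> and \<open>Inf\<close> carry no
      meaning, so it is given the value 0. This allows the passage from tagged intervals to
      intervals: one that carries two tags is degenerate and contributes nothing.\<close>
    also have "\<dots> = (\<Sum>(x,k)\<in>q. if k = {} then 0 else \<bar>f (Sup k) - f (Inf k)\<bar>)"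
    proof (rule sum.cong[OF refl])
      fix xk assume "xk \<in> q"
      then have "snd xk \<noteq> {}" using ne[of "fst xk" "snd xk"] by simp
      then show "(case xk of (x,k) \<Rightarrow> \<bar>f (Sup k) - f (Inf k)\<bar>) =
          (case xk of (x,k) \<Rightarrow> if k = {} then 0 else \<bar>f (Sup k) - f (Inf k)\<bar>)"
        by (simp add: case_prod_unfold)
    qed
    also have "\<dots> = (\<Sum>k\<in>snd ` q. if k = {} then 0 else \<bar>f (Sup k) - f (Inf k)\<bar>)"
      by (rule sum.over_tagged_division_lemma[OF qd]) (auto simp: content_real_eq_0 dest: antisym)
    also have "\<dots> = (\<Sum>k\<in>snd ` q. \<bar>f (Sup k) - f (Inf k)\<bar>)"
    proof (rule sum.cong[OF refl])
      fix k assume "k \<in> snd ` q"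
      then have "k \<noteq> {}" using ne by force
      then show "(if k = {} then 0 else \<bar>f (Sup k) - f (Inf k)\<bar>) = \<bar>f (Sup k) - f (Inf k)\<bar>" by simp
    qed
    also have "\<dots> < e" by (rule ac'[OF qdiv Tab len])
    finally have 1: "(\<Sum>(x,k)\<in>q. f (Sup k) - f (Inf k)) < e" .
    have "(\<Sum>(x,k)\<in>p - q. f (Sup k) - f (Inf k)) \<le> (\<Sum>(x,k)\<in>p - q. e * (Sup k - Inf k))"
    proof (rule sum_mono, clarify)
      fix x k assume xk: "(x,k) \<in> p" "(x,k) \<notin> q"
      then obtain u v where uv: "k = {u..v}" "u \<le> x" "x \<le> v" "u \<in> {a..b}" "v \<in> {a..b}" "x \<in> {a..b}" "{u..v} \<subseteq> ball x (d x)"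
        using pk by metis
      have "x \<notin> E" using xk by (auto simp: q_def)
      from d(3)[OF uv(6) this uv(2-5,7)] uv(1-3)
      show "f (Sup k) - f (Inf k) \<le> e * (Sup k - Inf k)" by simp
    qed
    also have "\<dots> \<le> (\<Sum>(x,k)\<in>p. e * (Sup k - Inf k))"
    proof (rule sum_mono2[OF finp])
      show "p - q \<subseteq> p" by blast
      fix xk assume "xk \<in> p - (p - q)"
      moreover obtain x k where xk: "xk = (x,k)" by fastforce
      ultimately have "(x,k) \<in> p" by blast
      then obtain u v where "k = {u..v}" "u \<le> v" using pk by (meson order.trans)
      then show "0 \<le> (case xk of (x,k) \<Rightarrow> e * (Sup k - Inf k))" using e xk by simp
    qed
    also have "\<dots> = e * (b - a)"
      using additive_tagged_division_1[OF ab p(1), of "\<lambda>x. x"]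
      by (simp add: split_def flip: sum_distrib_left)
    finally have 2: "(\<Sum>(x,k)\<in>p - q. f (Sup k) - f (Inf k)) \<le> e * (b - a)" .
    have "f b - f a = (\<Sum>(x,k)\<in>p. f (Sup k) - f (Inf k))"
      using additive_tagged_division_1[OF ab p(1), of f] by simp
    also have "\<dots> = (\<Sum>(x,k)\<in>p - q. f (Sup k) - f (Inf k)) + (\<Sum>(x,k)\<in>q. f (Sup k) - f (Inf k))"
      by (rule sum.subset_diff[OF _ finp]) (auto simp: q_def)
    finally show ?thesis using 1 2 by (simp add: algebra_simps)
  qed
  then have *: "f b - f a \<le> e * (b - a + 1)" if "e > 0" for e using that by blast
  show ?thesis
  proof (rule ccontr)
    assume "\<not> ?thesis"
    then have pos: "f b - f a > 0" by simp
    have "f b - f a \<le> ((f b - f a) / (2 * (b - a + 1))) * (b - a + 1)"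
      by (rule *) (use pos ab in auto)
    also have "\<dots> = (f b - f a) / 2" using ab by (simp add: field_simps)
    finally show False using pos by simp
  qed
qed

section \<open>Linear differential equations\<close>

lemma integrable_continuous_mult:
  fixes h p :: "real \<Rightarrow> complex"
  assumes "continuous_on {a..b} h" "p \<in> borel_measurable borel" "\<And>x. norm (p x) \<le> B"
  shows "(\<lambda>x. p x * h x) integrable_on {a..b}"
proof -
  have "bounded (h ` {a..b})"
    by (intro compact_imp_bounded compact_continuous_image assms) simp
  then obtain C where C: "\<And>x. x \<in> {a..b} \<Longrightarrow> norm (h x) \<le> C" unfolding bounded_iff by blast
  have "p \<in> borel_measurable (lebesgue_on {a..b})"
    using assms(2) by (simp add: measurable_completion measurable_restrict_space1)
  moreover have "h \<in> borel_measurable (lebesgue_on {a..b})"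
    by (intro continuous_imp_measurable_on_sets_lebesgue assms) simp
  ultimately have "(\<lambda>x. p x * h x) \<in> borel_measurable (lebesgue_on {a..b})"
    by (rule borel_measurable_times)
  then show ?thesis
  proof (rule measurable_bounded_by_integrable_imp_integrable)
    show "(\<lambda>x. B * C) integrable_on {a..b}" by (rule integrable_const_ivl)
    show "norm (p x * h x) \<le> B * C" if "x \<in> {a..b}" for x
    proof -
      have "0 \<le> B" using assms(3)[of x] norm_ge_zero order_trans by blast
      then show ?thesis unfolding norm_mult by (intro mult_mono assms(3) C that) auto
    qed
  qed simp
qed

text \<open>Picard iteration started at the constant \<open>z0\<close>; the conjugate makes the
  equation linear over the reals only. The factor 1/2 is given away, and the differences of the
  iterates are dominated by the exponential series, which converges for every
  \<open>L\<close>.\<close>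

lemma linear_ode_existence:
  fixes p :: "real \<Rightarrow> complex" and z0 :: complex
  assumes p: "p \<in> borel_measurable borel" "\<And>x. norm (p x) \<le> 1" and L: "0 \<le> L"
  obtains z where "continuous_on {0..L} z"
    "\<And>x. x \<in> {0..L} \<Longrightarrow> z x = z0 + integral {0..x} (\<lambda>s. p s * (cnj (z s) / 2))"
proof -
  define f where "f = rec_nat (\<lambda>x::real. z0) (\<lambda>n h x. z0 + integral {0..x} (\<lambda>s. p s * (cnj (h s) / 2)))"
  have f0: "f 0 = (\<lambda>x. z0)" and fS: "f (Suc n) = (\<lambda>x. z0 + integral {0..x} (\<lambda>s. p s * (cnj (f n s) / 2)))" for n
    by (simp_all add: f_def)
  have int: "(\<lambda>s. p s * (cnj (h s) / 2)) integrable_on {0..x}"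
    if "continuous_on {0..L} h" "x \<in> {0..L}" for h x
    by (rule integrable_continuous_mult[OF _ p])
       (use that in \<open>auto intro!: continuous_intros intro: continuous_on_subset\<close>)
  have cf: "continuous_on {0..L} (f n)" for n
  proof (induction n)
    case (Suc n)
    show ?case unfolding fS
      by (intro continuous_intros indefinite_integral_continuous_1 int Suc) (use L in auto)
  qed (simp add: f0)
  have bound: "norm (integral {0..x} (\<lambda>s. p s * (cnj (h s) / 2)) - integral {0..x} (\<lambda>s. p s * (cnj (k s) / 2))) \<le> i"
    if "continuous_on {0..L} h" "continuous_on {0..L} k" "x \<in> {0..L}" 
      "\<And>s. s \<in> {0..x} \<Longrightarrow> norm (h s - k s) \<le> b s" "(b has_integral i) {0..x}" for h k x b i
  proof -
    have "integral {0..x} (\<lambda>s. p s * (cnj (h s) / 2)) - integral {0..x} (\<lambda>s. p s * (cnj (k s) / 2))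
        = integral {0..x} (\<lambda>s. p s * (cnj (h s) / 2) - p s * (cnj (k s) / 2))"
      by (rule Henstock_Kurzweil_Integration.integral_diff[symmetric]) (intro int that)+
    also have "norm \<dots> \<le> integral {0..x} b"
    proof (rule integral_norm_bound_integral)
      show "(\<lambda>s. p s * (cnj (h s) / 2) - p s * (cnj (k s) / 2)) integrable_on {0..x}"
        by (intro integrable_diff int that)
      show "b integrable_on {0..x}" using that by blast
      fix s assume s: "s \<in> {0..x}"
      have "norm (p s * (cnj (h s) / 2) - p s * (cnj (k s) / 2)) = norm (p s) * (norm (h s - k s) / 2)"
        by (simp add: right_diff_distrib[symmetric] norm_mult norm_divide flip: complex_cnj_diff diff_divide_distrib)
      also have "\<dots> \<le> 1 * (norm (h s - k s) / 2)" by (intro mult_right_mono p) auto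
      also have "\<dots> \<le> b s" using that(4)[OF s] norm_ge_zero[of "h s - k s"] by linarith
      finally show "norm (p s * (cnj (h s) / 2) - p s * (cnj (k s) / 2)) \<le> b s" .
    qed
    also have "\<dots> = i" using that(5) by (rule integral_unique)
    finally show ?thesis .
  qed
  have step: "norm (f (Suc n) x - f n x) \<le> norm z0 * (x ^ Suc n / fact (Suc n))" if "x \<in> {0..L}" for n x
    using that
  proof (induction n arbitrary: x)
    case 0
    have "norm (integral {0..x} (\<lambda>s. p s * (cnj z0 / 2)) - integral {0..x} (\<lambda>s. p s * (cnj 0 / 2))) \<le> norm z0 * x"
      by (rule bound[where b = "\<lambda>_. norm z0"])
         (use 0 has_integral_const_real[of "norm z0" 0 x] in \<open>auto simp: mult.commute\<close>)
    then show ?case by (simp add: fS f0)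
  next
    case (Suc n)
    have "((\<lambda>s. norm z0 * (s ^ Suc n / fact (Suc n))) has_integral
        norm z0 * (x ^ Suc (Suc n) / fact (Suc (Suc n))) - norm z0 * (0 ^ Suc (Suc n) / fact (Suc (Suc n)))) {0..x}"
    proof (rule fundamental_theorem_of_calculus)
      show "0 \<le> x" using Suc by simp
      fix s
      have "((\<lambda>s. norm z0 * (s ^ Suc (Suc n) / fact (Suc (Suc n)))) has_real_derivative
         norm z0 * (s ^ Suc n / fact (Suc n))) (at s within {0..x})"
        by (rule derivative_eq_intros refl | simp)+
      then show "((\<lambda>s. norm z0 * (s ^ Suc (Suc n) / fact (Suc (Suc n)))) has_vector_derivative
         norm z0 * (s ^ Suc n / fact (Suc n))) (at s within {0..x})"
        by (simp only: has_real_derivative_iff_has_vector_derivative)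
    qed
    then have "norm (integral {0..x} (\<lambda>s. p s * (cnj (f (Suc n) s) / 2)) - integral {0..x} (\<lambda>s. p s * (cnj (f n s) / 2)))
        \<le> norm z0 * (x ^ Suc (Suc n) / fact (Suc (Suc n)))"
      by (intro bound[OF cf cf Suc.prems]) (use Suc in auto)
    then show ?case by (simp add: fS[of "Suc n"] fS[of n])
  qed
  define M where "M n = norm z0 * (L ^ Suc n / fact (Suc n))" for n
  have sM: "summable M"
  proof -
    have "summable (\<lambda>n. L ^ n / fact n)" using summable_exp[of L] by (simp add: field_simps)
    then show ?thesis unfolding M_def by (intro summable_mult) (simp only: summable_Suc_iff[of "\<lambda>n. L ^ n / fact n"])
  qed
  have "uniform_limit {0..L} (\<lambda>n x. \<Sum>i<n. f (Suc i) x - f i x) (\<lambda>x. \<Sum>i. f (Suc i) x - f i x) sequentially"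
  proof (rule Weierstrass_m_test[OF _ sM])
    fix n x assume x: "x \<in> {0..L}"
    show "norm (f (Suc n) x - f n x) \<le> M n"
      unfolding M_def by (intro order_trans[OF step[OF x]] mult_left_mono divide_right_mono power_mono) (use x in auto)
  qed
  then have "uniform_limit {0..L} (\<lambda>n x. f n x - f 0 x) (\<lambda>x. \<Sum>i. f (Suc i) x - f i x) sequentially"
    unfolding sum_lessThan_telescope[of "\<lambda>i. f i x" for x] .
  then have ul: "uniform_limit {0..L} f (\<lambda>x. z0 + (\<Sum>i. f (Suc i) x - f i x)) sequentially"
    by (simp add: uniform_limit_iff f0 dist_norm algebra_simps)
  define z where "z x = z0 + (\<Sum>i. f (Suc i) x - f i x)" for x
  have ul: "uniform_limit {0..L} f z sequentially" using ul by (simp add: z_def[abs_def])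
  have cz: "continuous_on {0..L} z"
    by (rule uniform_limit_theorem[OF _ ul]) (use cf in auto)
  show ?thesis
  proof
    show "continuous_on {0..L} z" by fact
    fix x assume x: "x \<in> {0..L}"
    have "(\<lambda>n. integral {0..x} (\<lambda>s. p s * (cnj (f n s) / 2))) \<longlonglongrightarrow> integral {0..x} (\<lambda>s. p s * (cnj (z s) / 2))"
    proof (rule LIMSEQ_I)
      fix r :: real assume r: "r > 0"
      define e where "e = r / (L + 1)"
      have "e > 0" using r L by (simp add: e_def)
      then obtain N where N: "\<And>n s. n \<ge> N \<Longrightarrow> s \<in> {0..L} \<Longrightarrow> dist (f n s) (z s) < e"
        using ul unfolding uniform_limit_iff eventually_sequentially by meson
      have "norm (integral {0..x} (\<lambda>s. p s * (cnj (f n s) / 2)) - integral {0..x} (\<lambda>s. p s * (cnj (z s) / 2))) < r"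
        if "n \<ge> N" for n
      proof -
        have "norm (integral {0..x} (\<lambda>s. p s * (cnj (f n s) / 2)) - integral {0..x} (\<lambda>s. p s * (cnj (z s) / 2))) \<le> e * x"
        proof (rule bound[OF cf cz x])
          show "norm (f n s - z s) \<le> e" if "s \<in> {0..x}" for s
            using N[OF \<open>n \<ge> N\<close>, of s] that x by (auto simp: dist_norm)
          show "((\<lambda>s. e) has_integral e * x) {0..x}"
            using has_integral_const_real[of e 0 x] x by (auto simp: mult.commute)
        qed
        also have "\<dots> \<le> e * L" using \<open>e > 0\<close> x by auto
        also have "\<dots> < r" using r L by (simp add: e_def field_simps)
        finally show ?thesis .
      qed
      then show "\<exists>no. \<forall>n\<ge>no. norm (integral {0..x} (\<lambda>s. p s * (cnj (f n s) / 2)) -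
          integral {0..x} (\<lambda>s. p s * (cnj (z s) / 2))) < r" by blast
    qed
    then have "(\<lambda>n. f (Suc n) x) \<longlonglongrightarrow> z0 + integral {0..x} (\<lambda>s. p s * (cnj (z s) / 2))"
      unfolding fS by (intro tendsto_intros)
    moreover have "(\<lambda>n. f (Suc n) x) \<longlonglongrightarrow> z x"
      using tendsto_uniform_limitI[OF ul x] LIMSEQ_Suc by blast
    ultimately show "z x = z0 + integral {0..x} (\<lambda>s. p s * (cnj (z s) / 2))"
      using LIMSEQ_unique by blast
  qed
qed

text \<open>The coefficient \<open>p\<close> will be a tangent direction with countably many jumps;
  at every other point the integral equation can be differentiated.\<close>

lemma linear_ode_derivative:
  fixes p z :: "real \<Rightarrow> complex"
  assumes p: "p \<in> borel_measurable borel" "\<And>x. norm (p x) \<le> 1" and cz: "continuous_on {0..L} z"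
    and z: "\<And>x. x \<in> {0..L} \<Longrightarrow> z x = z0 + integral {0..x} (\<lambda>s. p s * (cnj (z s) / 2))"
    and x: "x \<in> {0<..<L}" and cp: "isCont p x"
  shows "(z has_vector_derivative p x * cnj (z x) / 2) (at x)"
proof -
  have zx: "isCont z x" using cz x
    by (intro continuous_on_interior[of "{0..L}"]) (simp_all add: interior_atLeastAtMost_real)
  have "isCont (\<lambda>s. p s * (cnj (z s) / 2)) x"
    using cp zx unfolding isCont_def by (intro tendsto_intros) auto
  then have c: "continuous (at x within ({0..L} - {})) (\<lambda>s. p s * (cnj (z s) / 2))"
    by (rule continuous_at_imp_continuous_within)
  have int: "(\<lambda>s. p s * (cnj (z s) / 2)) integrable_on {0..L}"
    by (rule integrable_continuous_mult[OF _ p]) (intro continuous_intros cz, simp)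
  have "((\<lambda>x. integral {0..x} (\<lambda>s. p s * (cnj (z s) / 2))) has_vector_derivative p x * (cnj (z x) / 2))
      (at x within ({0..L} - {}))"
    by (rule integral_has_vector_derivative_continuous_at[OF int _ _ c]) (use x in auto)
  then have "((\<lambda>x. integral {0..x} (\<lambda>s. p s * (cnj (z s) / 2))) has_vector_derivative p x * (cnj (z x) / 2)) (at x within {0<..<L})"
    by (rule has_vector_derivative_within_subset) auto
  then have "((\<lambda>x. z0 + integral {0..x} (\<lambda>s. p s * (cnj (z s) / 2))) has_vector_derivative 0 + p x * (cnj (z x) / 2)) (at x within {0<..<L})"
    by (rule has_vector_derivative_add[OF has_vector_derivative_const])
  then have "(z has_vector_derivative 0 + p x * (cnj (z x) / 2)) (at x within {0<..<L})"
    by (rule has_vector_derivative_transform[OF x, rotated]) (simp add: z)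
  then show ?thesis
    unfolding at_within_open[OF x open_greaterThanLessThan] by simp
qed

text \<open>\<open>A\<close> and \<open>B\<close> are the entries of the fundamental matrix in \<open>SU(1,1)\<close>, so that \<open>z = A z\<^sub>0 + B (cnj z\<^sub>0)\<close>.\<close>

lemma fundamental_solution:
  fixes p :: "real \<Rightarrow> complex"
  assumes p: "p \<in> borel_measurable borel" "\<And>x. norm (p x) \<le> 1" and L: "0 \<le> L"
  obtains A B where "continuous_on {0..L} A" "continuous_on {0..L} B" "A 0 = 1" "B 0 = 0"
    "\<And>x. x \<in> {0<..<L} \<Longrightarrow> isCont p x \<Longrightarrow> (A has_vector_derivative p x * cnj (B x) / 2) (at x)"
    "\<And>x. x \<in> {0<..<L} \<Longrightarrow> isCont p x \<Longrightarrow> (B has_vector_derivative p x * cnj (A x) / 2) (at x)"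
proof -
  obtain y where y: "continuous_on {0..L} y"
    "\<And>x. x \<in> {0..L} \<Longrightarrow> y x = 1 + integral {0..x} (\<lambda>s. p s * (cnj (y s) / 2))"
    using linear_ode_existence[OF p L, of 1] by blast
  obtain z where z: "continuous_on {0..L} z"
    "\<And>x. x \<in> {0..L} \<Longrightarrow> z x = \<i> + integral {0..x} (\<lambda>s. p s * (cnj (z s) / 2))"
    using linear_ode_existence[OF p L, of \<i>] by blast
  show ?thesis
  proof
    \<comment> \<open>The flow is linear over the reals. Its values \<open>y\<close> and
      \<open>z\<close> on 1 and \<open>\<i>\<close> determine its complex linear part
      \<open>(y - \<i> z) / 2\<close> and its antilinear part
      \<open>(y + \<i> z) / 2\<close>.\<close>
    show "continuous_on {0..L} (\<lambda>x. (y x - \<i> * z x) / 2)" "continuous_on {0..L} (\<lambda>x. (y x + \<i> * z x) / 2)"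
      by (auto intro!: continuous_intros y z)
    show "(y 0 - \<i> * z 0) / 2 = 1" "(y 0 + \<i> * z 0) / 2 = 0"
      using y(2)[of 0] z(2)[of 0] L by simp_all
    fix x assume x: "x \<in> {0<..<L}" "isCont p x"
    note dy = linear_ode_derivative[OF p y x]
    note dz = linear_ode_derivative[OF p z x]
    have "((\<lambda>x. (1/2) * (y x - \<i> * z x)) has_vector_derivative
        (1/2) * (p x * cnj (y x) / 2 - \<i> * (p x * cnj (z x) / 2))) (at x)"
      by (intro has_vector_derivative_diff has_vector_derivative_mult_right dy dz)
    then show "((\<lambda>x. (y x - \<i> * z x) / 2) has_vector_derivative p x * cnj ((y x + \<i> * z x) / 2) / 2) (at x)"
      by (simp add: algebra_simps diff_divide_distrib)
    have "((\<lambda>x. (1/2) * (y x + \<i> * z x)) has_vector_derivative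
        (1/2) * (p x * cnj (y x) / 2 + \<i> * (p x * cnj (z x) / 2))) (at x)"
      by (intro has_vector_derivative_add has_vector_derivative_mult_right dy dz)
    then show "((\<lambda>x. (y x + \<i> * z x) / 2) has_vector_derivative p x * cnj ((y x - \<i> * z x) / 2) / 2) (at x)"
      by (simp add: algebra_simps add_divide_distrib)
  qed
qed

section \<open>Wirtinger's inequality and the area\<close>

lemma has_integral_nonneg_off_countable:
  fixes f :: "real \<Rightarrow> real"
  assumes "(f has_integral I) {a..b}" "countable D" "\<And>x. x \<in> {a<..<b} - D \<Longrightarrow> 0 \<le> f x"
  shows "0 \<le> I"
proof -
  have E: "negligible (D \<union> {a,b})" using assms(2) by (auto intro: countable_imp_negligible)
  have "((\<lambda>x. if x \<in> D \<union> {a,b} then 0 else f x) has_integral I) {a..b}"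
    using assms(1) by (rule has_integral_spike[OF E, rotated]) auto
  then show ?thesis
    by (rule has_integral_nonneg) (use assms(3) in auto)
qed

text \<open>Comparing with \<open>k tan (k y)\<close> for \<open>k < 1\<close> keeps the antiderivative \<open>-h\<^sup>2 k tan (k y)\<close> regular at the ends.\<close>

lemma wirtinger_half_period:
  fixes \<alpha> h q \<omega> :: "real \<Rightarrow> real"
  assumes lr: "l \<le> r" and D: "countable D"
    and cont: "continuous_on {l..r} \<alpha>" "continuous_on {l..r} h"
    and der: "\<And>x. x \<in> {l<..<r} - D \<Longrightarrow> (\<alpha> has_real_derivative \<omega> x) (at x)"
      "\<And>x. x \<in> {l<..<r} - D \<Longrightarrow> (h has_real_derivative \<omega> x * q x) (at x)"
    and \<omega>: "\<And>x. x \<in> {l<..<r} - D \<Longrightarrow> \<omega> x \<ge> 0"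
    and \<alpha>: "\<alpha> r = \<alpha> l + pi" and h0: "h l = 0" "h r = 0"
    and I: "((\<lambda>x. \<omega> x * (q x)\<^sup>2) has_integral I1) {l..r}" "((\<lambda>x. \<omega> x * (h x)\<^sup>2) has_integral I2) {l..r}"
  shows "I2 \<le> I1"
proof -
  define y where "y x = \<alpha> x - \<alpha> l - pi/2" for x
  have mono: "\<alpha> s \<le> \<alpha> t" if "l \<le> s" "s \<le> t" "t \<le> r" for s t
    by (rule nondecreasing_off_countable[OF that(2) D, where f' = \<omega>])
       (use that der(1) \<omega> in \<open>auto intro: continuous_on_subset[OF cont(1)] simp flip: has_real_derivative_iff_has_vector_derivative\<close>)
  have y: "\<bar>y x\<bar> \<le> pi/2" if "x \<in> {l..r}" for x
    using mono[of l x] mono[of x r] that \<alpha> by (auto simp: y_def abs_if)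
  have k: "k\<^sup>2 * I2 \<le> I1" if k: "0 < k" "k < 1" for k
  proof -
    have ky: "cos (k * y x) > 0" if "x \<in> {l..r}" for x
    proof (rule cos_gt_zero_pi)
      have "\<bar>k * y x\<bar> \<le> k * (pi/2)" using y[OF that] k by (simp add: abs_mult)
      also have "\<dots> < pi/2" using k by simp
      finally show "- (pi/2) < k * y x" "k * y x < pi/2" by auto
    qed
    define P where "P x = - (h x)\<^sup>2 * k * tan (k * y x)" for x
    \<comment> \<open>The derivative of \<open>P\<close>, with the square completed by means of
      \<open>tan' = 1 + tan\<^sup>2\<close>. The inequality arises from dropping the square.\<close>
    define P' where "P' x = \<omega> x * (q x)\<^sup>2 - k\<^sup>2 * (\<omega> x * (h x)\<^sup>2) - \<omega> x * (q x + h x * k * tan (k * y x))\<^sup>2" for x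
    have "(P has_vector_derivative P' x) (at x)" if x: "x \<in> {l<..<r} - D" for x
    proof -
      have nz: "cos (k * y x) \<noteq> 0" using ky[of x] x by auto
      have t: "inverse ((cos (k * y x))\<^sup>2) = 1 + (tan (k * y x))\<^sup>2"
        using tan_sec[OF nz] by (simp add: power_inverse)
      have "(P has_real_derivative (- (2 * h x * (\<omega> x * q x)) * k * tan (k * y x)
          + - (h x)\<^sup>2 * k * ((1 + (tan (k * y x))\<^sup>2) * (k * \<omega> x)))) (at x)"
        unfolding P_def y_def using nz t[unfolded y_def]
        by (auto intro!: derivative_eq_intros der x simp: y_def)
      also have "(- (2 * h x * (\<omega> x * q x)) * k * tan (k * y x)
          + - (h x)\<^sup>2 * k * ((1 + (tan (k * y x))\<^sup>2) * (k * \<omega> x))) = P' x"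
        unfolding P'_def by (simp add: power2_eq_square algebra_simps)
      finally show ?thesis by (simp add: has_real_derivative_iff_has_vector_derivative)
    qed
    moreover have "continuous_on {l..r} P"
      unfolding P_def y_def
      by (intro continuous_intros cont) (use ky in \<open>force simp: y_def\<close>)
    ultimately have "(P' has_integral (P r - P l)) {l..r}"
      by (intro fundamental_theorem_of_calculus_countable[OF lr D])
    then have "(P' has_integral 0) {l..r}" by (simp add: P_def h0)
    then have "((\<lambda>x. \<omega> x * (q x)\<^sup>2 - k\<^sup>2 * (\<omega> x * (h x)\<^sup>2) - P' x) has_integral (I1 - k\<^sup>2 * I2 - 0)) {l..r}"
      by (intro has_integral_diff has_integral_mult_right I)
    then have "0 \<le> I1 - k\<^sup>2 * I2 - 0"
      by (rule has_integral_nonneg_off_countable[OF _ D]) (use \<omega> in \<open>auto simp: P'_def\<close>)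
    then show ?thesis by simp
  qed
  have "((\<lambda>k. k\<^sup>2 * I2) \<longlongrightarrow> 1\<^sup>2 * I2) (at_left 1)"
    by (intro tendsto_intros)
  moreover have "eventually (\<lambda>k. k\<^sup>2 * I2 \<le> I1) (at_left (1::real))"
    by (rule eventually_mono[OF eventually_at_left_real[of 0 1]]) (auto intro: k)
  ultimately show ?thesis
    using tendsto_upperbound[of "\<lambda>k. k\<^sup>2 * I2" "1\<^sup>2 * I2" "at_left 1" I1] by simp
qed

text \<open>Subtracting a multiple of \<open>cos\<close> makes \<open>b\<close> take equal values at two antipodal parameters;
  this does not change the quadratic functional, which vanishes on the first harmonics.\<close>

theorem wirtinger:
  fixes \<alpha> b q \<omega> :: "real \<Rightarrow> real"
  assumes L: "0 \<le> L" and D: "countable D"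
    and cont: "continuous_on {0..L} \<alpha>" "continuous_on {0..L} b" "continuous_on {0..L} q"
    and der: "\<And>x. x \<in> {0<..<L} - D \<Longrightarrow> (\<alpha> has_real_derivative \<omega> x) (at x)"
      "\<And>x. x \<in> {0<..<L} - D \<Longrightarrow> (b has_real_derivative \<omega> x * q x) (at x)"
    and \<omega>: "\<And>x. x \<in> {0<..<L} - D \<Longrightarrow> \<omega> x \<ge> 0"
    and int: "\<And>f. continuous_on {0..L} f \<Longrightarrow> (\<lambda>x. \<omega> x * f x) integrable_on {0..L}"
    and \<alpha>: "\<alpha> L = \<alpha> 0 + 2 * pi" and b: "b L = b 0"
    and mean: "((\<lambda>x. \<omega> x * b x) has_integral 0) {0..L}"
    and I: "((\<lambda>x. \<omega> x * ((q x)\<^sup>2 - (b x)\<^sup>2)) has_integral I) {0..L}"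
  shows "0 \<le> I"
proof -
  obtain m where m: "0 \<le> m" "m \<le> L" "\<alpha> m = \<alpha> 0 + pi"
    using IVT'[of \<alpha> 0 "\<alpha> 0 + pi" L] L cont(1) \<alpha> pi_ge_zero by auto
  \<comment> \<open>With these two constants \<open>h\<close> vanishes at 0, \<open>m\<close> and
    \<open>L\<close>, which splits the period into two half periods.\<close>
  define A where "A = (b 0 - b m) / 2"
  define c where "c = (b 0 + b m) / 2"
  define h where "h x = b x - A * cos (\<alpha> x - \<alpha> 0) - c" for x
  define q' where "q' x = q x + A * sin (\<alpha> x - \<alpha> 0)" for x
  have h0: "h 0 = 0" "h m = 0" "h L = 0"
    by (auto simp: h_def m \<alpha> b A_def c_def field_simps)
  have ch: "continuous_on {0..L} h" and cq': "continuous_on {0..L} q'"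
    unfolding h_def q'_def by (intro continuous_intros cont)+
  have dh: "(h has_real_derivative \<omega> x * q' x) (at x)" if "x \<in> {0<..<L} - D" for x
    unfolding h_def q'_def by (auto intro!: derivative_eq_intros der that simp: algebra_simps)
  have exact: "((\<lambda>x. \<omega> x * f x) has_integral 0) {0..L}"
    if "\<And>x. x \<in> {0<..<L} - D \<Longrightarrow> (F has_real_derivative \<omega> x * f x) (at x)" "continuous_on {0..L} F" "F L = F 0"
    for F f
    using fundamental_theorem_of_calculus_countable[OF L D that(2), of "\<lambda>x. \<omega> x * f x"] that(1,3)
    by (simp add: has_real_derivative_iff_has_vector_derivative)
  have hi: "((\<lambda>x. \<omega> x * f x) has_integral integral {0..L} (\<lambda>x. \<omega> x * f x)) {0..L}"
    if "continuous_on {0..L} f" for f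
    using int[OF that] by (rule integrable_integral)
  define I1 where "I1 = integral {0..L} (\<lambda>x. \<omega> x * (q' x)\<^sup>2)"
  define I2 where "I2 = integral {0..L} (\<lambda>x. \<omega> x * (h x)\<^sup>2)"
  have I1: "((\<lambda>x. \<omega> x * (q' x)\<^sup>2) has_integral I1) {0..L}"
    and I2: "((\<lambda>x. \<omega> x * (h x)\<^sup>2) has_integral I2) {0..L}"
    unfolding I1_def I2_def by (intro hi continuous_intros ch cq')+
  have "I2 \<le> I1"
  proof -
    have sub: "(\<lambda>x. \<omega> x * f x) integrable_on {s..t}" if "continuous_on {0..L} f" "0 \<le> s" "t \<le> L" for f s t
      by (rule integrable_on_subinterval[OF int[OF that(1)]]) (use that in auto)
    have half: "integral {s..t} (\<lambda>x. \<omega> x * (h x)\<^sup>2) \<le> integral {s..t} (\<lambda>x. \<omega> x * (q' x)\<^sup>2)"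
      if st: "0 \<le> s" "s \<le> t" "t \<le> L" "\<alpha> t = \<alpha> s + pi" "h s = 0" "h t = 0" for s t
    proof (rule wirtinger_half_period[OF st(2) D, of \<alpha> h \<omega> q'])
      show "((\<lambda>x. \<omega> x * (q' x)\<^sup>2) has_integral integral {s..t} (\<lambda>x. \<omega> x * (q' x)\<^sup>2)) {s..t}"
        "((\<lambda>x. \<omega> x * (h x)\<^sup>2) has_integral integral {s..t} (\<lambda>x. \<omega> x * (h x)\<^sup>2)) {s..t}"
        by (intro integrable_integral sub continuous_intros ch cq' st)+
      show "continuous_on {s..t} \<alpha>" "continuous_on {s..t} h"
        using st by (auto intro: continuous_on_subset[OF cont(1)] continuous_on_subset[OF ch])
    qed (use st der dh \<omega> in auto)
    have "I2 = integral {0..m} (\<lambda>x. \<omega> x * (h x)\<^sup>2) + integral {m..L} (\<lambda>x. \<omega> x * (h x)\<^sup>2)"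
      unfolding I2_def using m
      by (intro Henstock_Kurzweil_Integration.integral_combine[symmetric] int continuous_intros ch)
    also have "\<dots> \<le> integral {0..m} (\<lambda>x. \<omega> x * (q' x)\<^sup>2) + integral {m..L} (\<lambda>x. \<omega> x * (q' x)\<^sup>2)"
      by (intro add_mono half) (use m h0 \<alpha> in auto)
    also have "\<dots> = I1"
      unfolding I1_def using m
      by (intro Henstock_Kurzweil_Integration.integral_combine int continuous_intros cq')
    finally show ?thesis .
  qed
  define J where "J = integral {0..L} (\<lambda>x. \<omega> x * h x)"
  have J: "((\<lambda>x. \<omega> x * h x) has_integral J) {0..L}"
    unfolding J_def by (intro hi ch)
  have one: "((\<lambda>x. \<omega> x * 1) has_integral 2 * pi) {0..L}"
    using fundamental_theorem_of_calculus_countable[OF L D cont(1), of "\<lambda>x. \<omega> x * 1"] der(1) \<alpha>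
    by (simp add: has_real_derivative_iff_has_vector_derivative)
  have cosi: "((\<lambda>x. \<omega> x * cos (\<alpha> x - \<alpha> 0)) has_integral 0) {0..L}"
    by (rule exact[of "\<lambda>x. sin (\<alpha> x - \<alpha> 0)"])
       (auto intro!: derivative_eq_intros der continuous_intros cont simp: \<alpha>)
  have "((\<lambda>x. \<omega> x * h x + A * (\<omega> x * cos (\<alpha> x - \<alpha> 0)) + c * (\<omega> x * 1)) has_integral (J + A * 0 + c * (2 * pi))) {0..L}"
    by (intro has_integral_add has_integral_mult_right J cosi one)
  also have "(\<lambda>x. \<omega> x * h x + A * (\<omega> x * cos (\<alpha> x - \<alpha> 0)) + c * (\<omega> x * 1)) = (\<lambda>x. \<omega> x * b x)"
    by (auto simp: h_def algebra_simps)
  finally have "0 = J + A * 0 + c * (2 * pi)" by (rule has_integral_unique[OF mean])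
  \<comment> \<open>Because \<open>b\<close> has mean zero, so has \<open>h + c\<close>; the
    constant then contributes \<open>2 \<pi> c\<^sup>2\<close> to the functional, with the
    favourable sign.\<close>
  then have J': "J = - 2 * pi * c" by (simp add: algebra_simps)
  \<comment> \<open>The terms that contain the first harmonic together form the derivative of a
    function with equal values at both ends.\<close>
  have ex: "((\<lambda>x. \<omega> x * (-2 * A * (q' x * sin (\<alpha> x - \<alpha> 0) + (h x + c) * cos (\<alpha> x - \<alpha> 0))
      + A\<^sup>2 * ((sin (\<alpha> x - \<alpha> 0))\<^sup>2 - (cos (\<alpha> x - \<alpha> 0))\<^sup>2))) has_integral 0) {0..L}"
    by (rule exact[of "\<lambda>x. -2 * A * ((h x + c) * sin (\<alpha> x - \<alpha> 0)) - A\<^sup>2 * (sin (\<alpha> x - \<alpha> 0) * cos (\<alpha> x - \<alpha> 0))"])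
       (auto intro!: derivative_eq_intros der dh continuous_intros cont ch simp: \<alpha> h0 algebra_simps power2_eq_square)
  have "((\<lambda>x. \<omega> x * (q' x)\<^sup>2 - \<omega> x * (h x)\<^sup>2 - 2 * c * (\<omega> x * h x) - c\<^sup>2 * (\<omega> x * 1)
      + \<omega> x * (-2 * A * (q' x * sin (\<alpha> x - \<alpha> 0) + (h x + c) * cos (\<alpha> x - \<alpha> 0))
      + A\<^sup>2 * ((sin (\<alpha> x - \<alpha> 0))\<^sup>2 - (cos (\<alpha> x - \<alpha> 0))\<^sup>2)))
      has_integral (I1 - I2 - 2 * c * J - c\<^sup>2 * (2 * pi) + 0)) {0..L}"
    by (intro has_integral_add has_integral_diff has_integral_mult_right I1 I2 J one ex)
  also have "(\<lambda>x. \<omega> x * (q' x)\<^sup>2 - \<omega> x * (h x)\<^sup>2 - 2 * c * (\<omega> x * h x) - c\<^sup>2 * (\<omega> x * 1)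
      + \<omega> x * (-2 * A * (q' x * sin (\<alpha> x - \<alpha> 0) + (h x + c) * cos (\<alpha> x - \<alpha> 0))
      + A\<^sup>2 * ((sin (\<alpha> x - \<alpha> 0))\<^sup>2 - (cos (\<alpha> x - \<alpha> 0))\<^sup>2)))
    = (\<lambda>x. \<omega> x * ((q x)\<^sup>2 - (b x)\<^sup>2))"
  proof
    fix x
    have b: "b x = h x + c + A * cos (\<alpha> x - \<alpha> 0)" and q: "q x = q' x - A * sin (\<alpha> x - \<alpha> 0)"
      by (simp_all add: h_def q'_def)
    show "\<omega> x * (q' x)\<^sup>2 - \<omega> x * (h x)\<^sup>2 - 2 * c * (\<omega> x * h x) - c\<^sup>2 * (\<omega> x * 1)
      + \<omega> x * (-2 * A * (q' x * sin (\<alpha> x - \<alpha> 0) + (h x + c) * cos (\<alpha> x - \<alpha> 0))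
      + A\<^sup>2 * ((sin (\<alpha> x - \<alpha> 0))\<^sup>2 - (cos (\<alpha> x - \<alpha> 0))\<^sup>2)) = \<omega> x * ((q x)\<^sup>2 - (b x)\<^sup>2)"
      unfolding b q by (simp add: power2_eq_square algebra_simps)
  qed
  finally have "I = I1 - I2 - 2 * c * J - c\<^sup>2 * (2 * pi) + 0"
    using has_integral_unique[OF I] by blast
  also have "\<dots> = I1 - I2 + 2 * pi * c\<^sup>2" unfolding J' by (simp add: power2_eq_square)
  also have "\<dots> \<ge> 0" using \<open>I2 \<le> I1\<close> by (auto intro: add_nonneg_nonneg)
  finally show ?thesis .
qed

text \<open>With \<open>u = V / |V|\<close> and \<open>\<eta> = ln (C + |V|)\<close>, the curve \<open>\<gamma> - \<eta> u\<close> has the direction \<open>u\<close> as normal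
  and the support function \<open>g\<close>, to whose derivative \<open>b\<close> Wirtinger's inequality is applied.\<close>

theorem rolling_area_bound:
  fixes gx gy px py Vx Vy C \<alpha> :: "real \<Rightarrow> real"
  defines "r \<equiv> \<lambda>x. sqrt ((Vx x)\<^sup>2 + (Vy x)\<^sup>2)"
  assumes L: "0 \<le> L" and D: "countable D"
    and cont: "continuous_on {0..L} gx" "continuous_on {0..L} gy" "continuous_on {0..L} Vx"
      "continuous_on {0..L} Vy" "continuous_on {0..L} C" "continuous_on {0..L} \<alpha>"
    and closed: "gx L = gx 0" "gy L = gy 0" "Vx L = Vx 0" "Vy L = Vy 0" "C L = C 0" "\<alpha> L = \<alpha> 0 + 2 * pi"
    and dg: "\<And>x. x \<in> {0<..<L} - D \<Longrightarrow> (gx has_real_derivative px x) (at x)"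
      "\<And>x. x \<in> {0<..<L} - D \<Longrightarrow> (gy has_real_derivative py x) (at x)"
    and dV: "\<And>x. x \<in> {0<..<L} - D \<Longrightarrow> (Vx has_real_derivative C x * px x) (at x)"
      "\<And>x. x \<in> {0<..<L} - D \<Longrightarrow> (Vy has_real_derivative C x * py x) (at x)"
    and dC: "\<And>x. x \<in> {0<..<L} - D \<Longrightarrow> (C has_real_derivative Vx x * px x + Vy x * py x) (at x)"
    and d\<alpha>: "\<And>x. x \<in> {0<..<L} - D \<Longrightarrow>
      (\<alpha> has_real_derivative C x * (Vx x * py x - Vy x * px x) / (r x)\<^sup>2) (at x)"
    and nz: "\<And>x. x \<in> {0..L} \<Longrightarrow> 0 < r x" "\<And>x. x \<in> {0..L} \<Longrightarrow> r x \<le> C x"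
    and pos: "\<And>x. x \<in> {0<..<L} - D \<Longrightarrow> 0 \<le> Vx x * py x - Vy x * px x"
    and int: "\<And>f. continuous_on {0..L} f \<Longrightarrow> (\<lambda>x. px x * f x) integrable_on {0..L}"
      "\<And>f. continuous_on {0..L} f \<Longrightarrow> (\<lambda>x. py x * f x) integrable_on {0..L}"
    and I: "((\<lambda>x. gx x * py x - gy x * px x) has_integral I) {0..L}"
  shows "I \<le> 2 * pi"
proof -
  define ux where "ux x = Vx x / r x" for x
  define uy where "uy x = Vy x / r x" for x
  \<comment> \<open>\<open>\<omega>\<close> is the derivative of \<open>\<alpha>\<close>, and
    \<open>X\<close> the component of the tangent along \<open>u\<close>, which turns out to be the
    derivative of \<open>\<eta>\<close>.\<close>
  define \<omega> where "\<omega> x = C x * (ux x * py x - uy x * px x) / r x" for x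
  define X where "X x = ux x * px x + uy x * py x" for x
  define \<eta> where "\<eta> x = ln (C x + r x)" for x
  define T where "T x = r x / C x" for x
  \<comment> \<open>\<open>a\<close> and \<open>b\<close> are the coordinates of
    \<open>\<gamma>\<close> in the moving frame of \<open>u\<close> and its left normal.
    Differentiating in the angle gives \<open>g' = b\<close> and \<open>b' = s - g\<close>, so
    \<open>s = g + g''\<close> is the radius of curvature of
    \<open>\<gamma> - \<eta> u\<close>.\<close>
  define a where "a x = gx x * ux x + gy x * uy x" for x
  define b where "b x = gy x * ux x - gx x * uy x" for x
  define s where "s x = T x - \<eta> x" for x
  define g where "g x = a x - \<eta> x" for x
  have r2: "(r x)\<^sup>2 = (Vx x)\<^sup>2 + (Vy x)\<^sup>2" for x by (simp add: r_def)
  have Cpos: "0 < C x" if "x \<in> {0..L}" for x using nz[OF that] by linarith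
  have u1: "ux x * ux x + uy x * uy x = 1" if "x \<in> {0..L}" for x
  proof -
    have "ux x * ux x + uy x * uy x = ((Vx x)\<^sup>2 + (Vy x)\<^sup>2) / (r x)\<^sup>2"
      by (simp add: ux_def uy_def power2_eq_square add_divide_distrib)
    also have "\<dots> = 1" using nz(1)[OF that] by (simp flip: r2)
    finally show ?thesis .
  qed
  have cr: "continuous_on {0..L} r" unfolding r_def by (intro continuous_intros cont)
  have cu: "continuous_on {0..L} ux" "continuous_on {0..L} uy"
    unfolding ux_def uy_def by (intro continuous_intros cont cr; use nz in force)+
  have c\<eta>: "continuous_on {0..L} \<eta>"
    unfolding \<eta>_def using nz Cpos by (intro continuous_intros cont cr) (force dest: add_pos_pos)
  have cT: "continuous_on {0..L} T"
    unfolding T_def using Cpos by (intro continuous_intros cont cr) force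
  have ca: "continuous_on {0..L} a" and cb: "continuous_on {0..L} b"
    unfolding a_def b_def by (intro continuous_intros cont cu)+
  have cg: "continuous_on {0..L} g" and cs: "continuous_on {0..L} s"
    unfolding g_def s_def by (intro continuous_intros ca c\<eta> cT)+
  have cl: "r L = r 0" "ux L = ux 0" "uy L = uy 0" "\<eta> L = \<eta> 0" "T L = T 0" "b L = b 0" "g L = g 0"
    by (simp_all add: r_def ux_def uy_def \<eta>_def T_def b_def g_def a_def closed)
  have \<omega>0: "0 \<le> \<omega> x" if x: "x \<in> {0<..<L} - D" for x
  proof -
    have "\<omega> x = C x * (Vx x * py x - Vy x * px x) / (r x)\<^sup>2"
      by (simp add: \<omega>_def ux_def uy_def power2_eq_square diff_divide_distrib[symmetric])
    then show ?thesis using pos[OF x] Cpos[of x] x by simp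
  qed
  have d\<alpha>': "(\<alpha> has_real_derivative \<omega> x) (at x)" if x: "x \<in> {0<..<L} - D" for x
    using d\<alpha>[OF x] by (simp add: \<omega>_def ux_def uy_def power2_eq_square diff_divide_distrib[symmetric])
  have dr: "(r has_real_derivative C x * X x) (at x)" if x: "x \<in> {0<..<L} - D" for x
  proof -
    have "0 < (Vx x)\<^sup>2 + (Vy x)\<^sup>2" using nz(1)[of x] x by (simp add: r_def)
    then show ?thesis
      unfolding r_def X_def ux_def uy_def
      by (auto intro!: derivative_eq_intros dV x simp: add_divide_distrib distrib_left)
        (simp add: divide_inverse mult_ac)
  qed
  have dux: "(ux has_real_derivative - \<omega> x * uy x) (at x)" if x: "x \<in> {0<..<L} - D" for x
  proof -
    have rx: "r x \<noteq> 0" using nz(1)[of x] x by simp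
    have "(ux has_real_derivative (C x * px x * r x - Vx x * (C x * X x)) / (r x * r x)) (at x)"
      unfolding ux_def by (intro DERIV_divide dV dr x rx)
    also have "(C x * px x * r x - Vx x * (C x * X x)) / (r x * r x) = C x / r x * (px x - ux x * X x)"
      using rx by (simp add: ux_def field_simps)
    also have "px x - ux x * X x = px x * (ux x * ux x + uy x * uy x) - ux x * X x"
      using u1[of x] x by simp
    also have "C x / r x * \<dots> = - \<omega> x * uy x"
      unfolding X_def \<omega>_def by (simp add: algebra_simps diff_divide_distrib)
    finally show ?thesis .
  qed
  have duy: "(uy has_real_derivative \<omega> x * ux x) (at x)" if x: "x \<in> {0<..<L} - D" for x
  proof -
    have rx: "r x \<noteq> 0" using nz(1)[of x] x by simp
    have "(uy has_real_derivative (C x * py x * r x - Vy x * (C x * X x)) / (r x * r x)) (at x)"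
      unfolding uy_def by (intro DERIV_divide dV dr x rx)
    also have "(C x * py x * r x - Vy x * (C x * X x)) / (r x * r x) = C x / r x * (py x - uy x * X x)"
      using rx by (simp add: uy_def field_simps)
    also have "py x - uy x * X x = py x * (ux x * ux x + uy x * uy x) - uy x * X x"
      using u1[of x] x by simp
    also have "C x / r x * \<dots> = \<omega> x * ux x"
      unfolding X_def \<omega>_def by (simp add: field_simps)
    finally show ?thesis .
  qed
  have d\<eta>: "(\<eta> has_real_derivative X x) (at x)" if x: "x \<in> {0<..<L} - D" for x
  proof -
    have rC: "r x > 0" "C x > 0" using nz(1)[of x] Cpos[of x] x by simp_all
    have CX: "Vx x * px x + Vy x * py x = r x * X x" using rC by (simp add: X_def ux_def uy_def field_simps)
    have "(\<eta> has_real_derivative inverse (C x + r x) * ((Vx x * px x + Vy x * py x) + C x * X x)) (at x)"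
      unfolding \<eta>_def by (rule DERIV_chain2[OF DERIV_ln DERIV_add[OF dC[OF x] dr[OF x]]]) (use rC in simp)
    also have "inverse (C x + r x) * ((Vx x * px x + Vy x * py x) + C x * X x) = X x"
      unfolding CX using rC by (simp add: field_simps)
    finally show ?thesis .
  qed
  have TY: "ux x * py x - uy x * px x = T x * \<omega> x" if "x \<in> {0..L}" for x
    using nz(1)[OF that] Cpos[OF that] by (simp add: T_def \<omega>_def field_simps)
  have dg': "(g has_real_derivative \<omega> x * b x) (at x)" if x: "x \<in> {0<..<L} - D" for x
    unfolding g_def a_def
    by (auto intro!: derivative_eq_intros dg dux duy d\<eta> x simp: X_def b_def algebra_simps)
  have db: "(b has_real_derivative \<omega> x * (s x - g x)) (at x)" if x: "x \<in> {0<..<L} - D" for x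
  proof -
    have "(b has_real_derivative (ux x * py x - uy x * px x) - \<omega> x * a x) (at x)"
      unfolding b_def by (auto intro!: derivative_eq_intros dg dux duy x simp: a_def algebra_simps)
    then show ?thesis using TY[of x] x by (simp add: s_def g_def algebra_simps)
  qed
  have int\<omega>: "(\<lambda>x. \<omega> x * f x) integrable_on {0..L}" if "continuous_on {0..L} f" for f
  proof -
    have "(\<lambda>x. py x * (C x * ux x / r x * f x) - px x * (C x * uy x / r x * f x)) integrable_on {0..L}"
      by (intro integrable_diff int continuous_intros that cont cu cr) (use nz in force)+
    then show ?thesis
      by (rule integrable_eq) (simp add: \<omega>_def algebra_simps diff_divide_distrib)
  qed
  have hi: "((\<lambda>x. \<omega> x * f x) has_integral integral {0..L} (\<lambda>x. \<omega> x * f x)) {0..L}"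
    if "continuous_on {0..L} f" for f
    using int\<omega>[OF that] by (rule integrable_integral)
  have exact: "(F' has_integral 0) {0..L}"
    if "\<And>x. x \<in> {0<..<L} - D \<Longrightarrow> (F has_real_derivative F' x) (at x)" "continuous_on {0..L} F" "F L = F 0"
    for F F'
    using fundamental_theorem_of_calculus_countable[OF L D that(2), of F'] that(1,3)
    by (simp add: has_real_derivative_iff_has_vector_derivative)
  \<comment> \<open>Wirtinger's functional for \<open>b\<close>, whose derivative in the angle is
    \<open>s - g\<close>. The mean of \<open>b\<close> vanishes because \<open>b\<close> is itself
    the angular derivative of the closed function \<open>g\<close>.\<close>
  define W where "W = integral {0..L} (\<lambda>x. \<omega> x * ((s x - g x)\<^sup>2 - (b x)\<^sup>2))"
  have W: "((\<lambda>x. \<omega> x * ((s x - g x)\<^sup>2 - (b x)\<^sup>2)) has_integral W) {0..L}"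
    unfolding W_def by (intro hi continuous_intros cs cg cb)
  have W0: "0 \<le> W"
  proof (rule wirtinger[OF L D cont(6) cb _ d\<alpha>' db \<omega>0 int\<omega> closed(6) cl(6) _ W])
    show "continuous_on {0..L} (\<lambda>x. s x - g x)" by (intro continuous_intros cs cg)
    show "((\<lambda>x. \<omega> x * b x) has_integral 0) {0..L}" by (rule exact[OF dg' cg cl(7)])
  qed
  have T2: "((\<lambda>x. \<omega> x * (1 - (T x)\<^sup>2)) has_integral integral {0..L} (\<lambda>x. \<omega> x * (1 - (T x)\<^sup>2))) {0..L}"
    by (intro hi continuous_intros cT)
  \<comment> \<open>\<open>T \<le> 1\<close> expresses that the fixed vector is timelike or
    lightlike; the defect \<open>1 - T\<^sup>2\<close> of the turning is given up here.\<close>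
  have T20: "0 \<le> integral {0..L} (\<lambda>x. \<omega> x * (1 - (T x)\<^sup>2))"
  proof (rule has_integral_nonneg_off_countable[OF T2 D])
    fix x assume x: "x \<in> {0<..<L} - D"
    then have "0 \<le> T x" "T x \<le> 1" using nz[of x] Cpos[of x] by (auto simp: T_def)
    then show "0 \<le> \<omega> x * (1 - (T x)\<^sup>2)" using \<omega>0[OF x] by (simp add: power_le_one)
  qed
  have one: "((\<lambda>x. \<omega> x * 1) has_integral 2 * pi) {0..L}"
    using fundamental_theorem_of_calculus_countable[OF L D cont(6), of "\<lambda>x. \<omega> x * 1"] d\<alpha>' closed(6)
    by (simp add: has_real_derivative_iff_has_vector_derivative)
  \<comment> \<open>The derivative of the closed function \<open>(\<eta> + g) b = a b\<close>. Up to
    this exact term, the density of twice the area is \<open>\<omega> T\<^sup>2\<close> minus the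
    Wirtinger density.\<close>
  define F' where "F' x = X x * b x + \<eta> x * (\<omega> x * (s x - g x)) + (\<omega> x * b x * b x + g x * (\<omega> x * (s x - g x)))" for x
  have F': "(F' has_integral 0) {0..L}"
  proof (rule exact)
    show "((\<lambda>x. \<eta> x * b x + g x * b x) has_real_derivative F' x) (at x)" if x: "x \<in> {0<..<L} - D" for x
      unfolding F'_def by (auto intro!: derivative_eq_intros d\<eta> db dg' x simp: algebra_simps)
    show "continuous_on {0..L} (\<lambda>x. \<eta> x * b x + g x * b x)" by (intro continuous_intros c\<eta> cb cg)
  qed (simp add: cl)
  have "((\<lambda>x. \<omega> x * 1 - \<omega> x * (1 - (T x)\<^sup>2) - \<omega> x * ((s x - g x)\<^sup>2 - (b x)\<^sup>2) - F' x) has_integral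
      (2 * pi - integral {0..L} (\<lambda>x. \<omega> x * (1 - (T x)\<^sup>2)) - W - 0)) {0..L}"
    by (intro has_integral_diff one T2 W F')
  moreover have "((\<lambda>x. \<omega> x * 1 - \<omega> x * (1 - (T x)\<^sup>2) - \<omega> x * ((s x - g x)\<^sup>2 - (b x)\<^sup>2) - F' x) has_integral I) {0..L}"
  proof (rule has_integral_eq[OF _ I])
    fix x assume x: "x \<in> {0..L}"
    have "gx x * py x - gy x * px x = (gx x * py x - gy x * px x) * (ux x * ux x + uy x * uy x)"
      using u1[OF x] by simp
    also have "\<dots> = a x * (ux x * py x - uy x * px x) - b x * X x"
      unfolding a_def b_def X_def by (simp add: algebra_simps)
    also have "\<dots> = (g x + \<eta> x) * ((s x + \<eta> x) * \<omega> x) - b x * X x"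
      unfolding TY[OF x] by (simp add: g_def s_def)
    also have "\<dots> = \<omega> x * 1 - \<omega> x * (1 - (s x + \<eta> x)\<^sup>2) - \<omega> x * ((s x - g x)\<^sup>2 - (b x)\<^sup>2) - F' x"
      unfolding F'_def by (simp add: algebra_simps power2_eq_square)
    also have "s x + \<eta> x = T x" by (simp add: s_def)
    finally show "gx x * py x - gy x * px x = \<omega> x * 1 - \<omega> x * (1 - (T x)\<^sup>2) - \<omega> x * ((s x - g x)\<^sup>2 - (b x)\<^sup>2) - F' x" .
  qed
  ultimately have "I = 2 * pi - integral {0..L} (\<lambda>x. \<omega> x * (1 - (T x)\<^sup>2)) - W - 0"
    using has_integral_unique by blast
  then show ?thesis using T20 W0 by linarith
qed

section \<open>The position of the origin\<close>

text \<open>Takes the place of the intermediate value theorem for a tangent angle, which is monotone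
  but may jump over the value \<open>v\<close>.\<close>

lemma monotone_threshold:
  fixes \<psi> :: "real \<Rightarrow> real"
  assumes "mono_on {a..b} \<psi>" "a \<le> b"
  obtains m where "a \<le> m" "m \<le> b" "\<And>x. a \<le> x \<Longrightarrow> x < m \<Longrightarrow> \<psi> x \<le> v"
    "\<And>x. m < x \<Longrightarrow> x \<le> b \<Longrightarrow> v \<le> \<psi> x"
proof -
  define S where "S = insert a {x \<in> {a..b}. \<psi> x \<le> v}"
  have S: "S \<noteq> {}" "bdd_above S" "\<And>x. x \<in> S \<Longrightarrow> a \<le> x \<and> x \<le> b"
    using assms(2) by (auto simp: S_def intro!: bdd_aboveI[of _ b])
  show ?thesis
  proof
    show "a \<le> Sup S" using S(2) by (intro cSup_upper) (auto simp: S_def)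
    show "Sup S \<le> b" using S by (intro cSup_least) auto
    fix x
    show "\<psi> x \<le> v" if x: "a \<le> x" "x < Sup S"
    proof -
      obtain y where y: "y \<in> S" "x < y" using less_cSup_iff[OF S(1,2)] x by blast
      then have "y \<in> {a..b}" "\<psi> y \<le> v" using x by (auto simp: S_def)
      moreover have "\<psi> x \<le> \<psi> y" using assms(1) x y calculation by (auto simp: mono_on_def)
      ultimately show ?thesis by simp
    qed
    show "v \<le> \<psi> x" if x: "Sup S < x" "x \<le> b"
    proof (rule ccontr)
      assume "\<not> v \<le> \<psi> x"
      then have "x \<in> S" using x \<open>a \<le> Sup S\<close> by (auto simp: S_def)
      then show False using cSup_upper[OF _ S(2)] x by fastforce
    qed
  qed
qed

text \<open>On the horizontal line at height \<open>y\<close>, with \<kappa> = \<epsilon> +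
  \<open>y\<^sup>2\<close>, this quotient is \<open>Vt / C\<close>: it grows from left to
  right.\<close>

lemma strictly_increasing_over_sqrt:
  fixes \<kappa> v w :: real
  assumes "0 < \<kappa>" "v < w"
  shows "v / sqrt (\<kappa> + v\<^sup>2) < w / sqrt (\<kappa> + w\<^sup>2)"
proof (rule DERIV_pos_imp_increasing[OF assms(2)])
  fix x :: real
  define s where "s = \<kappa> + x\<^sup>2"
  have s: "s > x\<^sup>2" "s > 0" using assms(1) by (auto simp: s_def add_pos_nonneg)
  have "((\<lambda>v. v / sqrt (\<kappa> + v\<^sup>2)) has_real_derivative
      (1 * sqrt s - x * (inverse (sqrt s) / 2 * (2 * x))) / (sqrt s * sqrt s)) (at x)"
    unfolding s_def using s by (auto intro!: derivative_eq_intros simp: s_def)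
  also have "1 * sqrt s - x * (inverse (sqrt s) / 2 * (2 * x)) = (s - x\<^sup>2) / sqrt s"
    using s by (simp add: field_simps power2_eq_square)
  finally have "((\<lambda>v. v / sqrt (\<kappa> + v\<^sup>2)) has_real_derivative (s - x\<^sup>2) / sqrt s / (sqrt s * sqrt s)) (at x)" .
  moreover have "0 < (s - x\<^sup>2) / sqrt s / (sqrt s * sqrt s)"
    using s by (intro divide_pos_pos mult_pos_pos) auto
  ultimately show "\<exists>y. ((\<lambda>v. v / sqrt (\<kappa> + v\<^sup>2)) has_real_derivative y) (at x) \<and> 0 < y"
    by blast
qed

lemma DERIV_locally_constant:
  fixes f :: "real \<Rightarrow> real"
  assumes "a < x" "x < b" "\<And>y. a < y \<Longrightarrow> y < b \<Longrightarrow> f y = c"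
  shows "(f has_real_derivative 0) (at x)"
  by (rule has_field_derivative_transform_within_open[OF DERIV_const, of "{a<..<b}" _ c])
     (use assms in auto)

text \<open>\<open>V\<close> and \<open>\<gamma>\<close> are convex curves with \<open>\<gamma>' = V' / C\<close>. If \<open>V\<close> stayed in the half-plane \<open>Vn \<ge> 0\<close>, then on each horizontal
  line meeting \<open>V\<close> twice the quotient \<open>Vt / C\<close> would be larger at the right-hand point. But the integral of
  \<open>(Vt / C) d ln (\<epsilon> + Vn\<^sup>2)\<close> is twice the gap of \<open>\<gamma>\<close> in the \<open>t\<close>-direction, which is zero. Both points are
  compared with the one on the chord \<open>Vt = ll(Vn)\<close> from the lowest to the highest point of \<open>V\<close>; the function \<open>W\<close> below is the
  accumulated difference, and \<open>E\<close> measures the signed distance to the chord.\<close>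

theorem origin_inside_rolling_curve:
  fixes \<psi> gt Vt Vn C :: "real \<Rightarrow> real"
  assumes L: "0 < L" and D: "countable D"
    and \<psi>: "mono_on {0..L} \<psi>" "\<psi> 0 = 0" "\<And>x. x \<in> {0..L} \<Longrightarrow> \<psi> x \<le> 2 * pi"
    and cont: "continuous_on {0..L} gt" "continuous_on {0..L} Vt" "continuous_on {0..L} Vn" "continuous_on {0..L} C"
    and closed: "gt L = gt 0" "Vt L = Vt 0" "Vn L = Vn 0" "C L = C 0"
    and dg: "\<And>x. x \<in> {0<..<L} - D \<Longrightarrow> (gt has_real_derivative cos (\<psi> x)) (at x)"
    and dV: "\<And>x. x \<in> {0<..<L} - D \<Longrightarrow> (Vt has_real_derivative C x * cos (\<psi> x)) (at x)"
      "\<And>x. x \<in> {0<..<L} - D \<Longrightarrow> (Vn has_real_derivative C x * sin (\<psi> x)) (at x)"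
    and dC: "\<And>x. x \<in> {0<..<L} - D \<Longrightarrow> (C has_real_derivative Vt x * cos (\<psi> x) + Vn x * sin (\<psi> x)) (at x)"
    and C: "\<And>x. x \<in> {0..L} \<Longrightarrow> 0 < C x" "\<And>x. x \<in> {0..L} \<Longrightarrow> (C x)\<^sup>2 = \<epsilon> + (Vt x)\<^sup>2 + (Vn x)\<^sup>2"
    and \<epsilon>: "0 \<le> \<epsilon>" "0 < \<epsilon> + (Vn 0)\<^sup>2"
    and nondeg: "\<And>\<delta> E. countable E \<Longrightarrow> \<exists>x \<in> {0<..<L} - E. sin (\<psi> x - \<delta>) \<noteq> 0"
  shows "Vn 0 < 0"
proof (rule ccontr)
  assume "\<not> Vn 0 < 0"
  then have Vn0: "0 \<le> Vn 0" by simp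
  have up: "f s \<le> f t"
    if "continuous_on {0..L} f" "0 \<le> s" "s \<le> t" "t \<le> L"
      "\<And>x. x \<in> {0<..<L} - D \<Longrightarrow> (f has_real_derivative f' x) (at x)"
      "\<And>x. x \<in> {s<..<t} - D \<Longrightarrow> 0 \<le> f' x" for f f' s t
    by (rule nondecreasing_off_countable[OF that(3) D, where f' = f'])
       (use that in \<open>auto intro: continuous_on_subset[OF that(1)] simp flip: has_real_derivative_iff_has_vector_derivative\<close>)
  have down: "f t \<le> f s"
    if "continuous_on {0..L} f" "0 \<le> s" "s \<le> t" "t \<le> L"
      "\<And>x. x \<in> {0<..<L} - D \<Longrightarrow> (f has_real_derivative f' x) (at x)"
      "\<And>x. x \<in> {s<..<t} - D \<Longrightarrow> f' x \<le> 0" for f f' s t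
    using up[of "\<lambda>x. - f x" s t "\<lambda>x. - f' x"] that by (auto intro: continuous_on_minus DERIV_minus)

  \<comment> \<open>Lowest and highest point of \<open>V\<close>\<close>
  have \<psi>0: "0 \<le> \<psi> x" if "x \<in> {0..L}" for x
    using \<psi>(1,2) that L by (metis atLeastAtMost_iff mono_onD less_eq_real_def)
  have \<psi>m: "\<psi> x \<le> \<psi> y" if "0 \<le> x" "x \<le> y" "y \<le> L" for x y
    using mono_onD[OF \<psi>(1), of x y] that by auto
  \<comment> \<open>Tangent angles up to \<pi> make \<open>V\<close> rise and those beyond \<pi>
    make it fall, so \<open>m\<close> is a highest point and the base point 0 a lowest one.\<close>
  obtain m where m: "0 \<le> m" "m \<le> L" "\<And>x. 0 \<le> x \<Longrightarrow> x < m \<Longrightarrow> \<psi> x \<le> pi"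
    "\<And>x. m < x \<Longrightarrow> x \<le> L \<Longrightarrow> pi \<le> \<psi> x"
    using monotone_threshold[OF \<psi>(1), of pi] L by auto
  have s1: "0 \<le> sin (\<psi> x)" if "0 < x" "x < m" for x
    using m \<psi>0[of x] that by (intro sin_ge_zero) auto
  have s2: "sin (\<psi> x) \<le> 0" if "m < x" "x < L" for x
    using m \<psi>(3)[of x] that sin_ge_zero[of "\<psi> x - pi"] by (simp add: sin_diff)
  have Vn_up: "Vn s \<le> Vn t" if "0 \<le> s" "s \<le> t" "t \<le> m" for s t
    by (rule up[OF cont(3) _ _ _ dV(2)]) (use that m s1 C(1) in \<open>auto simp: less_imp_le\<close>)
  have Vn_down: "Vn t \<le> Vn s" if "m \<le> s" "s \<le> t" "t \<le> L" for s t
    by (rule down[OF cont(3) _ _ _ dV(2)]) (use that m s2 C(1) in \<open>auto simp: mult_nonneg_nonpos less_imp_le\<close>)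
  have Vn_ge: "Vn 0 \<le> Vn x" if "x \<in> {0..L}" for x
    using Vn_up[of 0 x] Vn_down[of x L] that closed by (cases "x \<le> m") auto
  have Vn_le: "Vn x \<le> Vn m" if "x \<in> {0..L}" for x
    using Vn_up[of x m] Vn_down[of m x] that by (cases "x \<le> m") auto
  have \<kappa>: "0 < \<epsilon> + y\<^sup>2" if "Vn 0 \<le> y" for y
    using \<epsilon> power_mono[OF that Vn0, of 2] by linarith
  have Vn_const: "sin (\<psi> x) = 0" if "s < x" "x < t" "x \<notin> D" "0 \<le> s" "t \<le> L" "\<And>y. y \<in> {s<..<t} \<Longrightarrow> Vn y = c" for s t x c
  proof -
    have "(Vn has_real_derivative 0) (at x)"
      by (rule DERIV_locally_constant[of s _ t _ c]) (use that in auto)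
    moreover have "(Vn has_real_derivative C x * sin (\<psi> x)) (at x)"
      by (rule dV(2)) (use that in auto)
    ultimately have "C x * sin (\<psi> x) = 0"
      using DERIV_unique by blast
    then show ?thesis using C(1)[of x] that by auto
  qed

  \<comment> \<open>The chord from the lowest to the highest point\<close>
  define dt where "dt = Vt m - Vt 0"
  define dn where "dn = Vn m - Vn 0"
  have dn: "dn > 0"
  proof (rule ccontr)
    assume "\<not> dn > 0"
    then have Vc: "Vn x = Vn 0" if "x \<in> {0..L}" for x
      using Vn_ge[OF that] Vn_le[OF that] by (simp add: dn_def)
    have "sin (\<psi> x - 0) = 0" if "x \<in> {0<..<L} - D" for x
    proof -
      have "sin (\<psi> x) = 0"
      proof (rule Vn_const[of 0 x L "Vn 0"])
        show "Vn y = Vn 0" if "y \<in> {0<..<L}" for y by (rule Vc) (use that in simp)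
      qed (use that in auto)
      then show ?thesis by simp
    qed
    then show False using bspec nondeg[OF D, of 0] by meson
  qed
  define R where "R = sqrt (dt\<^sup>2 + dn\<^sup>2)"
  have R: "R > 0" using dn by (simp add: R_def sum_power2_gt_zero_iff)
  define \<delta> where "\<delta> = arccos (dt / R)"
  have dtR: "\<bar>dt\<bar> < R" unfolding R_def using dn by (intro real_less_rsqrt) (auto simp: )
  have \<delta>: "0 < \<delta>" "\<delta> < pi"
    using dtR R arccos_lt_bounded[of "dt / R"] by (auto simp: \<delta>_def abs_if field_simps split: if_splits)
  have "cos \<delta> = dt / R" unfolding \<delta>_def using dtR R by (intro cos_arccos) (auto simp: field_simps)
  then have cos\<delta>: "dt = R * cos \<delta>" using R by simp
  have "(R * sin \<delta>)\<^sup>2 = dn\<^sup>2"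
  proof -
    have "(R * sin \<delta>)\<^sup>2 = R\<^sup>2 - (R * cos \<delta>)\<^sup>2"
      by (simp add: power_mult_distrib sin_squared_eq algebra_simps)
    also have "\<dots> = R\<^sup>2 - dt\<^sup>2" by (simp only: cos\<delta>)
    also have "\<dots> = dn\<^sup>2" by (simp add: R_def)
    finally show ?thesis .
  qed
  then have sin\<delta>: "dn = R * sin \<delta>"
    using dn R sin_gt_zero[OF \<delta>] by (simp add: power2_eq_iff_nonneg less_imp_le)
  \<comment> \<open>The determinant of the chord and the displacement from the base point, hence
    \<open>R\<close> times the distance, positive on the left. Its derivative has the sign of
    \<open>sin (\<psi> x - \<delta>)\<close>, where \<open>\<delta>\<close> is the angle of the
    chord.\<close>
  define E where "E x = dt * (Vn x - Vn 0) - dn * (Vt x - Vt 0)" for x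
  have cE: "continuous_on {0..L} E" unfolding E_def by (intro continuous_intros cont)
  have dE: "(E has_real_derivative C x * R * sin (\<psi> x - \<delta>)) (at x)" if "x \<in> {0<..<L} - D" for x
    unfolding E_def sin\<delta> cos\<delta>
    by (auto intro!: derivative_eq_intros dV that simp: sin_diff algebra_simps)
  have E0: "E 0 = 0" "E m = 0" "E L = 0"
    by (auto simp: E_def dt_def dn_def closed algebra_simps)
  \<comment> \<open>At \<open>m1\<close> on the rising arc and at \<open>m2\<close> on the falling
    arc the tangent passes the direction of the chord; there \<open>E\<close> attains its minimum
    and its maximum.\<close>
  obtain m1 where m1: "0 \<le> m1" "m1 \<le> m" "\<And>x. 0 \<le> x \<Longrightarrow> x < m1 \<Longrightarrow> \<psi> x \<le> \<delta>"
    "\<And>x. m1 < x \<Longrightarrow> x \<le> m \<Longrightarrow> \<delta> \<le> \<psi> x"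
    using monotone_threshold[OF mono_on_subset[OF \<psi>(1)], of 0 m \<delta>] m by auto
  obtain m2 where m2: "m \<le> m2" "m2 \<le> L" "\<And>x. m \<le> x \<Longrightarrow> x < m2 \<Longrightarrow> \<psi> x \<le> \<delta> + pi"
    "\<And>x. m2 < x \<Longrightarrow> x \<le> L \<Longrightarrow> \<delta> + pi \<le> \<psi> x"
    using monotone_threshold[OF mono_on_subset[OF \<psi>(1)], of m L "\<delta> + pi"] m by auto
  have sgn: "0 \<le> C x * R * y \<longleftrightarrow> 0 \<le> y" "C x * R * y \<le> 0 \<longleftrightarrow> y \<le> 0" if "x \<in> {0..L}" for x y
    using C(1)[OF that] R by (auto simp: zero_le_mult_iff mult_le_0_iff)
  have E1: "E t \<le> E s" if "0 \<le> s" "s \<le> t" "t \<le> m1" for s t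
  proof (rule down[OF cE _ _ _ dE])
    fix x assume x: "x \<in> {s<..<t} - D"
    then have "0 \<le> \<delta> - \<psi> x" "\<delta> - \<psi> x \<le> pi" using m1(1,2) m1(3)[of x] m(1,2) \<psi>0[of x] \<delta> that by auto
    then have "0 \<le> sin (\<delta> - \<psi> x)" by (rule sin_ge_zero)
    then have "sin (\<psi> x - \<delta>) \<le> 0" by (simp add: sin_diff mult.commute)
    then show "C x * R * sin (\<psi> x - \<delta>) \<le> 0" using sgn x that m1 m by simp
  qed (use that m m1 in auto)
  have E2: "E s \<le> E t" if "m1 \<le> s" "s \<le> t" "t \<le> m" for s t
  proof (rule up[OF cE _ _ _ dE])
    fix x assume x: "x \<in> {s<..<t} - D"
    then have "0 \<le> \<psi> x - \<delta>" "\<psi> x - \<delta> \<le> pi" using m1(1,2) m1(4)[of x] m(1,2) m(3)[of x] \<delta> that by auto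
    then have "0 \<le> sin (\<psi> x - \<delta>)" by (rule sin_ge_zero)
    then show "0 \<le> C x * R * sin (\<psi> x - \<delta>)" using sgn x that m1 m by simp
  qed (use that m m1 in auto)
  have E3: "E s \<le> E t" if "m \<le> s" "s \<le> t" "t \<le> m2" for s t
  proof (rule up[OF cE _ _ _ dE])
    fix x assume x: "x \<in> {s<..<t} - D"
    then have "0 \<le> \<psi> x - \<delta>" "\<psi> x - \<delta> \<le> pi" using m2(2) m2(3)[of x] m(1,2) m(4)[of x] \<delta> that by auto
    then have "0 \<le> sin (\<psi> x - \<delta>)" by (rule sin_ge_zero)
    then show "0 \<le> C x * R * sin (\<psi> x - \<delta>)" using sgn x that m2 m by simp
  qed (use that m m2 in auto)
  have E4: "E t \<le> E s" if "m2 \<le> s" "s \<le> t" "t \<le> L" for s t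
  proof (rule down[OF cE _ _ _ dE])
    fix x assume x: "x \<in> {s<..<t} - D"
    then have "0 \<le> \<psi> x - \<delta> - pi" "\<psi> x - \<delta> - pi \<le> pi" using m2(1,2) m2(4)[of x] m(1,2) \<psi>(3)[of x] \<delta> that by auto
    then have "0 \<le> sin (\<psi> x - \<delta> - pi)" by (rule sin_ge_zero)
    then have "sin (\<psi> x - \<delta>) \<le> 0" by (simp add: sin_diff[of _ pi])
    then show "C x * R * sin (\<psi> x - \<delta>) \<le> 0" using sgn x that m2 m by simp
  qed (use that m m2 in auto)
  have En: "E x \<le> 0" if "0 \<le> x" "x \<le> m" for x
    using E1[of 0 x] E2[of x m] that E0 by (cases "x \<le> m1") auto
  have Ep: "0 \<le> E x" if "m \<le> x" "x \<le> L" for x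
    using E3[of m x] E4[of x L] that E0 by (cases "x \<le> m2") auto

  \<comment> \<open>The accumulated difference from the chord\<close>
  define ll where "ll y = Vt 0 + (y - Vn 0) * (dt / dn)" for y
  have Ell: "E x = dn * (ll (Vn x) - Vt x)" for x
    using dn by (simp add: E_def ll_def field_simps)
  \<comment> \<open>The integrand \<open>(Vt / C) * Vn / (\<epsilon> + Vn\<^sup>2)\<close>,
    evaluated at the point of the chord at height \<open>y\<close>.\<close>
  define hh where "hh y = ll y / sqrt (\<epsilon> + y\<^sup>2 + (ll y)\<^sup>2) * (y / (\<epsilon> + y\<^sup>2))" for y
  \<comment> \<open>Below the lowest height the integrand is continued by a constant, since
    \<epsilon> + \<open>y\<^sup>2\<close> may vanish there.\<close>
  define h where "h y = hh (max y (Vn 0))" for y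
  have hpos: "0 < \<epsilon> + (max y (Vn 0))\<^sup>2" "0 < \<epsilon> + (max y (Vn 0))\<^sup>2 + (ll (max y (Vn 0)))\<^sup>2" for y
    using \<kappa>[of "max y (Vn 0)"] by (auto intro: add_pos_nonneg)
  have ch: "continuous_on S h" for S
    unfolding h_def hh_def ll_def
    by (intro continuous_intros) (use hpos less_imp_neq[OF dn] in \<open>auto simp: ll_def less_imp_neq[symmetric] simp del: max.absorb1 max.absorb2\<close>)
  \<comment> \<open>Starting one unit below \<open>Vn 0\<close> makes the derivative two-sided at
    the lowest height as well.\<close>
  define H where "H y = integral {Vn 0 - 1..y} h" for y
  have dH: "(H has_real_derivative h (Vn x)) (at (Vn x))" if "x \<in> {0..L}" for x
  proof -
    have i: "Vn x \<in> {Vn 0 - 1<..<Vn m + 1}" using Vn_ge[OF that] Vn_le[OF that] by simp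
    have "(H has_vector_derivative h (Vn x)) (at (Vn x) within {Vn 0 - 1..Vn m + 1})"
      unfolding H_def by (rule integral_has_vector_derivative[OF ch]) (use i in auto)
    then have "(H has_vector_derivative h (Vn x)) (at (Vn x) within {Vn 0 - 1<..<Vn m + 1})"
      by (rule has_vector_derivative_within_subset) auto
    then show ?thesis
      unfolding at_within_open[OF i open_greaterThanLessThan] has_real_derivative_iff_has_vector_derivative .
  qed
  have CV: "0 < C x + Vt x" "0 < C x - Vt x" "(C x + Vt x) * (C x - Vt x) = \<epsilon> + (Vn x)\<^sup>2" if "x \<in> {0..L}" for x
  proof -
    show eq: "(C x + Vt x) * (C x - Vt x) = \<epsilon> + (Vn x)\<^sup>2"
      using C(2)[OF that] by (simp add: power2_eq_square algebra_simps)
    have "(Vt x)\<^sup>2 < (C x)\<^sup>2" using C(2)[OF that] \<kappa>[OF Vn_ge[OF that]] by simp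
    then have "\<bar>Vt x\<bar>\<^sup>2 < (C x)\<^sup>2" by simp
    then have "\<bar>Vt x\<bar> < C x" by (rule power2_less_imp_less) (use C(1)[OF that] in simp)
    then show "0 < C x + Vt x" "0 < C x - Vt x" by auto
  qed
  \<comment> \<open>Half the difference of the logarithms is the inverse hyperbolic tangent of
    \<open>Vt / C\<close>. Its derivative cancels the term \<open>cos (\<psi> x)\<close> coming from
    \<open>gt\<close>; what remains is an integral against the height, from which \<open>H\<close>
    subtracts the same integral along the chord.\<close>
  define W where "W x = gt x - (ln (C x + Vt x) - ln (C x - Vt x)) / 2 - H (Vn x)" for x
  define W' where "W' x = sin (\<psi> x) * (Vn x * C x / (\<epsilon> + (Vn x)\<^sup>2) *
     (Vt x / sqrt (\<epsilon> + (Vn x)\<^sup>2 + (Vt x)\<^sup>2) - ll (Vn x) / sqrt (\<epsilon> + (Vn x)\<^sup>2 + (ll (Vn x))\<^sup>2)))" for x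
  have dW: "(W has_real_derivative W' x) (at x)" if x: "x \<in> {0<..<L} - D" for x
  proof -
    have x': "x \<in> {0..L}" using x by auto
    have CC: "sqrt (\<epsilon> + (Vn x)\<^sup>2 + (Vt x)\<^sup>2) = C x"
      using C[OF x'] by (intro real_sqrt_unique) auto
    have hV: "h (Vn x) = ll (Vn x) / sqrt (\<epsilon> + (Vn x)\<^sup>2 + (ll (Vn x))\<^sup>2) * (Vn x / (\<epsilon> + (Vn x)\<^sup>2))"
      using Vn_ge[OF x'] by (simp add: h_def hh_def max_def)
    have a: "((\<lambda>x. ln (C x + Vt x)) has_real_derivative
        inverse (C x + Vt x) * (Vt x * cos (\<psi> x) + Vn x * sin (\<psi> x) + C x * cos (\<psi> x))) (at x)"
      by (rule DERIV_chain2[OF DERIV_ln[OF CV(1)[OF x']] DERIV_add[OF dC[OF x] dV(1)[OF x]]])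
    have b: "((\<lambda>x. ln (C x - Vt x)) has_real_derivative
        inverse (C x - Vt x) * (Vt x * cos (\<psi> x) + Vn x * sin (\<psi> x) - C x * cos (\<psi> x))) (at x)"
      by (rule DERIV_chain2[OF DERIV_ln[OF CV(2)[OF x']] DERIV_diff[OF dC[OF x] dV(1)[OF x]]])
    have c: "((\<lambda>x. H (Vn x)) has_real_derivative h (Vn x) * (C x * sin (\<psi> x))) (at x)"
      by (rule DERIV_chain2[OF dH[OF x'] dV(2)[OF x]])
    define P where "P = inverse (C x + Vt x)"
    define Q where "Q = inverse (C x - Vt x)"
    have PQ: "P * (C x + Vt x) = 1" "Q * (C x - Vt x) = 1" using CV[OF x'] by (auto simp: P_def Q_def)
    have "(W has_real_derivative (cos (\<psi> x) - (P * (Vt x * cos (\<psi> x) + Vn x * sin (\<psi> x) + C x * cos (\<psi> x))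
        - Q * (Vt x * cos (\<psi> x) + Vn x * sin (\<psi> x) - C x * cos (\<psi> x))) / 2
        - h (Vn x) * (C x * sin (\<psi> x)))) (at x)"
      unfolding W_def P_def Q_def by (intro DERIV_diff DERIV_cdivide dg[OF x] a b c)
    also have "P * (Vt x * cos (\<psi> x) + Vn x * sin (\<psi> x) + C x * cos (\<psi> x))
        = (P * (C x + Vt x)) * cos (\<psi> x) + P * Vn x * sin (\<psi> x)" by (simp add: algebra_simps)
    also have "Q * (Vt x * cos (\<psi> x) + Vn x * sin (\<psi> x) - C x * cos (\<psi> x))
        = Q * Vn x * sin (\<psi> x) - (Q * (C x - Vt x)) * cos (\<psi> x)" by (simp add: algebra_simps)
    also have "cos (\<psi> x) - (P * (C x + Vt x) * cos (\<psi> x) + P * Vn x * sin (\<psi> x)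
        - (Q * Vn x * sin (\<psi> x) - Q * (C x - Vt x) * cos (\<psi> x))) / 2 - h (Vn x) * (C x * sin (\<psi> x))
      = (Q - P) / 2 * Vn x * sin (\<psi> x) - h (Vn x) * (C x * sin (\<psi> x))"
      unfolding PQ by (simp add: algebra_simps diff_divide_distrib)
    also have "Q - P = 2 * (Vt x / (\<epsilon> + (Vn x)\<^sup>2))"
      unfolding CV(3)[OF x', symmetric] P_def Q_def using CV(1,2)[OF x'] by (simp add: divide_simps)
    also have "2 * (Vt x / (\<epsilon> + (Vn x)\<^sup>2)) / 2 * Vn x * sin (\<psi> x) - h (Vn x) * (C x * sin (\<psi> x)) = W' x"
      unfolding W'_def hV CC nonzero_mult_div_cancel_left[OF zero_neq_numeral[symmetric]]
      using C(1)[OF x'] by (simp add: algebra_simps)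
    finally show ?thesis .
  qed
  have cW: "continuous_on {0..L} W"
  proof -
    have "continuous_on {Vn 0 - 1..Vn m} H"
      unfolding H_def by (rule indefinite_integral_continuous_1[OF integrable_continuous_real[OF ch]])
    then have "continuous_on {0..L} (\<lambda>x. H (Vn x))"
      by (rule continuous_on_compose2[OF _ cont(3)]) (use Vn_ge Vn_le in force)
    then show ?thesis
      unfolding W_def using CV by (intro continuous_intros cont) (auto simp: less_imp_neq[symmetric])
  qed
  have brack: "Vt x / sqrt (\<epsilon> + (Vn x)\<^sup>2 + (Vt x)\<^sup>2) \<le> ll (Vn x) / sqrt (\<epsilon> + (Vn x)\<^sup>2 + (ll (Vn x))\<^sup>2) \<longleftrightarrow> 0 \<le> E x"
     "ll (Vn x) / sqrt (\<epsilon> + (Vn x)\<^sup>2 + (ll (Vn x))\<^sup>2) \<le> Vt x / sqrt (\<epsilon> + (Vn x)\<^sup>2 + (Vt x)\<^sup>2) \<longleftrightarrow> E x \<le> 0"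
    if "x \<in> {0..L}" for x
    using strictly_increasing_over_sqrt[OF \<kappa>[OF Vn_ge[OF that]], of "Vt x" "ll (Vn x)"]
      strictly_increasing_over_sqrt[OF \<kappa>[OF Vn_ge[OF that]], of "ll (Vn x)" "Vt x"] dn
    unfolding Ell zero_le_mult_iff mult_le_0_iff by (cases "Vt x" "ll (Vn x)" rule: linorder_cases; simp)+
  \<comment> \<open>Where \<open>V\<close> rises it lies to the right of the chord, where it falls
    to the left, so the two signs in \<open>W'\<close> change together. The prefactor is nonnegative
    because \<open>Vn \<ge> 0\<close> is assumed for contradiction.\<close>
  have W'0: "0 \<le> W' x" if x: "x \<in> {0<..<L} - D" "x \<noteq> m" for x
  proof -
    have x': "x \<in> {0..L}" using x by auto
    have q: "0 \<le> Vn x * C x / (\<epsilon> + (Vn x)\<^sup>2)"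
      using Vn_ge[OF x'] Vn0 C(1)[OF x'] \<kappa>[OF Vn_ge[OF x']] by (intro divide_nonneg_pos mult_nonneg_nonneg) auto
    show ?thesis
    proof (cases "x < m")
      case True
      then show ?thesis unfolding W'_def using brack(2)[OF x'] En[of x] x s1[of x] q
        by (intro mult_nonneg_nonneg) auto
    next
      case False
      then have "m < x" using x by simp
      then have "0 \<le> E x" "sin (\<psi> x) \<le> 0" using Ep[of x] x s2[of x] by auto
      then show ?thesis unfolding W'_def using brack(1)[OF x'] q
        by (intro mult_nonpos_nonpos mult_nonneg_nonpos) auto
    qed
  qed
  have W_up: "W s \<le> W t" if "0 \<le> s" "s \<le> t" "t \<le> L" for s t
  proof -
    have c: "continuous_on {a..b} W" if "0 \<le> a" "b \<le> L" for a b
      using that by (auto intro: continuous_on_subset[OF cW])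
    show ?thesis
      by (rule nondecreasing_off_countable[OF that(2), of "insert m D" W W'])
         (use that D dW W'0 c in \<open>auto simp flip: has_real_derivative_iff_has_vector_derivative\<close>)
  qed
  \<comment> \<open>All ingredients of \<open>W\<close> are closed, and a nondecreasing function
    with equal end values is constant.\<close>
  have "W L = W 0" by (simp add: W_def closed)
  then have Wc: "W x = W 0" if "x \<in> {0..L}" for x
    using W_up[of 0 x] W_up[of x L] that by auto

  \<comment> \<open>Equality forces \<open>V\<close> onto the chord\<close>
  have zero: "sin (\<psi> x) = 0 \<or> E x = 0" if x: "x \<in> {0<..<L} - D" for x
  proof -
    have x': "x \<in> {0..L}" using x by auto
    have "(W has_real_derivative 0) (at x)"
      by (rule DERIV_locally_constant[of 0 _ L _ "W 0"]) (use x in \<open>auto intro!: Wc\<close>)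
    then have "W' x = 0" using dW[OF x] DERIV_unique by blast
    moreover have "E x = 0" if "Vt x / sqrt (\<epsilon> + (Vn x)\<^sup>2 + (Vt x)\<^sup>2) = ll (Vn x) / sqrt (\<epsilon> + (Vn x)\<^sup>2 + (ll (Vn x))\<^sup>2)"
      using brack[OF x'] that by simp
    \<comment> \<open>At height 0 the curve is as low as it can be, so the derivative of
      \<open>Vn\<close> vanishes.\<close>
    moreover have "sin (\<psi> x) = 0" if "Vn x = 0"
    proof -
      have "C x * sin (\<psi> x) = 0"
      proof (rule DERIV_local_min[OF dV(2)[OF x], of "min x (L - x)"])
        show "\<forall>y. \<bar>x - y\<bar> < min x (L - x) \<longrightarrow> Vn x \<le> Vn y"
        proof (intro allI impI)
          fix y assume "\<bar>x - y\<bar> < min x (L - x)"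
          then have "y \<in> {0..L}" by auto
          then show "Vn x \<le> Vn y" using order_trans[OF Vn0 Vn_ge[of y]] \<open>Vn x = 0\<close> by simp
        qed
      qed (use x in auto)
      then show ?thesis using C(1)[OF x'] by simp
    qed
    ultimately show ?thesis
      using C(1)[OF x'] \<kappa>[OF Vn_ge[OF x']] unfolding W'_def by auto
  qed
  have uncount: "\<exists>y. a < y \<and> y < b \<and> y \<notin> D" if "a < b" for a b :: real
  proof -
    have "\<not> {a<..<b} \<subseteq> D"
      using D uncountable_open_interval[of a b] that countable_subset by blast
    then show ?thesis by auto
  qed
  \<comment> \<open>If the minimum were negative, \<open>E\<close> would be nonzero near
    \<open>m1\<close> and the tangents there horizontal. By monotonicity the angle would be 0 on all
    of the arc before \<open>m1\<close> and \<pi> from there up to \<open>m\<close>, and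
    \<open>V\<close> would not rise at all. The maximum at \<open>m2\<close> is treated in the same
    way.\<close>
  have Em1: "E m1 = 0"
  proof (rule ccontr)
    assume "E m1 \<noteq> 0"
    then have neg: "E m1 < 0" using En[of m1] m1 by auto
    then have m1': "0 < m1" "m1 < m" using E0 m1 by (auto simp: less_le)
    have "isCont E m1" using continuous_on_interior[OF cE, of m1] m1' m by (auto simp: interior_atLeastAtMost_real)
    then have "eventually (\<lambda>x. E x < 0) (at m1)"
      using neg by (simp add: isCont_def order_tendstoD(2))
    then obtain d where d: "d > 0" "\<And>x. x \<noteq> m1 \<Longrightarrow> dist x m1 < d \<Longrightarrow> E x < 0"
      by (auto simp: eventually_at)
    obtain y where y: "max 0 (m1 - d) < y" "y < m1" "y \<notin> D" using uncount[of "max 0 (m1 - d)" m1] d m1' by auto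
    obtain z where z: "m1 < z" "z < min m (m1 + d)" "z \<notin> D" using uncount[of m1 "min m (m1 + d)"] d m1' by auto
    have sy: "\<psi> x = 0" if x: "0 < x" "x < m1" for x
    proof -
      obtain w where w: "max x y < w" "w < m1" "w \<notin> D" using uncount[of "max x y" m1] x y by auto
      have "E w < 0" using E1[of y w] d(2)[of y] y w by (auto simp: dist_real_def)
      then have "sin (\<psi> w) = 0" using zero[of w] w x m1' m by auto
      moreover have "0 \<le> \<psi> w" "\<psi> w < pi" using \<psi>0[of w] m1(3)[of w] w x \<delta> m1' m by auto
      ultimately have "\<psi> w = 0" using sin_gt_zero[of "\<psi> w"] by (cases "\<psi> w = 0") auto
      then show ?thesis using \<psi>m[of x w] \<psi>0[of x] w x m1' m by auto
    qed
    have sz: "\<psi> x = pi" if x: "m1 < x" "x < m" for x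
    proof -
      obtain w where w: "m1 < w" "w < min x z" "w \<notin> D" using uncount[of m1 "min x z"] x z by auto
      have "E w < 0" using E2[of w z] d(2)[of z] z w by (auto simp: dist_real_def)
      then have "sin (\<psi> w) = 0" using zero[of w] w x m1' m by auto
      moreover have "0 < \<psi> w" "\<psi> w \<le> pi" using m(3)[of w] m1(4)[of w] w x \<delta> m1' m by auto
      ultimately have "\<psi> w = pi" using sin_gt_zero[of "\<psi> w"] by (cases "\<psi> w = pi") auto
      then show ?thesis using \<psi>m[of w x] m(3)[of x] w x m1' m(1,2) by auto
    qed
    have "Vn m1 \<le> Vn 0"
      by (rule down[OF cont(3) _ _ _ dV(2)]) (use sy m m1' in auto)
    moreover have "Vn m \<le> Vn m1"
      by (rule down[OF cont(3) _ _ _ dV(2)]) (use sz m m1' in auto)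
    ultimately show False using dn by (simp add: dn_def)
  qed
  have Em2: "E m2 = 0"
  proof (rule ccontr)
    assume "E m2 \<noteq> 0"
    then have neg: "0 < E m2" using Ep[of m2] m2 by auto
    then have m2': "m < m2" "m2 < L" using E0 m2 by (auto simp: less_le)
    have "isCont E m2" using continuous_on_interior[OF cE, of m2] m2' m by (auto simp: interior_atLeastAtMost_real)
    then have "eventually (\<lambda>x. 0 < E x) (at m2)"
      using neg by (simp add: isCont_def order_tendstoD(1))
    then obtain d where d: "d > 0" "\<And>x. x \<noteq> m2 \<Longrightarrow> dist x m2 < d \<Longrightarrow> 0 < E x"
      by (auto simp: eventually_at)
    obtain y where y: "max m (m2 - d) < y" "y < m2" "y \<notin> D" using uncount[of "max m (m2 - d)" m2] d m2' by auto
    obtain z where z: "m2 < z" "z < min L (m2 + d)" "z \<notin> D" using uncount[of m2 "min L (m2 + d)"] d m2' by auto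
    have sy: "\<psi> x = pi" if x: "m < x" "x < m2" for x
    proof -
      obtain w where w: "max x y < w" "w < m2" "w \<notin> D" using uncount[of "max x y" m2] x y by auto
      have "0 < E w" using E3[of y w] d(2)[of y] y w by (auto simp: dist_real_def)
      then have "sin (\<psi> w) = 0" using zero[of w] w x m2' m by auto
      moreover have "pi \<le> \<psi> w" "\<psi> w < 2 * pi" using m(4)[of w] m2(3)[of w] w x \<delta> m2' m by auto
      ultimately have "\<psi> w = pi" using sin_gt_zero[of "\<psi> w - pi"] by (cases "\<psi> w = pi") (auto simp: sin_diff)
      then show ?thesis using \<psi>m[of x w] m(4)[of x] w x m2' m(1,2) by auto
    qed
    have sz: "\<psi> x = 2 * pi" if x: "m2 < x" "x < L" for x
    proof -
      obtain w where w: "m2 < w" "w < min x z" "w \<notin> D" using uncount[of m2 "min x z"] x z by auto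
      have "0 < E w" using E4[of w z] d(2)[of z] z w by (auto simp: dist_real_def)
      then have "sin (\<psi> w) = 0" using zero[of w] w x m2' m by auto
      moreover have "pi < \<psi> w" "\<psi> w \<le> 2 * pi" using \<psi>(3)[of w] m2(4)[of w] w x \<delta> m2' m by auto
      ultimately have "\<psi> w = 2 * pi" using sin_gt_zero[of "\<psi> w - pi"] by (cases "\<psi> w = 2 * pi") (auto simp: sin_diff)
      then show ?thesis using \<psi>m[of w x] \<psi>(3)[of x] w x m2' m by auto
    qed
    have "Vn m \<le> Vn m2"
      by (rule up[OF cont(3) _ _ _ dV(2)]) (use sy m m2' in auto)
    moreover have "Vn m2 \<le> Vn L"
      by (rule up[OF cont(3) _ _ _ dV(2)]) (use sz m m2' in auto)
    ultimately show False using dn closed by (simp add: dn_def)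
  qed
  have Ez: "E x = 0" if "x \<in> {0..L}" for x
  proof (cases "x \<le> m")
    case True
    then show ?thesis using En[of x] E1[of x m1] E2[of m1 x] Em1 that by (cases "x \<le> m1") auto
  next
    case False
    then show ?thesis using Ep[of x] E3[of x m2] E4[of m2 x] Em2 that by (cases "x \<le> m2") auto
  qed
  have "sin (\<psi> x - \<delta>) = 0" if x: "x \<in> {0<..<L} - D" for x
  proof -
    have "(E has_real_derivative 0) (at x)"
      by (rule DERIV_locally_constant[of 0 _ L _ 0]) (use x in \<open>auto intro!: Ez\<close>)
    then have "C x * R * sin (\<psi> x - \<delta>) = 0" using dE[OF x] DERIV_unique by blast
    then show ?thesis using C(1)[of x] R x by auto
  qed
  then show False using nondeg[OF D, of \<delta>] by blast
qed

section \<open>Tangent angle of a convex curve\<close>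

text \<open>The determinant of two plane vectors: the signed area of their parallelogram, positive
  when \<open>b\<close> points to the left of \<open>a\<close>.\<close>

definition wedge :: "complex \<Rightarrow> complex \<Rightarrow> real" where
  "wedge a b = Im (cnj a * b)"

lemma wedge_simps:
  "wedge a (b + c) = wedge a b + wedge a c" "wedge a (b - c) = wedge a b - wedge a c"
  "wedge (a + b) c = wedge a c + wedge b c" "wedge (a - b) c = wedge a c - wedge b c"
  "wedge (of_real r * a) b = r * wedge a b" "wedge a (of_real r * b) = r * wedge a b"
  "wedge (- a) b = - wedge a b" "wedge a (- b) = - wedge a b" "wedge a a = 0"
  "wedge (cnj a) (cnj b) = - wedge a b"
  by (simp_all add: wedge_def algebra_simps)

lemma wedge_commute: "wedge a b = - wedge b a"
  by (simp add: wedge_def algebra_simps)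

lemma wedge_cis: "wedge (cis a) (cis b) = sin (b - a)"
  by (simp add: wedge_def sin_diff algebra_simps)

lemma sin_nonneg_imp_nonneg:
  fixes x :: real
  assumes "0 \<le> sin x" "- pi < x"  "x < pi"
  shows "0 \<le> x"
  using sin_lt_zero[of "- x"] sin_gt_zero[of "- x"] assms by (cases "x < 0") auto

lemma exists_polar_above:
  assumes "0 \<le> wedge (cis t) d"
  obtains s where "0 \<le> s" "s \<le> pi" "d = of_real (norm d) * cis (t + s)"
proof -
  define e where "e = d * cis (- t)"
  have d: "d = e * cis t" by (simp add: e_def mult.assoc cis_mult)
  have e: "0 \<le> Im e" "norm e = norm d"
    using assms by (auto simp: e_def wedge_def norm_mult cis_cnj mult.commute)
  define s where "s = (if e = 0 then 0 else Arg e)"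
  have "e = of_real (norm e) * cis s"
    by (cases "e = 0") (auto simp: s_def rcis_cmod_Arg[unfolded rcis_def])
  then have "d = of_real (norm d) * cis (t + s)"
    unfolding e(2) d by (metis d cis_mult mult.assoc mult.commute)
  moreover have "0 \<le> s"
  proof (cases "Im e = 0")
    case True
    then have "e \<in> \<real>" by (simp add: complex_is_Real_iff)
    then show ?thesis using Arg_eq_0_pi[of e] by (auto simp: s_def)
  next
    case False
    then show ?thesis using e(1) Arg_lt_pi[of e] by (auto simp: s_def)
  qed
  moreover have "s \<le> pi" by (simp add: s_def Arg_le_pi)
  ultimately show ?thesis using that by blast
qed

text \<open>A convex curve run counterclockwise around the origin and extended periodically, so that
  every parameter can serve as base point. \<open>\<theta>\<close> is its polar angle, and
  \<open>\<tau>\<close> selects at each point a supporting direction with the curve on its left,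
  without any continuity; \<open>\<rho>\<close> bounds from below the distance of the supporting
  lines from the origin.\<close>

locale support_loop =
  fixes L :: real and g :: "real \<Rightarrow> complex" and \<theta> :: "real \<Rightarrow> real" and \<tau> :: "real \<Rightarrow> complex" and \<rho> :: real
  assumes L: "0 < L"
    and g: "continuous_on UNIV g" "\<And>x. g (x + L) = g x"
    and \<theta>: "continuous_on UNIV \<theta>" "strict_mono \<theta>" "\<And>x. \<theta> (x + L) = \<theta> x + 2 * pi"
      "\<And>x. g x = of_real (norm (g x)) * cis (\<theta> x)"
    and \<rho>: "0 < \<rho>" "\<And>x. \<rho> \<le> wedge (g x) (\<tau> x)"
    and \<tau>: "\<And>x. norm (\<tau> x) = 1" "\<And>x. \<tau> (x + L) = \<tau> x" "\<And>x y. 0 \<le> wedge (\<tau> x) (g y - g x)"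
    and arclength: "\<And>s t. 0 \<le> s \<Longrightarrow> s \<le> t \<Longrightarrow> t \<le> L \<Longrightarrow> curve_length g s t = ereal (t - s)"
begin

text \<open>The angle of \<open>\<tau>\<close>, lifted to the real line. The angle from
  \<open>g x\<close> to \<open>\<tau> x\<close> lies strictly between 0 and \<pi>, so adding it to
  the continuous \<open>\<theta>\<close> selects a branch although \<open>\<tau>\<close> may
  jump.\<close>

definition \<phi> :: "real \<Rightarrow> real" where
  "\<phi> x = \<theta> x + Arg (\<tau> x / g x)"

lemma g_nz: "g x \<noteq> 0"
  using \<rho>(1) \<rho>(2)[of x] by (auto simp: wedge_def)

lemma \<phi>_bounds: "\<theta> x < \<phi> x" "\<phi> x < \<theta> x + pi"
proof -
  have "Im (\<tau> x / g x) = wedge (g x) (\<tau> x) / (norm (g x))\<^sup>2"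
    by (simp add: wedge_def complex_div_cnj[of "\<tau> x"] mult.commute)
  then have "0 < Im (\<tau> x / g x)" using \<rho>(1) \<rho>(2)[of x] g_nz[of x] by simp
  then show "\<theta> x < \<phi> x" "\<phi> x < \<theta> x + pi"
    using Arg_lt_pi[of "\<tau> x / g x"] by (auto simp: \<phi>_def)
qed

lemma cis_\<phi>: "cis (\<phi> x) = \<tau> x"
proof -
  have nz: "\<tau> x / g x \<noteq> 0" using \<tau>(1)[of x] g_nz[of x] by auto
  have "cis (\<phi> x) = cis (\<theta> x) * cis (Arg (\<tau> x / g x))" by (simp add: \<phi>_def cis_mult)
  also have "cis (Arg (\<tau> x / g x)) = sgn (\<tau> x / g x)" by (rule cis_Arg[OF nz])
  also have "\<dots> = \<tau> x / g x * of_real (norm (g x))"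
    using \<tau>(1)[of x] g_nz[of x] by (simp add: sgn_eq norm_divide)
  also have "cis (\<theta> x) * \<dots> = \<tau> x * (of_real (norm (g x)) * cis (\<theta> x)) / g x" by simp
  also have "\<dots> = \<tau> x" using \<theta>(4)[of x] g_nz[of x] by simp
  finally show ?thesis .
qed

lemma \<phi>_periodic: "\<phi> (x + L) = \<phi> x + 2 * pi"
  by (simp add: \<phi>_def g \<theta>(3) \<tau>(2))

lemma wedge_g_pos:
  assumes "x < y" "\<theta> y < \<theta> x + pi"
  shows "0 < wedge (g x) (g y)"
proof -
  have "wedge (g x) (g y) = wedge (of_real (norm (g x)) * cis (\<theta> x)) (of_real (norm (g y)) * cis (\<theta> y))"
    using \<theta>(4) by metis
  also have "\<dots> = norm (g x) * norm (g y) * sin (\<theta> y - \<theta> x)" by (simp add: wedge_simps wedge_cis)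
  also have "\<dots> > 0"
    using g_nz strict_monoD[OF \<theta>(2) assms(1)] assms(2) by (intro mult_pos_pos sin_gt_zero) auto
  finally show ?thesis .
qed

lemma wedge_cis_\<theta>:
  assumes "x < y" "\<theta> y < \<theta> x + pi"
  shows "0 < wedge (cis (\<theta> x)) (g y - g x)"
proof -
  have "norm (g x) * wedge (cis (\<theta> x)) (g y - g x) = wedge (g x) (g y)"
    by (metis \<theta>(4) wedge_simps(2,5,9) diff_zero)
  then show ?thesis using wedge_g_pos[OF assms] g_nz[of x] by (metis zero_less_mult_pos zero_less_norm_iff)
qed

text \<open>If \<open>\<phi> y < \<phi> x\<close> with \<open>x < y\<close>, then \<open>\<tau> y\<close> is a positive combination of \<open>g x\<close> and \<open>\<tau> x\<close>, and the chord
  would lie strictly to the left of \<open>\<tau> y\<close>.\<close>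

lemma mono_\<phi>: "mono \<phi>"
proof (rule monoI)
  fix x y :: real assume xy: "x \<le> y"
  show "\<phi> x \<le> \<phi> y"
  proof (rule ccontr)
    assume *: "\<not> \<phi> x \<le> \<phi> y"
    then have lt: "x < y" using xy by (cases "x = y") auto
    have t: "\<theta> x < \<theta> y" by (rule strict_monoD[OF \<theta>(2) lt])
    have far: "\<theta> y < \<theta> x + pi" using * \<phi>_bounds[of x] \<phi>_bounds[of y] by linarith
    define d where "d = g y - g x"
    have a: "0 < wedge (cis (\<theta> x)) d" unfolding d_def by (rule wedge_cis_\<theta>[OF lt far])
    have b: "0 \<le> wedge (cis (\<phi> x)) d" unfolding d_def cis_\<phi> by (rule \<tau>)
    have "0 \<le> wedge (cis (\<phi> y)) (g x - g y)" unfolding cis_\<phi> by (rule \<tau>)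
    then have c: "wedge (cis (\<phi> y)) d \<le> 0" unfolding d_def by (simp add: wedge_simps)
    have "sin (\<phi> x - \<theta> x) * wedge (cis (\<phi> y)) d
        = sin (\<phi> x - \<phi> y) * wedge (cis (\<theta> x)) d + sin (\<phi> y - \<theta> x) * wedge (cis (\<phi> x)) d"
    proof -
      have "sin (\<phi> x - \<theta> x) * cos (\<phi> y) = sin (\<phi> x - \<phi> y) * cos (\<theta> x) + sin (\<phi> y - \<theta> x) * cos (\<phi> x)"
        "sin (\<phi> x - \<theta> x) * sin (\<phi> y) = sin (\<phi> x - \<phi> y) * sin (\<theta> x) + sin (\<phi> y - \<theta> x) * sin (\<phi> x)"
        by (simp_all add: sin_diff algebra_simps)
      moreover have w: "wedge (cis u) d = cos u * Im d - sin u * Re d" for u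
        by (simp add: wedge_def)
      ultimately show ?thesis unfolding w by (simp add: algebra_simps)
    qed
    moreover have "0 < sin (\<phi> x - \<phi> y)" "0 < sin (\<phi> y - \<theta> x)" "0 < sin (\<phi> x - \<theta> x)"
      using * t \<phi>_bounds[of x] \<phi>_bounds[of y] by (auto intro!: sin_gt_zero)
    ultimately show False using a b c
      by (smt (verit, best) mult_nonneg_nonneg mult_nonneg_nonpos mult_pos_pos)
  qed
qed

text \<open>The chord lies to the left of the supporting line at \<open>x\<close>, and seen from
  \<open>y\<close> the supporting line there bounds it from the other side. This confines its
  direction modulo full turns; the bounds on \<open>\<theta>\<close> and \<open>\<phi>\<close> fix
  the turn.\<close>

lemma chord_direction:
  assumes "x \<le> y" "\<theta> y < \<theta> x + pi" "\<phi> y < \<phi> x + pi / 2"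
  obtains t where "\<phi> x \<le> t" "t \<le> \<phi> y" "g y - g x = of_real (norm (g y - g x)) * cis t"
proof (cases "x = y")
  case True
  then show ?thesis using that[of "\<phi> x"] by simp
next
  case False
  then have lt: "x < y" using assms by simp
  define d where "d = g y - g x"
  have nz: "d \<noteq> 0" using wedge_cis_\<theta>[OF lt assms(2)] by (auto simp: d_def wedge_def)
  obtain s where s: "0 \<le> s" "s \<le> pi" "d = of_real (norm d) * cis (\<theta> x + s)"
    using exists_polar_above[of "\<theta> x" d] wedge_cis_\<theta>[OF lt assms(2)] by (auto simp: d_def)
  have "0 \<le> wedge (cis (\<phi> x)) d" unfolding d_def cis_\<phi> by (rule \<tau>)
  then have "0 \<le> norm d * sin (\<theta> x + s - \<phi> x)" by (subst (asm) s(3)) (simp add: wedge_simps wedge_cis)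
  then have "0 \<le> sin (\<theta> x + s - \<phi> x)" using nz by (simp add: zero_le_mult_iff)
  then have 1: "0 \<le> \<theta> x + s - \<phi> x"
    by (rule sin_nonneg_imp_nonneg) (use \<phi>_bounds[of x] s in auto)
  have "0 \<le> wedge (cis (\<phi> y)) (g x - g y)" unfolding cis_\<phi> by (rule \<tau>)
  then have "wedge (cis (\<phi> y)) d \<le> 0" unfolding d_def by (simp add: wedge_simps)
  then have "norm d * sin (\<theta> x + s - \<phi> y) \<le> 0" by (subst (asm) s(3)) (simp add: wedge_simps wedge_cis)
  then have "sin (\<theta> x + s - \<phi> y) \<le> 0" using nz by (simp add: mult_le_0_iff)
  then have "0 \<le> sin (- (\<theta> x + s - \<phi> y))" unfolding sin_minus by simp
  then have "0 \<le> - (\<theta> x + s - \<phi> y)"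
    by (rule sin_nonneg_imp_nonneg)
       (use 1 assms(3) monoD[OF mono_\<phi> assms(1)] \<phi>_bounds[of x] s in auto)
  then show ?thesis using 1 that[of "\<theta> x + s"] s(3) by (simp add: d_def)
qed

text \<open>All chords of the arc deviate from \<open>\<tau> x\<close> by at most
  \<open>\<phi> y - \<phi> x\<close>, so projecting an inscribed polygon to \<open>\<tau> x\<close>
  shrinks its length at most by the cosine of that angle. The projections telescope to that of the
  whole chord.\<close>

lemma norm_chord_ge:
  assumes "0 \<le> x" "x \<le> y" "y \<le> L" "\<theta> y < \<theta> x + pi" "\<phi> y < \<phi> x + pi / 2"
  shows "(y - x) * cos (\<phi> y - \<phi> x) \<le> norm (g y - g x)"
proof -
  define c where "c = cos (\<phi> y - \<phi> x)"
  have c: "c > 0" unfolding c_def using assms monoD[OF mono_\<phi> assms(2)] by (intro cos_gt_zero_pi) auto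
  define f where "f s = Re (cnj (cis (\<phi> x)) * g s)" for s
  have each: "norm (g v - g u) * c \<le> f v - f u" if uv: "x \<le> u" "u \<le> v" "v \<le> y" for u v
  proof -
    have m: "\<phi> x \<le> \<phi> u" "\<phi> u \<le> \<phi> v" "\<phi> v \<le> \<phi> y" "\<theta> x \<le> \<theta> u" "\<theta> v \<le> \<theta> y"
      using monoD[OF mono_\<phi>] monoD[OF strict_mono_mono[OF \<theta>(2)]] uv by auto
    obtain t where t: "\<phi> u \<le> t" "t \<le> \<phi> v" "g v - g u = of_real (norm (g v - g u)) * cis t"
      using chord_direction[of u v] uv m assms by auto
    have "f v - f u = Re (cnj (cis (\<phi> x)) * (g v - g u))" by (simp add: f_def algebra_simps)
    also have "\<dots> = norm (g v - g u) * cos (t - \<phi> x)"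
      by (subst t(3)) (simp add: cos_diff algebra_simps)
    also have "\<dots> \<ge> norm (g v - g u) * c"
      unfolding c_def using t m assms by (intro mult_left_mono cos_monotone_0_pi_le) auto
    finally show ?thesis .
  qed
  have "curve_length g x y \<le> ereal ((f y - f x) / c)"
    unfolding curve_length_def
  proof (rule SUP_least)
    fix d assume "d \<in> {d. d division_of {x..y}}"
    then have d: "d division_of {x..y}" by simp
    \<comment> \<open>Tagging each interval by its left end makes the telescoping of sums over
      tagged divisions available.\<close>
    define p where "p = (\<lambda>k. (Inf k, k)) ` d"
    have sub: "\<exists>u v. k = {u..v} \<and> x \<le> u \<and> u \<le> v \<and> v \<le> y" if k: "k \<in> d" for k
    proof -
      obtain u v where "k = {u..v}" using division_ofD(4)[OF d k] by auto
      moreover have "k \<noteq> {}" "k \<subseteq> {x..y}" using division_ofD(2,3)[OF d k] by auto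
      ultimately show ?thesis by auto
    qed
    have inj: "inj_on (\<lambda>k. (Inf k, k)) d" by (auto simp: inj_on_def)
    have "p tagged_division_of {x..y}"
      unfolding p_def
    proof (rule tagged_division_ofI)
      show "finite ((\<lambda>k. (Inf k, k)) ` d)" using division_ofD(1)[OF d] by simp
      fix a k assume ak: "(a, k) \<in> (\<lambda>k. (Inf k, k)) ` d"
      then obtain u v where "k = {u..v}" "x \<le> u" "u \<le> v" "v \<le> y" "a = Inf k" using sub by blast
      then show "a \<in> k" "k \<subseteq> {x..y}" "\<exists>a b. k = cbox a b" by auto
      fix b l assume "(b, l) \<in> (\<lambda>k. (Inf k, k)) ` d" "(a, k) \<noteq> (b, l)"
      then show "interior k \<inter> interior l = {}" using ak division_ofD(5)[OF d, of k l] by auto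
    next
      show "\<Union>{k. \<exists>a. (a, k) \<in> (\<lambda>k. (Inf k, k)) ` d} = {x..y}"
        using division_ofD(6)[OF d] by (auto simp: image_iff)
    qed
    then have "(\<Sum>(a,k)\<in>p. f (Sup k) - f (Inf k)) = f y - f x"
      by (rule additive_tagged_division_1[OF assms(2)])
    then have tel: "(\<Sum>k\<in>d. f (Sup k) - f (Inf k)) = f y - f x"
      unfolding p_def using inj by (simp add: sum.reindex)
    have "(\<Sum>k\<in>d. norm (g (Sup k) - g (Inf k))) * c = (\<Sum>k\<in>d. norm (g (Sup k) - g (Inf k)) * c)"
      by (rule sum_distrib_right)
    also have "\<dots> \<le> (\<Sum>k\<in>d. f (Sup k) - f (Inf k))"
    proof (rule sum_mono)
      fix k assume "k \<in> d"
      then obtain u v where "k = {u..v}" "x \<le> u" "u \<le> v" "v \<le> y" using sub by blast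
      then show "norm (g (Sup k) - g (Inf k)) * c \<le> f (Sup k) - f (Inf k)" using each[of u v] by simp
    qed
    finally show "ereal (\<Sum>k\<in>d. norm (g (Sup k) - g (Inf k))) \<le> ereal ((f y - f x) / c)"
      using c tel by (simp add: field_simps)
  qed
  then have "y - x \<le> (f y - f x) / c" using arclength[of x y] assms by simp
  then have "(y - x) * c \<le> f y - f x" using c by (simp add: field_simps)
  also have "\<dots> = Re (cnj (cis (\<phi> x)) * (g y - g x))" by (simp add: f_def algebra_simps)
  also have "\<dots> \<le> norm (cnj (cis (\<phi> x)) * (g y - g x))" by (rule complex_Re_le_cmod)
  also have "\<dots> = norm (g y - g x)" by (simp add: norm_mult)
  finally show ?thesis by (simp add: c_def)
qed

lemma norm_chord_le:
  assumes "0 \<le> x" "x \<le> y" "y \<le> L"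
  shows "norm (g y - g x) \<le> y - x"
proof -
  have "ereal (norm (g y - g x)) \<le> curve_length g x y"
    unfolding curve_length_def
    by (rule SUP_upper2[of "{{x..y}}"]) (use assms division_of_self[of x y] in auto)
  then show ?thesis using arclength[of x y] assms by simp
qed

text \<open>The length of the chord differs from \<open>y - x\<close> by at most the factor
  \<open>1 - cos\<close>, and its direction from \<open>\<phi> z\<close> by at most the variation of
  \<open>\<phi>\<close>; each error costs one such variation. Allowing either endpoint as
  \<open>z\<close> serves both one-sided derivatives.\<close>

lemma chord_estimate:
  assumes "0 \<le> x" "x \<le> y" "y \<le> L" "\<theta> y < \<theta> x + pi" "\<phi> y < \<phi> x + pi / 2" "z \<in> {x,y}"
  shows "norm (g y - g x - (y - x) *\<^sub>R cis (\<phi> z)) \<le> 2 * (\<phi> y - \<phi> x) * (y - x)"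
proof -
  obtain t where t: "\<phi> x \<le> t" "t \<le> \<phi> y" "g y - g x = of_real (norm (g y - g x)) * cis t"
    using chord_direction[OF assms(2,4,5)] by blast
  have lip: "norm (cis a - cis b) \<le> \<bar>a - b\<bar>" for a b
  proof -
    have "norm (cis a - cis b) = norm (cis b * (cis (a - b) - 1))"
      by (simp add: right_diff_distrib cis_mult)
    also have "\<dots> = norm (exp (\<i> * of_real (a - b)) - 1)" by (simp add: norm_mult cis_conv_exp)
    also have "\<dots> = 2 * \<bar>sin ((a - b) / 2)\<bar>" by (rule dist_exp_i_1)
    also have "\<dots> \<le> \<bar>a - b\<bar>" using abs_sin_x_le_abs_x[of "(a - b) / 2"] by simp
    finally show ?thesis .
  qed
  define n where "n = norm (g y - g x)"
  define \<Delta> where "\<Delta> = \<phi> y - \<phi> x"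
  have n: "(y - x) * cos \<Delta> \<le> n" "n \<le> y - x"
    unfolding n_def \<Delta>_def using norm_chord_ge norm_chord_le assms by auto
  have \<Delta>: "0 \<le> \<Delta>" using monoD[OF mono_\<phi> assms(2)] by (simp add: \<Delta>_def)
  have "norm (cis \<Delta> - cis 0) \<le> \<Delta>" using lip[of \<Delta> 0] \<Delta> by simp
  then have "1 - cos \<Delta> \<le> \<Delta>" using abs_Re_le_cmod[of "cis \<Delta> - cis 0"] by simp
  then have "(y - x) * (1 - cos \<Delta>) \<le> (y - x) * \<Delta>" using assms by (intro mult_left_mono) auto
  then have 1: "\<bar>n - (y - x)\<bar> \<le> (y - x) * \<Delta>" using n by (simp add: algebra_simps)
  have "\<bar>t - \<phi> z\<bar> \<le> \<Delta>" using t assms(6) by (auto simp: \<Delta>_def)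
  then have 2: "norm (cis t - cis (\<phi> z)) \<le> \<Delta>" using lip[of t "\<phi> z"] by linarith
  have "g y - g x - (y - x) *\<^sub>R cis (\<phi> z) = of_real (n - (y - x)) * cis t + of_real (y - x) * (cis t - cis (\<phi> z))"
    by (subst t(3)) (simp add: n_def scaleR_conv_of_real algebra_simps)
  also have "norm \<dots> \<le> \<bar>n - (y - x)\<bar> + (y - x) * norm (cis t - cis (\<phi> z))"
    using assms(2) by (intro order_trans[OF norm_triangle_ineq]) (simp add: norm_mult del: of_real_diff)
  also have "\<dots> \<le> (y - x) * \<Delta> + (y - x) * \<Delta>"
    using assms(2) by (intro add_mono 1 mult_left_mono 2) auto
  finally show ?thesis by (simp add: \<Delta>_def algebra_simps)
qed

lemma has_vector_derivative_g_base:
  assumes x: "0 < x" "x < L" and c: "isCont \<phi> x"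
  shows "(g has_vector_derivative cis (\<phi> x)) (at x)"
  unfolding has_vector_derivative_def has_derivative_at_alt
proof (intro conjI allI impI)
  show "bounded_linear (\<lambda>h. h *\<^sub>R cis (\<phi> x))" by (rule bounded_linear_scaleR_left)
  fix e :: real assume e: "e > 0"
  have "isCont \<theta> x" using \<theta>(1) by (simp add: continuous_on_eq_continuous_at)
  then obtain d1 where d1: "d1 > 0" "\<And>y. dist y x < d1 \<Longrightarrow> dist (\<theta> y) (\<theta> x) < pi"
    unfolding continuous_at_eps_delta using pi_gt_zero by meson
  have m: "min (e / 2) (pi / 2) > 0" using e by simp
  obtain d2 where d2: "d2 > 0" "\<And>y. dist y x < d2 \<Longrightarrow> dist (\<phi> y) (\<phi> x) < min (e / 2) (pi / 2)"
    using c m unfolding continuous_at_eps_delta by meson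
  define d where "d = min (min d1 d2) (min x (L - x))"
  show "\<exists>d>0. \<forall>y. norm (y - x) < d \<longrightarrow> norm (g y - g x - (y - x) *\<^sub>R cis (\<phi> x)) \<le> e * norm (y - x)"
  proof (intro exI[of _ d] conjI allI impI)
    show "d > 0" using d1 d2 x by (simp add: d_def)
    fix y assume y: "norm (y - x) < d"
    have 1: "\<bar>\<theta> y - \<theta> x\<bar> < pi" using d1(2)[of y] y by (simp add: d_def dist_real_def)
    have 2: "\<bar>\<phi> y - \<phi> x\<bar> < e / 2" "\<bar>\<phi> y - \<phi> x\<bar> < pi / 2"
      using d2(2)[of y] y by (simp_all add: d_def dist_real_def)
    have 3: "0 < y" "y < L" using y by (auto simp: d_def)
    have "\<phi> y - \<phi> x < e / 2" "\<phi> x - \<phi> y < e / 2"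
      using order.strict_trans1[OF abs_ge_self 2(1)] order.strict_trans1[OF abs_ge_minus_self 2(1)]
      by auto
    then have 5: "2 * (\<phi> y - \<phi> x) \<le> e" "2 * (\<phi> x - \<phi> y) \<le> e"
      by (simp_all add: field_simps)
    have 4: "\<theta> y < \<theta> x + pi" "\<theta> x < \<theta> y + pi" "\<phi> y < \<phi> x + pi / 2" "\<phi> x < \<phi> y + pi / 2"
      using 1 2(2) by linarith+
    show "norm (g y - g x - (y - x) *\<^sub>R cis (\<phi> x)) \<le> e * norm (y - x)"
    proof (cases "x \<le> y")
      case True
      have "norm (g y - g x - (y - x) *\<^sub>R cis (\<phi> x)) \<le> 2 * (\<phi> y - \<phi> x) * (y - x)"
        by (rule chord_estimate) (use True 4 3 x in auto)
      also have "\<dots> \<le> e * (y - x)" using 5 True by (intro mult_right_mono) auto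
      finally show ?thesis using True by simp
    next
      case False
      have "norm (g x - g y - (x - y) *\<^sub>R cis (\<phi> x)) \<le> 2 * (\<phi> x - \<phi> y) * (x - y)"
        by (rule chord_estimate) (use False 4 3 x in auto)
      also have "\<dots> \<le> e * (x - y)" using 5 False by (intro mult_right_mono) auto
      also have "norm (g x - g y - (x - y) *\<^sub>R cis (\<phi> x)) = norm (g y - g x - (y - x) *\<^sub>R cis (\<phi> x))"
        by (subst norm_minus_commute[symmetric]) (simp add: algebra_simps)
      finally show ?thesis using False by simp
    qed
  qed
qed

end

section \<open>Periodic extension and winding\<close>

lemma continuous_Ints_valued_constant:
  fixes f :: "real \<Rightarrow> real"
  assumes "continuous_on UNIV f" "\<And>x. f x \<in> \<int>"
  obtains k :: int where "\<And>x. f x = of_int k"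
proof -
  have "f constant_on UNIV"
  proof (rule continuous_discrete_range_constant[OF _ assms(1)])
    fix x
    have "1 \<le> norm (f y - f x)" if "f y \<noteq> f x" for y
      using Ints_nonzero_abs_ge1[of "f y - f x"] assms(2) that by auto
    then show "\<exists>e>0. \<forall>y. y \<in> UNIV \<and> f y \<noteq> f x \<longrightarrow> e \<le> norm (f y - f x)"
      by (intro exI[of _ 1]) auto
  qed simp
  then obtain c where "\<And>x. f x = c" by (auto simp: constant_on_def)
  moreover obtain k where "f 0 = of_int k" using assms(2)[of 0] by (auto elim: Ints_cases)
  ultimately show ?thesis using that by metis
qed

lemma shift_int_multiple:
  fixes f :: "real \<Rightarrow> 'a::real_vector"
  assumes "\<And>x. f (x + L) = f x + c"
  shows "f (x + of_int n * L) = f x + of_int n *\<^sub>R c"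
proof (induction n arbitrary: x rule: int_induct[of _ 0])
  case (step1 i)
  have "f (x + of_int (i + 1) * L) = f ((x + of_int i * L) + L)" by (simp add: algebra_simps)
  also have "\<dots> = f x + of_int i *\<^sub>R c + c" unfolding assms step1 ..
  finally show ?case by (simp add: algebra_simps)
next
  case (step2 i)
  have "f x + of_int i *\<^sub>R c = f ((x + of_int (i - 1) * L) + L)"
    unfolding step2(2)[symmetric] by (simp add: algebra_simps)
  also have "\<dots> = f (x + of_int (i - 1) * L) + c" by (rule assms)
  finally show ?case by (simp add: algebra_simps)
qed simp

definition periodic_ext :: "real \<Rightarrow> (real \<Rightarrow> 'a) \<Rightarrow> real \<Rightarrow> 'a" where
  "periodic_ext L f x = f (x - of_int \<lfloor>x / L\<rfloor> * L)"

lemma frac_interval: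
  fixes L :: real
  assumes "0 < L"
  shows "0 \<le> x - of_int \<lfloor>x / L\<rfloor> * L" "x - of_int \<lfloor>x / L\<rfloor> * L < L"
  using assms floor_divide_lower[of L x] floor_divide_upper[of L x] by (auto simp: algebra_simps)

lemma periodic_ext_eq:
  assumes "0 < L" "f L = f 0" "x \<in> {of_int n * L..of_int (n + 1) * L}"
  shows "periodic_ext L f x = f (x - of_int n * L)"
proof (cases "x = of_int (n + 1) * L")
  case True
  then have "\<lfloor>x / L\<rfloor> = n + 1" using assms(1) by simp
  then show ?thesis using True assms by (simp add: periodic_ext_def algebra_simps)
next
  case False
  then have "\<lfloor>x / L\<rfloor> = n" using assms by (intro floor_unique) (auto simp: field_simps)
  then show ?thesis by (simp add: periodic_ext_def)
qed

lemma periodic_ext_base: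
  assumes "0 < L" "f L = f 0" "x \<in> {0..L}"
  shows "periodic_ext L f x = f x"
  using periodic_ext_eq[OF assms(1,2), of x 0] assms(3) by simp

lemma periodic_ext_periodic:
  assumes "0 < L"
  shows "periodic_ext L f (x + L) = periodic_ext L f x"
proof -
  have "\<lfloor>(x + L) / L\<rfloor> = \<lfloor>x / L\<rfloor> + 1" using assms by (simp add: add_divide_distrib)
  then show ?thesis by (simp add: periodic_ext_def algebra_simps)
qed

lemma continuous_periodic_ext:
  fixes f :: "real \<Rightarrow> 'a::topological_space"
  assumes L: "0 < L" and f: "continuous_on {0..L} f" "f L = f 0"
  shows "continuous_on UNIV (periodic_ext L f)"
  unfolding continuous_on_eq_continuous_at[OF open_UNIV]
proof
  fix x :: real
  have piece: "continuous_on {of_int n * L..of_int (n + 1) * L} (periodic_ext L f)" for n :: int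
  proof -
    have "continuous_on {of_int n * L..of_int (n + 1) * L} (\<lambda>x. f (x - of_int n * L))"
      by (rule continuous_on_compose2[OF f(1)]) (auto intro!: continuous_intros simp: algebra_simps)
    then show ?thesis
      by (rule continuous_on_eq) (simp add: periodic_ext_eq[OF L f(2)])
  qed
  define n where "n = \<lfloor>x / L\<rfloor>"
  have n: "of_int n * L \<le> x" "x < of_int (n + 1) * L"
    using frac_interval[OF L, of x] by (auto simp: n_def algebra_simps)
  \<comment> \<open>The point may be the left end of its period, so the preceding period is glued on
    to make it interior.\<close>
  have "continuous_on ({of_int (n - 1) * L..of_int (n - 1 + 1) * L} \<union> {of_int n * L..of_int (n + 1) * L}) (periodic_ext L f)"
    by (rule continuous_on_closed_Un[OF _ _ piece piece]) auto
  moreover have "{of_int (n - 1) * L..of_int (n - 1 + 1) * L} \<union> {of_int n * L..of_int (n + 1) * L} = {of_int (n - 1) * L..of_int (n + 1) * L}"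
    using L by (auto simp: algebra_simps)
  ultimately have "continuous_on {of_int (n - 1) * L..of_int (n + 1) * L} (periodic_ext L f)" by simp
  then show "isCont (periodic_ext L f) x"
  proof (rule continuous_on_interior)
    have "of_int (n - 1) * L < of_int n * L" using L by simp
    then show "x \<in> interior {of_int (n - 1) * L..of_int (n + 1) * L}"
      using n unfolding interior_atLeastAtMost_real greaterThanLessThan_iff by linarith
  qed
qed

context support_loop
begin

text \<open>The multiples of \<open>L\<close> are included because arc length is only given within
  one period, and because solutions on \<open>{0..L}\<close> may acquire corners there when extended
  periodically.\<close>

definition bad :: "real set" where
  "bad = {x. \<not> isCont \<phi> x} \<union> range (\<lambda>n::int. of_int n * L)"

lemma countable_bad: "countable bad"
  using mono_ctble_discont[OF mono_\<phi>] by (auto simp: bad_def)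

lemma isCont_cis_\<phi>: "x \<notin> bad \<Longrightarrow> isCont (\<lambda>x. cis (\<phi> x)) x"
  unfolding isCont_def cis.code bad_def by (intro tendsto_Complex tendsto_cos tendsto_sin) auto

lemma isCont_\<phi>: "x \<notin> bad \<Longrightarrow> isCont \<phi> x"
  by (simp add: bad_def)

lemma bad_shift: "x + of_int n * L \<in> bad \<longleftrightarrow> x \<in> bad"
proof -
  have *: "isCont \<phi> (x + of_int n * L)" if "isCont \<phi> x" for x n
  proof -
    have "isCont (\<lambda>y. \<phi> (y - of_int n * L)) (x + of_int n * L)"
      by (rule isCont_o2[of _ "\<lambda>y. y - of_int n * L" \<phi>]) (use that in simp_all)
    then have "isCont (\<lambda>y. \<phi> (y - of_int n * L) + of_int n *\<^sub>R (2 * pi)) (x + of_int n * L)"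
      by (rule isCont_add[OF _ continuous_const])
    moreover have "(\<lambda>y. \<phi> (y - of_int n * L) + of_int n *\<^sub>R (2 * pi)) = \<phi>"
    proof
      fix y
      show "\<phi> (y - of_int n * L) + of_int n *\<^sub>R (2 * pi) = \<phi> y"
        using shift_int_multiple[of \<phi> L "2 * pi", OF \<phi>_periodic, of "y - of_int n * L" n] by simp
    qed
    ultimately show ?thesis by (simp only:)
  qed
  have "isCont \<phi> (x + of_int n * L) \<longleftrightarrow> isCont \<phi> x"
    using *[of x n] *[of "x + of_int n * L" "- n"] by auto
  moreover have "x + of_int n * L \<in> range (\<lambda>n::int. of_int n * L) \<longleftrightarrow> x \<in> range (\<lambda>n::int. of_int n * L)"
  proof
    assume "x + of_int n * L \<in> range (\<lambda>n::int. of_int n * L)"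
    then obtain k :: int where "x + of_int n * L = of_int k * L" by auto
    then have "x = of_int (k - n) * L" by (simp add: algebra_simps)
    then show "x \<in> range (\<lambda>n::int. of_int n * L)" by blast
  next
    assume "x \<in> range (\<lambda>n::int. of_int n * L)"
    then obtain k :: int where "x = of_int k * L" by auto
    then have "x + of_int n * L = of_int (k + n) * L" by (simp add: algebra_simps)
    then show "x + of_int n * L \<in> range (\<lambda>n::int. of_int n * L)" by blast
  qed
  ultimately show ?thesis by (simp add: bad_def)
qed

lemma has_vector_derivative_g:
  assumes "x \<notin> bad"
  shows "(g has_vector_derivative cis (\<phi> x)) (at x)"
proof -
  define n where "n = \<lfloor>x / L\<rfloor>"
  define y where "y = x - of_int n * L"
  have y: "y \<notin> bad" using bad_shift[of x "- n"] assms by (simp add: y_def)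
  then have "y \<noteq> of_int 0 * L" by (auto simp: bad_def)
  then have y0: "0 < y" "y < L" using frac_interval[OF L, of x] by (auto simp: y_def n_def)
  have "(g has_vector_derivative cis (\<phi> y)) (at y)"
    by (rule has_vector_derivative_g_base) (use y y0 isCont_\<phi> in auto)
  moreover have "((\<lambda>s. s - of_int n * L) has_vector_derivative 1) (at x)"
    using has_vector_derivative_diff[OF has_vector_derivative_id has_vector_derivative_const] by simp
  ultimately have "((\<lambda>s. g (s - of_int n * L)) has_vector_derivative 1 *\<^sub>R cis (\<phi> y)) (at x)"
    using vector_diff_chain_at[of "\<lambda>s. s - of_int n * L" 1 x g "cis (\<phi> y)"]
    by (simp add: o_def y_def)
  moreover have "(\<lambda>s. g (s - of_int n * L)) = g"
  proof
    fix s
    show "g (s - of_int n * L) = g s"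
      using shift_int_multiple[of g L 0 s "- n"] g(2) by simp
  qed
  moreover have "cis (\<phi> y) = cis (\<phi> x)"
    using shift_int_multiple[of "\<lambda>x. cis (\<phi> x)" L 0 x "- n"] \<tau> by (simp add: cis_\<phi> y_def)
  ultimately show ?thesis by simp
qed

end

section \<open>Convex regions around the origin\<close>

lemma frontier_ray_unique:
  fixes K :: "'a::euclidean_space set"
  assumes K: "convex K" "0 \<in> interior K" and a: "a \<in> frontier K" and t: "0 < t" "t *\<^sub>R a \<in> frontier K"
  shows "t = 1"
proof -
  have small: False if "b \<in> frontier K" "s *\<^sub>R b \<in> frontier K" "0 < s" "s < 1" for b s
  proof -
    have "b - (1 - s) *\<^sub>R (b - 0) \<in> interior K"
      by (rule mem_interior_closure_convex_shrink[OF K]) (use that in \<open>auto simp: frontier_def\<close>)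
    then show False using that by (simp add: frontier_def algebra_simps)
  qed
  show ?thesis
  proof (cases t "1::real" rule: linorder_cases)
    case less
    then show ?thesis using small[OF a t(2,1)] by simp
  next
    case greater
    then show ?thesis using small[OF t(2), of "inverse t"] a t by (simp add: inverse_less_1_iff)
  qed
qed

text \<open>The inner normal \<open>n\<close> of a supporting line, turned clockwise by a right
  angle, has the region on its left. The inscribed ball keeps the line at distance
  \<open>\<rho>\<close> from the origin.\<close>

lemma frontier_supporting_direction:
  assumes K: "convex K" "closed K" and \<rho>: "0 < \<rho>" "cball 0 \<rho> \<subseteq> K" and a: "a \<in> frontier K"
  shows "\<exists>t. norm t = 1 \<and> (\<forall>y\<in>K. 0 \<le> wedge t (y - a)) \<and> \<rho> \<le> wedge a t"
proof -
  have "interior K \<noteq> {}"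
    using \<rho> interior_mono[OF \<rho>(2)] by (force simp: interior_cball)
  then have ri: "rel_interior K = interior K" by (simp add: rel_interior_nonempty_interior)
  have "a \<in> closure K" "a \<notin> rel_interior K" using a by (auto simp: frontier_def ri)
  then obtain n where n: "n \<noteq> 0" "\<And>y. y \<in> closure K \<Longrightarrow> n \<bullet> a \<le> n \<bullet> y"
    using supporting_hyperplane_relative_frontier[OF K(1)] by metis
  define t where "t = - \<i> * sgn n"
  have w: "norm n * wedge t v = n \<bullet> v" for v
    using n(1) by (simp add: t_def wedge_def sgn_eq inner_complex_def field_simps)
  have "norm t = 1" using n(1) by (simp add: t_def norm_mult norm_sgn)
  moreover have "0 \<le> wedge t (y - a)" if "y \<in> K" for y
  proof -
    have "0 \<le> norm n * wedge t (y - a)"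
      unfolding w using n(2)[of y] that closure_subset by (auto simp: inner_diff_right)
    then show ?thesis using n(1) by (simp add: zero_le_mult_iff)
  qed
  moreover have "\<rho> \<le> wedge a t"
  proof -
    \<comment> \<open>The point of the ball nearest to the supporting line.\<close>
    have "of_real (- \<rho>) * sgn n \<in> cball 0 \<rho>" using \<rho>(1) n(1) by (simp add: norm_mult norm_sgn)
    then have "of_real (- \<rho>) * sgn n \<in> K" using \<rho> by blast
    from calculation(2)[OF this] have "0 \<le> wedge t (of_real (- \<rho>) * sgn n) - wedge t a" by (simp add: wedge_simps)
    moreover have "wedge t (sgn n) = 1"
    proof -
      have "wedge t (sgn n) = (Re (sgn n))\<^sup>2 + (Im (sgn n))\<^sup>2"
        by (simp add: t_def wedge_def power2_eq_square)
      also have "\<dots> = (norm (sgn n))\<^sup>2" by (simp add: cmod_power2)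
      finally show ?thesis using n(1) by (simp add: norm_sgn)
    qed
    ultimately show ?thesis unfolding wedge_simps wedge_commute[of t a] by simp
  qed
  ultimately show ?thesis by blast
qed

text \<open>A lift of the direction is injective because each ray meets the curve once per period; hence it is monotone and
  gains exactly one turn.\<close>

lemma winding_lift:
  fixes h :: "real \<Rightarrow> complex"
  assumes L: "0 < L" and h: "continuous_on UNIV h" "\<And>x. h (x + L) = h x" "\<And>x. h x \<noteq> 0"
    and ray: "\<And>x y t. 0 < t \<Longrightarrow> h x = of_real t * h y \<Longrightarrow> \<exists>n::int. x = y + of_int n * L"
  obtains \<theta> where "continuous_on UNIV \<theta>" "\<And>x. h x = of_real (norm (h x)) * cis (\<theta> x)"
    "(strict_mono \<theta> \<and> (\<forall>x. \<theta> (x + L) = \<theta> x + 2 * pi)) \<or>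
     (strict_mono (\<lambda>x. - \<theta> x) \<and> (\<forall>x. \<theta> (x + L) = \<theta> x - 2 * pi))"
proof -
  obtain f where f: "continuous_on UNIV f" "\<And>x. h x = exp (f x)"
    using continuous_logarithm_on_contractible[OF h(1) convex_imp_contractible[OF convex_UNIV] h(3)] by auto
  define \<theta> where "\<theta> x = Im (f x)" for x
  have c\<theta>: "continuous_on UNIV \<theta>" unfolding \<theta>_def by (intro continuous_intros f)
  have pol: "h x = of_real (norm (h x)) * cis (\<theta> x)" for x
    by (simp add: f(2) \<theta>_def exp_eq_polar norm_mult)
  \<comment> \<open>Angles that agree up to full turns mean a common ray, hence parameters that
    differ by whole periods.\<close>
  have same: "\<exists>n::int. x = y + of_int n * L" if "\<theta> x = \<theta> y + of_int k * (2 * pi)" for x y k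
  proof (rule ray)
    show "0 < norm (h x) / norm (h y)" using h(3) by simp
    have "cis (\<theta> x) = cis (\<theta> y)"
      unfolding that by (simp add: cis_mult[symmetric] mult.commute[of _ "2 * pi"])
    then have "h x = of_real (norm (h x)) * cis (\<theta> y)" using pol[of x] by (rule subst)
    also have "cis (\<theta> y) = h y / of_real (norm (h y))"
      using pol[of y] h(3)[of y] by (metis nonzero_mult_div_cancel_left norm_eq_zero of_real_eq_0_iff)
    finally show "h x = of_real (norm (h x) / norm (h y)) * h y" by simp
  qed
  have zi: "(\<theta> (x + L) - \<theta> x) / (2 * pi) \<in> \<int>" for x
  proof -
    have "exp (f (x + L)) = exp (f x)" using h(2)[of x] by (simp add: f(2))
    then obtain n :: int where "f (x + L) = f x + of_int (2 * n) * of_real pi * \<i>"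
      by (auto simp: exp_eq)
    then have "\<theta> (x + L) = \<theta> x + of_int n * (2 * pi)" by (simp add: \<theta>_def)
    then show ?thesis by simp
  qed
  have zc: "continuous_on UNIV (\<lambda>x. (\<theta> (x + L) - \<theta> x) / (2 * pi))"
    by (intro continuous_on_divide continuous_on_diff continuous_on_compose2[OF c\<theta>] c\<theta>
          continuous_on_add continuous_on_id continuous_on_const) simp_all
  obtain k :: int where k: "\<And>x. (\<theta> (x + L) - \<theta> x) / (2 * pi) = of_int k"
    using continuous_Ints_valued_constant[OF zc zi] by blast
  have per: "\<theta> (x + L) = \<theta> x + of_int k * (2 * pi)" for x
    using k[of x] by (simp add: field_simps)
  have pern: "\<theta> (x + of_int n * L) = \<theta> x + of_int n * of_int k * (2 * pi)" for x n
    using shift_int_multiple[of \<theta> L "of_int k * (2 * pi)"] per by simp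
  have ivt: "\<exists>x. 0 < x \<and> x < L \<and> \<theta> x = v" if v: "\<theta> a < v" "v < \<theta> b" "{a, b} \<subseteq> {0..L}" for a b v
  proof -
    have "connected (\<theta> ` closed_segment a b)"
      by (intro connected_continuous_image continuous_on_subset[OF c\<theta>] connected_segment) auto
    then have "v \<in> \<theta> ` closed_segment a b"
      using connectedD_interval[of "\<theta> ` closed_segment a b" "\<theta> a" "\<theta> b" v] v by auto
    then obtain x where x: "x \<in> closed_segment a b" "\<theta> x = v" by auto
    moreover have "x \<noteq> a" "x \<noteq> b" using x v by auto
    ultimately have "min a b < x" "x < max a b" by (auto simp: closed_segment_eq_real_ivl split: if_splits)
    then have "0 < x" "x < L" using v(3) by (auto simp: min_def max_def split: if_splits)
    then show ?thesis using x by blast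
  qed
  have in_L: False if "x = y + of_int n * L" "0 \<le> y" "y < x" "x < L" for x y and n :: int
  proof -
    have "0 < of_int n * L" "of_int n * L < 1 * L" using that by linarith+
    then show False using L by (simp add: zero_less_mult_iff mult_less_cancel_right)
  qed
  \<comment> \<open>Without any gain of angle, a value strictly between those at 0 and
    \<open>L / 2\<close> would be taken in both halves of the period, at two parameters less than
    one period apart.\<close>
  have k0: "k \<noteq> 0"
  proof
    assume k0: "k = 0"
    define v where "v = (\<theta> 0 + \<theta> (L / 2)) / 2"
    have ne: "\<theta> (L / 2) \<noteq> \<theta> 0"
    proof
      assume "\<theta> (L / 2) = \<theta> 0"
      then obtain n :: int where n: "L / 2 = 0 + of_int n * L" using same[of "L / 2" 0 0] by auto
      show False using in_L[OF n] L by simp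
    qed
    have e: "\<theta> L = \<theta> 0" using per[of 0] k0 by simp
    have mid: "\<exists>x\<in>{a..b}. \<theta> x = v"
      if "a \<le> b" "(\<theta> a \<le> v \<and> v \<le> \<theta> b) \<or> (\<theta> b \<le> v \<and> v \<le> \<theta> a)" for a b
      using IVT'[of \<theta> a v b] IVT2'[of \<theta> b v a] that continuous_on_subset[OF c\<theta>, of "{a..b}"] by fastforce
    have "(\<theta> 0 \<le> v \<and> v \<le> \<theta> (L/2)) \<or> (\<theta> (L/2) \<le> v \<and> v \<le> \<theta> 0)"
      by (auto simp: v_def)
    then have "\<exists>x\<in>{0..L/2}. \<theta> x = v" "\<exists>x\<in>{L/2..L}. \<theta> x = v"
      using L e by (intro mid; auto)+
    then obtain x y where xy: "x \<in> {0..L/2}" "y \<in> {L/2..L}" "\<theta> x = v" "\<theta> y = v" by auto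
    have "v \<noteq> \<theta> 0" "v \<noteq> \<theta> (L/2)" using ne by (auto simp: v_def)
    then have "y \<noteq> L" "x \<noteq> L/2" using xy e by auto
    moreover obtain n :: int where n: "y = x + of_int n * L" using same[of y x 0] xy by auto
    ultimately show False using in_L[OF n] xy by auto
  qed
  have "inj \<theta>"
  proof (rule injI)
    fix x y assume e: "\<theta> x = \<theta> y"
    then obtain n :: int where n: "x = y + of_int n * L" using same[of x y 0] by auto
    then have "of_int n * of_int k * (2 * pi) = 0" using pern[of y n] e by simp
    then show "x = y" using n k0 by simp
  qed
  then have mono: "strict_mono_on UNIV \<theta> \<or> strict_antimono_on UNIV \<theta>"
    using injective_eq_monotone_map[OF is_interval_univ c\<theta>] by simp
  \<comment> \<open>A lift gaining two or more turns would meet the ray of \<open>h 0\<close> again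
    strictly inside the period.\<close>
  have kle: "k \<le> 1"
  proof (rule ccontr)
    assume "\<not> k \<le> 1"
    then have "\<theta> 0 + 2 * pi < \<theta> L" using per[of 0] by simp
    then obtain x where "0 < x" "x < L" "\<theta> x = \<theta> 0 + 2 * pi" using ivt[of 0 "\<theta> 0 + 2 * pi" L] L by auto
    moreover from this obtain n :: int where n: "x = 0 + of_int n * L" using same[of x 0 1] by auto
    ultimately show False using in_L[OF n] by simp
  qed
  have kge: "- 1 \<le> k"
  proof (rule ccontr)
    assume "\<not> - 1 \<le> k"
    then have "of_int k < (- 1 :: real)" by simp
    then have "of_int k * (2 * pi) < (- 1) * (2 * pi)" by (intro mult_strict_right_mono) auto
    then have "\<theta> L < \<theta> 0 - 2 * pi" using per[of 0] by simp
    then obtain x where "0 < x" "x < L" "\<theta> x = \<theta> 0 - 2 * pi" using ivt[of L "\<theta> 0 - 2 * pi" 0] L by auto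
    moreover from this obtain n :: int where n: "x = 0 + of_int n * L" using same[of x 0 "-1"] by auto
    ultimately show False using in_L[OF n] by simp
  qed
  show ?thesis
  proof
    show "continuous_on UNIV \<theta>" by (rule c\<theta>)
    show "h x = of_real (norm (h x)) * cis (\<theta> x)" for x by (rule pol)
    have "k = 1 \<or> k = -1" using kle kge k0 by linarith
    then show "(strict_mono \<theta> \<and> (\<forall>x. \<theta> (x + L) = \<theta> x + 2 * pi)) \<or>
     (strict_mono (\<lambda>x. - \<theta> x) \<and> (\<forall>x. \<theta> (x + L) = \<theta> x - 2 * pi))"
    proof
      assume k: "k = 1"
      then have "\<theta> 0 < \<theta> L" using per[of 0] by simp
      then have "\<not> strict_antimono_on UNIV \<theta>" using L monotone_onD[of UNIV _ _ \<theta> 0 L] by fastforce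
      then show ?thesis using mono per k by simp
    next
      assume k: "k = -1"
      then have "\<theta> L < \<theta> 0" using per[of 0] by simp
      then have "\<not> strict_mono_on UNIV \<theta>" using L monotone_onD[of UNIV _ _ \<theta> 0 L] by fastforce
      then have "strict_antimono_on UNIV \<theta>" using mono by simp
      then have "strict_mono (\<lambda>x. - \<theta> x)" by (auto simp: monotone_on_def strict_mono_def)
      then show ?thesis using per k by simp
    qed
  qed
qed

section \<open>Area of the region\<close>

lemma curve_length_cong:
  assumes "\<And>x y. x \<in> {s..t} \<Longrightarrow> y \<in> {s..t} \<Longrightarrow> norm (f x - f y) = norm (h x - h y)"
  shows "curve_length f s t = curve_length h s t"
  unfolding curve_length_def
proof (rule SUP_cong[OF refl])
  fix d assume "d \<in> {d. d division_of {s..t}}"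
  then have d: "d division_of {s..t}" by simp
  have "norm (f (Sup k) - f (Inf k)) = norm (h (Sup k) - h (Inf k))" if k: "k \<in> d" for k
  proof -
    obtain u v where "k = {u..v}" using division_ofD(4)[OF d k] by auto
    moreover have "k \<noteq> {}" "k \<subseteq> {s..t}" using division_ofD(2,3)[OF d k] by auto
    ultimately show ?thesis using assms by auto
  qed
  then show "ereal (\<Sum>k\<in>d. norm (f (Sup k) - f (Inf k))) = ereal (\<Sum>k\<in>d. norm (h (Sup k) - h (Inf k)))"
    by simp
qed

text \<open>The lift of the direction decides the sense of rotation; a clockwise curve is replaced
  by its mirror image in the real axis.\<close>

theorem convex_curve_support_loop:
  fixes K :: "complex set"
  assumes K: "compact K" "convex K" "0 \<in> interior K"
    and \<gamma>: "closed_arclength_parametrization \<gamma> L (frontier K)"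
  obtains g \<theta> \<tau> \<rho> where "support_loop L g \<theta> \<tau> \<rho>"
    "(\<forall>x\<in>{0..L}. g x = \<gamma> x) \<or> (\<forall>x\<in>{0..L}. g x = cnj (\<gamma> x))"
proof -
  have L: "0 < L" and c\<gamma>: "continuous_on {0..L} \<gamma>" and im: "\<gamma> ` {0..L} = frontier K"
    and cl: "\<gamma> L = \<gamma> 0" and inj: "inj_on \<gamma> {0..<L}"
    and len: "\<And>s t. 0 \<le> s \<Longrightarrow> s \<le> t \<Longrightarrow> t \<le> L \<Longrightarrow> curve_length \<gamma> s t = ereal (t - s)"
    using \<gamma> by (auto simp: closed_arclength_parametrization_def)
  define h where "h = periodic_ext L \<gamma>"
  have ch: "continuous_on UNIV h" and hp: "h (x + L) = h x" and h\<gamma>: "x \<in> {0..L} \<Longrightarrow> h x = \<gamma> x" for x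
    using continuous_periodic_ext[OF L c\<gamma> cl] periodic_ext_periodic[OF L] periodic_ext_base[OF L cl]
    by (auto simp: h_def)
  have hfr: "h x \<in> frontier K" for x
    using frac_interval[OF L, of x] by (auto simp: h_def periodic_ext_def simp flip: im)
  have hK: "h x \<in> K" for x using hfr[of x] frontier_subset_closed[OF compact_imp_closed[OF K(1)]] by blast
  have hnz: "h x \<noteq> 0" for x using hfr[of x] K(3) by (auto simp: frontier_def)
  have ray: "\<exists>n::int. x = y + of_int n * L" if t: "0 < t" "h x = of_real t * h y" for x y t
  proof -
    have "t = 1"
      by (rule frontier_ray_unique[OF K(2,3) hfr[of y] t(1)])
         (use t(2) hfr[of x] in \<open>simp add: scaleR_conv_of_real\<close>)
    then have "h x = h y" using t by simp
    then have "x - of_int \<lfloor>x / L\<rfloor> * L = y - of_int \<lfloor>y / L\<rfloor> * L"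
      using frac_interval[OF L, of x] frac_interval[OF L, of y]
      by (intro inj_onD[OF inj]) (auto simp: h_def periodic_ext_def)
    then have "x = y + of_int (\<lfloor>x / L\<rfloor> - \<lfloor>y / L\<rfloor>) * L" by (simp add: algebra_simps)
    then show ?thesis by blast
  qed
  obtain \<rho> where \<rho>: "0 < \<rho>" "cball 0 \<rho> \<subseteq> K"
    using K(3) mem_interior_cball by blast
  \<comment> \<open>The direction is selected per frontier point, not per parameter, so it is
    automatically periodic along the curve.\<close>
  obtain T where T: "\<And>a. a \<in> frontier K \<Longrightarrow> norm (T a) = 1 \<and> (\<forall>y\<in>K. 0 \<le> wedge (T a) (y - a)) \<and> \<rho> \<le> wedge a (T a)"
    using frontier_supporting_direction[OF K(2) compact_imp_closed[OF K(1)] \<rho>] by metis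
  obtain \<theta> where \<theta>: "continuous_on UNIV \<theta>" "\<And>x. h x = of_real (norm (h x)) * cis (\<theta> x)"
    "(strict_mono \<theta> \<and> (\<forall>x. \<theta> (x + L) = \<theta> x + 2 * pi)) \<or>
     (strict_mono (\<lambda>x. - \<theta> x) \<and> (\<forall>x. \<theta> (x + L) = \<theta> x - 2 * pi))"
    by (rule winding_lift[OF L ch hp hnz]) (rule ray that; assumption)+
  from \<theta>(3) show ?thesis
  proof
    assume a: "strict_mono \<theta> \<and> (\<forall>x. \<theta> (x + L) = \<theta> x + 2 * pi)"
    have "support_loop L h \<theta> (\<lambda>x. T (h x)) \<rho>"
    proof
      show "h x = complex_of_real (cmod (h x)) * cis (\<theta> x)" for x by (rule \<theta>(2))
      show "curve_length h s t = ereal (t - s)" if "0 \<le> s" "s \<le> t" "t \<le> L" for s t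
        using curve_length_cong[of s t h \<gamma>] h\<gamma> that len by auto
    qed (use a L ch hp \<theta>(1) \<rho> T hfr hK in auto)
    then show ?thesis using that h\<gamma> by blast
  next
    assume a: "strict_mono (\<lambda>x. - \<theta> x) \<and> (\<forall>x. \<theta> (x + L) = \<theta> x - 2 * pi)"
    \<comment> \<open>The reflection exchanges left and right, and the minus sign puts the region
      back on the left of the supporting direction.\<close>
    have "support_loop L (\<lambda>x. cnj (h x)) (\<lambda>x. - \<theta> x) (\<lambda>x. - cnj (T (h x))) \<rho>"
    proof
      show "continuous_on UNIV (\<lambda>x. cnj (h x))" "continuous_on UNIV (\<lambda>x. - \<theta> x)"
        by (intro continuous_intros ch \<theta>)+
      show "cnj (h x) = complex_of_real (cmod (cnj (h x))) * cis (- \<theta> x)" for x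
        by (subst \<theta>(2)) (simp add: cis_cnj)
      show "\<rho> \<le> wedge (cnj (h x)) (- cnj (T (h x)))" for x
        using T[OF hfr[of x]] by (simp add: wedge_simps)
      show "0 \<le> wedge (- cnj (T (h x))) (cnj (h y) - cnj (h x))" for x y
        using T[OF hfr[of x]] hK[of y] by (simp add: wedge_simps flip: complex_cnj_diff)
      show "curve_length (\<lambda>x. cnj (h x)) s t = ereal (t - s)" if st: "0 \<le> s" "s \<le> t" "t \<le> L" for s t
      proof -
        have "curve_length (\<lambda>x. cnj (h x)) s t = curve_length \<gamma> s t"
        proof (rule curve_length_cong)
          fix x y assume "x \<in> {s..t}" "y \<in> {s..t}"
          then have "h x = \<gamma> x" "h y = \<gamma> y" using st h\<gamma> by auto
          then show "norm (cnj (h x) - cnj (h y)) = norm (\<gamma> x - \<gamma> y)" by (simp flip: complex_cnj_diff)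
        qed
        then show ?thesis using len st by simp
      qed
    qed (use a L hp \<rho> T hfr in auto)
    then show ?thesis using that h\<gamma> by auto
  qed
qed

section \<open>Area of triangles\<close>

definition complex_of_vec :: "real ^ 2 \<Rightarrow> complex" where
  "complex_of_vec v = Complex (v $ 1) (v $ 2)"

lemma linear_complex_of_vec: "linear complex_of_vec"
  by (rule linearI) (simp_all add: complex_of_vec_def complex_eq_iff)

text \<open>Boxes correspond to boxes of the same volume. This carries the area formula for
  triangles in \<open>real ^ 2\<close> over to complex numbers.\<close>

lemma lborel_complex_of_vec: "(lborel :: complex measure) = distr lborel borel complex_of_vec"
proof (rule lborel_eqI)
  have m: "complex_of_vec \<in> borel_measurable borel"
    using linear_continuous_on[OF linear_complex_of_vec[THEN linear_conv_bounded_linear[THEN iffD1]]]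
    by (intro borel_measurable_continuous_onI)
  fix l u :: complex assume lu: "\<And>b. b \<in> Basis \<Longrightarrow> l \<bullet> b \<le> u \<bullet> b"
  define v :: "complex \<Rightarrow> real ^ 2" where "v z = (\<chi> i. if i = 1 then Re z else Im z)" for z
  have B: "(Basis :: (real ^ 2) set) = {axis 1 1, axis 2 1}"
    by (auto simp: Basis_vec_def UNIV_2)
  have ne: "axis 1 1 \<noteq> (axis 2 1 :: real ^ 2)" by (simp add: axis_eq_axis)
  have "complex_of_vec -` box l u = box (v l) (v u)"
    by (auto simp: box_def B Basis_complex_def complex_of_vec_def v_def inner_axis inner_complex_def)
  moreover have "Re l \<le> Re u" "Im l \<le> Im u" using lu[of 1] lu[of \<i>] by (auto simp: Basis_complex_def inner_complex_def)
  ultimately show "emeasure (distr lborel borel complex_of_vec) (box l u) = (\<Prod>b\<in>Basis. (u - l) \<bullet> b)"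
    using ne by (simp add: emeasure_distr m emeasure_lborel_box_eq B v_def inner_axis Basis_complex_def inner_complex_def)
qed simp

lemma measure_triangle:
  "measure lebesgue (convex hull {0, a, b :: complex}) = \<bar>wedge a b\<bar> / 2"
proof -
  have m: "complex_of_vec \<in> borel_measurable borel"
    using linear_continuous_on[OF linear_complex_of_vec[THEN linear_conv_bounded_linear[THEN iffD1]]]
    by (intro borel_measurable_continuous_onI)
  define v :: "complex \<Rightarrow> real ^ 2" where "v z = (\<chi> i. if i = 1 then Re z else Im z)" for z
  have cv: "complex_of_vec (v z) = z" for z by (simp add: complex_of_vec_def v_def)
  have inj: "inj complex_of_vec"
    by (auto simp: inj_def complex_of_vec_def vec_eq_iff forall_2)
  have cl: "closed (convex hull {0, a, b})"
    by (intro compact_imp_closed finite_imp_compact_convex_hull) simp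
  have "convex hull {0, a, b} = complex_of_vec ` (convex hull {0, v a, v b})"
    by (subst convex_hull_linear_image[OF linear_complex_of_vec])
       (simp add: cv linear_0[OF linear_complex_of_vec])
  then have vi: "complex_of_vec -` (convex hull {0, a, b}) = convex hull {0, v a, v b}"
    by (simp add: inj_vimage_image_eq[OF inj])
  have "measure lebesgue (convex hull {0, a, b}) = measure lborel (convex hull {0, a, b})"
    by (intro measure_completion) (use cl in auto)
  also have "\<dots> = measure (distr lborel borel complex_of_vec) (convex hull {0, a, b})"
    by (subst lborel_complex_of_vec) simp
  also have "\<dots> = measure lborel (convex hull {0, v a, v b})"
    by (subst measure_distr) (use m cl vi in auto)
  also have "\<dots> = \<bar>wedge a b\<bar> / 2"
    unfolding content_triangle by (simp add: v_def wedge_def abs_minus_commute mult.commute)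
  finally show ?thesis .
qed

section \<open>Area as an integral over the curve\<close>

context support_loop
begin

lemma borel_measurable_cis_\<phi>: "(\<lambda>x. cis (\<phi> x)) \<in> borel_measurable borel"
proof -
  have "(\<lambda>x. Complex (cos (\<phi> x)) (sin (\<phi> x))) \<in> borel_measurable borel"
    using borel_measurable_mono[OF mono_\<phi>] unfolding Complex_eq by measurable
  then show ?thesis by (simp add: cis.code)
qed

lemma integrable_tangent:
  assumes "continuous_on {a..b} f"
  shows "(\<lambda>x. wedge (f x) (cis (\<phi> x))) integrable_on {a..b}"
proof -
  have "(\<lambda>x. cis (\<phi> x) * cnj (f x)) integrable_on {a..b}"
    by (rule integrable_continuous_mult[OF _ borel_measurable_cis_\<phi>, where B = 1])
       (auto intro!: continuous_intros assms)
  from integrable_linear[OF this bounded_linear_Im]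
  have "(\<lambda>x. Im (cis (\<phi> x) * cnj (f x))) integrable_on {a..b}" by (simp only: o_def)
  then show ?thesis unfolding wedge_def mult.commute[of "cnj _"] .
qed

lemma continuous_g: "continuous_on S g"
  using g(1) continuous_on_subset by blast

lemma wedge_chord_has_integral:
  assumes "a \<le> b"
  shows "((\<lambda>x. wedge w (cis (\<phi> x))) has_integral wedge w (g b - g a)) {a..b}"
proof -
  have "((\<lambda>x. cis (\<phi> x)) has_integral (g b - g a)) {a..b}"
    by (rule fundamental_theorem_of_calculus_countable[OF assms countable_bad continuous_g])
       (auto intro: has_vector_derivative_g)
  then have "((\<lambda>x. cnj w * cis (\<phi> x)) has_integral cnj w * (g b - g a)) {a..b}"
    by (rule has_integral_mult_right)
  then have "((Im \<circ> (\<lambda>x. cnj w * cis (\<phi> x))) has_integral Im (cnj w * (g b - g a))) {a..b}"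
    by (rule has_integral_linear[OF _ bounded_linear_Im])
  then show ?thesis by (simp add: o_def wedge_def)
qed

lemma abs_wedge_le: "\<bar>wedge a b\<bar> \<le> norm a * norm b"
  using abs_Im_le_cmod[of "cnj a * b"] by (simp add: wedge_def norm_mult)

text \<open>The sectors of the region are covered by slightly enlarged inscribed triangles.\<close>

theorem area_le:
  fixes f :: "complex \<Rightarrow> complex"
  assumes f: "linear f" "\<And>a b. \<bar>wedge (f a) (f b)\<bar> = \<bar>wedge a b\<bar>"
    and K: "compact K" "\<And>k. k \<in> K \<Longrightarrow> \<exists>r x. 0 \<le> r \<and> r \<le> 1 \<and> x \<in> {0..L} \<and> k = f (of_real r * g x)"
    and I: "((\<lambda>x. wedge (g x) (cis (\<phi> x))) has_integral I) {0..L}"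
  shows "measure lebesgue K \<le> I / 2"
proof -
  define F where "F x = integral {0..x} (\<lambda>x. wedge (g x) (cis (\<phi> x)))" for x
  have Fint: "((\<lambda>x. wedge (g x) (cis (\<phi> x))) has_integral (F b - F a)) {a..b}" if "0 \<le> a" "a \<le> b" for a b
  proof -
    have "F a + integral {a..b} (\<lambda>x. wedge (g x) (cis (\<phi> x))) = F b"
      unfolding F_def using that
      by (intro Henstock_Kurzweil_Integration.integral_combine integrable_tangent continuous_g) auto
    then have "integral {a..b} (\<lambda>x. wedge (g x) (cis (\<phi> x))) = F b - F a" by linarith
    then show ?thesis using integrable_integral[OF integrable_tangent[OF continuous_g, of a b]] by (simp only:)
  qed
  have IF: "I = F L - F 0" using has_integral_unique[OF I Fint[of 0 L]] L by simp
  \<comment> \<open>The estimate for a subdivision into \<open>N\<close> arcs of length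
    \<open>d\<close>. The square is the area factor of the enlargement; \<open>d * L\<close> is the
    total cost of freezing \<open>g\<close> at the start of each arc.\<close>
  have main: "measure lebesgue K \<le> (1 + d / (\<rho> - d))\<^sup>2 / 2 * (I + d * L)"
    if N: "0 < N" and d: "d = L / real N" "d < \<rho>" for N :: nat and d
  proof -
    have d0: "0 < d" using N L d by simp
    define x where "x i = real i * d" for i :: nat
    have xN: "x N = L" using N d by (simp add: x_def)
    have xS: "x (Suc i) = x i + d" for i by (simp add: x_def algebra_simps)
    have x0: "0 \<le> x i" for i using d0 by (simp add: x_def)
    have xL: "x (Suc i) \<le> L" if "i < N" for i
    proof -
      have "x (Suc i) \<le> x N" unfolding x_def using that d0 by (intro mult_right_mono) auto
      then show ?thesis using xN by simp
    qed
    have close: "norm (g t - g s) \<le> d" if "x i \<le> s" "s \<le> t" "t \<le> x (Suc i)" "i < N" for i s t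
      using norm_chord_le[of s t] that x0[of i] xL[of i] xS[of i] by linarith
    \<comment> \<open>The integrand is at least \<open>\<rho>\<close> when \<open>g\<close> is taken
      at the point of tangency; freezing \<open>g\<close> at \<open>s\<close> costs at most
      \<open>d\<close>. In particular the triangles are nondegenerate.\<close>
    have lower: "(\<rho> - d) * (t - s) \<le> wedge (g s) (g t)"
      if st: "x i \<le> s" "s \<le> t" "t \<le> x (Suc i)" "i < N" for i s t
    proof -
      have "(\<rho> - d) * (t - s) \<le> wedge (g s) (g t - g s)"
      proof (rule has_integral_le[OF _ wedge_chord_has_integral[OF st(2)]])
        show "((\<lambda>y. \<rho> - d) has_integral (\<rho> - d) * (t - s)) {s..t}"
          using has_integral_const_real[of "\<rho> - d" s t] st by (simp add: mult.commute)
        fix y assume y: "y \<in> {s..t}"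
        have "\<bar>wedge (g y - g s) (cis (\<phi> y))\<bar> \<le> d"
          using abs_wedge_le[of "g y - g s" "cis (\<phi> y)"] close[of i s y] y st by auto
        then show "\<rho> - d \<le> wedge (g s) (cis (\<phi> y))"
          using \<rho>(2)[of y] by (simp add: wedge_simps cis_\<phi>)
      qed
      then show ?thesis by (simp add: wedge_simps)
    qed
    have upper: "wedge (g (x i)) (g (x (Suc i))) \<le> F (x (Suc i)) - F (x i) + d * d" if i: "i < N" for i
    proof -
      have le: "x i \<le> x (Suc i)" using d0 xS by simp
      have "wedge (g (x i)) (g (x (Suc i)) - g (x i)) \<le> F (x (Suc i)) - F (x i) + d * d"
      proof (rule has_integral_le[OF wedge_chord_has_integral[OF le]])
        have "((\<lambda>y. d) has_integral d * d) {x i..x (Suc i)}"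
          using has_integral_const_real[of d "x i" "x (Suc i)"] le by (simp add: xS)
        then show "((\<lambda>y. wedge (g y) (cis (\<phi> y)) + d) has_integral F (x (Suc i)) - F (x i) + d * d) {x i..x (Suc i)}"
          by (intro has_integral_add Fint x0 le)
        fix y assume y: "y \<in> {x i..x (Suc i)}"
        have "\<bar>wedge (g y - g (x i)) (cis (\<phi> y))\<bar> \<le> d"
          using abs_wedge_le[of "g y - g (x i)" "cis (\<phi> y)"] close[of i "x i" y] y i by auto
        then show "wedge (g (x i)) (cis (\<phi> y)) \<le> wedge (g y) (cis (\<phi> y)) + d"
          by (simp add: wedge_simps)
      qed
      then show ?thesis by (simp add: wedge_simps)
    qed
    \<comment> \<open>The enlargement by which the triangle also covers the part of the sector
      beyond the chord: the excess there is at most \<open>d * d\<close> divided by the determinant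
      \<open>w \<ge> (\<rho> - d) * d\<close>.\<close>
    define c where "c = 1 + d / (\<rho> - d)"
    have "0 \<le> d / (\<rho> - d)" using d(2) d0 by (intro divide_nonneg_pos) auto
    then have c0: "0 < c" by (simp add: c_def)
    define T where "T i = convex hull {0, of_real c * f (g (x i)), of_real c * f (g (x (Suc i)))}" for i
    have mT: "T i \<in> lmeasurable" for i
      unfolding T_def by (intro lmeasurable_compact finite_imp_compact_convex_hull) simp
    have T: "measure lebesgue (T i) \<le> c\<^sup>2 / 2 * (F (x (Suc i)) - F (x i) + d * d)" if i: "i < N" for i
    proof -
      have "measure lebesgue (T i) = c * c * \<bar>wedge (g (x i)) (g (x (Suc i)))\<bar> / 2"
        unfolding T_def measure_triangle using c0 f(2) by (simp add: wedge_simps abs_mult)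
      also have "\<bar>wedge (g (x i)) (g (x (Suc i)))\<bar> = wedge (g (x i)) (g (x (Suc i)))"
        using lower[of i "x i" "x (Suc i)"] i xS[of i] d d0 mult_nonneg_nonneg[of "\<rho> - d" d] by simp
      also have "c * c * \<dots> / 2 \<le> c * c * (F (x (Suc i)) - F (x i) + d * d) / 2"
        using upper[OF i] c0 by (intro divide_right_mono mult_left_mono) auto
      finally show ?thesis by (simp add: power2_eq_square)
    qed
    have "K \<subseteq> (\<Union>i<N. T i)"
    proof
      fix k assume "k \<in> K"
      then obtain r z where rz: "0 \<le> r" "r \<le> 1" "0 \<le> z" "z \<le> L" "k = f (of_real r * g z)" using K(2) by fastforce
      have "\<exists>i<N. x i \<le> z \<and> z \<le> x (Suc i)"
      \<comment> \<open>Rounding down would give the endpoint \<open>L\<close> the index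
        \<open>N\<close>; it belongs to the last arc.\<close>
      proof (cases "z = L")
        case True
        have "x (N - 1) \<le> z" "z \<le> x (Suc (N - 1))" using True N xN xS[of "N - 1"] d0 by auto
        then show ?thesis using N by (intro exI[of _ "N - 1"]) auto
      next
        case False
        define i where "i = nat \<lfloor>z / d\<rfloor>"
        have ri: "real i = of_int \<lfloor>z / d\<rfloor>" using rz d0 by (simp add: i_def)
        have "real i \<le> z / d" "z / d < real i + 1" unfolding ri by linarith+
        then have a: "x i \<le> z" "z \<le> x (Suc i)" using d0 by (auto simp: x_def field_simps)
        have "z < L" using False rz by simp
        then have "real i * d < real N * d" using a xN by (simp add: x_def)
        then have "i < N" using d0 by simp
        then show ?thesis using a by blast
      qed
      then obtain i where i: "i < N" "x i \<le> z" "z \<le> x (Suc i)" by blast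
      define a where "a = g (x i)"
      define b where "b = g (x (Suc i))"
      define w where "w = wedge a b"
      have w: "(\<rho> - d) * d \<le> w" using lower[of i "x i" "x (Suc i)"] i d0 xS by (simp add: w_def a_def b_def)
      then have w0: "0 < w" using d d0 mult_pos_pos[of "\<rho> - d" d] by linarith
      \<comment> \<open>Cramer's rule for \<open>g z\<close> in the basis \<open>a\<close>,
        \<open>b\<close>. The point lies beyond the chord exactly when \<open>s + t\<close> exceeds
        1.\<close>
      define s where "s = wedge (g z) b / w"
      define t where "t = wedge a (g z) / w"
      have "0 \<le> (\<rho> - d) * (x (Suc i) - z)" "0 \<le> (\<rho> - d) * (z - x i)" using d i by auto
      then have st0: "0 \<le> s" "0 \<le> t"
        using lower[of i z "x (Suc i)"] lower[of i "x i" z] i w0 by (auto simp: s_def t_def a_def b_def)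
      have gz: "g z = of_real s * a + of_real t * b"
      proof -
        have "of_real w * g z = of_real (wedge (g z) b) * a + of_real (wedge a (g z)) * b"
          by (simp add: w_def wedge_def complex_eq_iff algebra_simps)
        then have "g z = (of_real (wedge (g z) b) * a + of_real (wedge a (g z)) * b) / of_real w"
          using w0 by (simp add: field_simps)
        then show ?thesis by (simp add: s_def t_def add_divide_distrib)
      qed
      have "s + t - 1 = wedge (g z - a) (b - a) / w"
        using w0 wedge_commute[of "g z" a] by (simp add: s_def t_def w_def wedge_simps field_simps)
      also have "\<dots> \<le> d * d / w"
      proof (rule divide_right_mono)
        have "wedge (g z - a) (b - a) \<le> norm (g z - a) * norm (b - a)" using abs_wedge_le[of "g z - a" "b - a"] by linarith
        also have "\<dots> \<le> d * d"
          using close[of i "x i" z] close[of i "x i" "x (Suc i)"] i d0 xS by (intro mult_mono) (auto simp: a_def b_def)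
        finally show "wedge (g z - a) (b - a) \<le> d * d" .
      qed (use w0 in simp)
      also have "\<dots> \<le> d * d / ((\<rho> - d) * d)"
        using w w0 d(2) d0 by (intro divide_left_mono mult_pos_pos) auto
      also have "\<dots> = d / (\<rho> - d)" using d0 by simp
      finally have stc: "s + t \<le> c" by (simp add: c_def)
      define s' where "s' = r * s / c"
      define t' where "t' = r * t / c"
      have "s' + t' = r * ((s + t) / c)" by (simp add: s'_def t'_def algebra_simps add_divide_distrib)
      also have "\<dots> \<le> 1 * 1" using rz st0 stc c0 by (intro mult_mono) auto
      finally have le1: "s' + t' \<le> 1" by simp
      have fs: "f (of_real q * y) = of_real q * f y" for q y
        using linear_scale[OF f(1), of q y] by (simp add: scaleR_conv_of_real)
      have "k = of_real s' * (of_real c * f a) + of_real t' * (of_real c * f b)"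
        unfolding rz(5) gz fs linear_add[OF f(1)] using c0 by (simp add: s'_def t'_def algebra_simps)
      then have "k = (1 - s' - t') *\<^sub>R 0 + s' *\<^sub>R (of_real c * f a) + t' *\<^sub>R (of_real c * f b)"
        by (simp add: scaleR_conv_of_real)
      moreover have "0 \<le> s'" "0 \<le> t'" using rz st0 c0 by (auto simp: s'_def t'_def)
      ultimately have "k \<in> T i"
        unfolding T_def convex_hull_3 a_def b_def using le1
        by (intro CollectI exI[of _ "1 - s' - t'"] exI[of _ s'] exI[of _ t']) auto
      then show "k \<in> (\<Union>i<N. T i)" using i by blast
    qed
    then have "measure lebesgue K \<le> measure lebesgue (\<Union>i<N. T i)"
    proof (rule measure_mono_fmeasurable)
      show "K \<in> sets lebesgue" by (rule fmeasurableD[OF lmeasurable_compact[OF K(1)]])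
      show "(\<Union>i<N. T i) \<in> lmeasurable" by (intro fmeasurable.finite_UN mT) simp
    qed
    also have "\<dots> \<le> (\<Sum>i<N. measure lebesgue (T i))"
      by (rule measure_UNION_le) (use mT in auto)
    also have "\<dots> \<le> (\<Sum>i<N. c\<^sup>2 / 2 * (F (x (Suc i)) - F (x i) + d * d))"
      by (intro sum_mono T) simp
    also have "\<dots> = c\<^sup>2 / 2 * ((\<Sum>i<N. F (x (Suc i)) - F (x i)) + real N * (d * d))"
      unfolding sum_distrib_left[symmetric] sum.distrib by simp
    also have "(\<Sum>i<N. F (x (Suc i)) - F (x i)) = I"
      using sum_lessThan_telescope[of "\<lambda>i. F (x i)" N] xN IF by (simp add: x_def)
    also have "real N * (d * d) = d * L" using N d by simp
    finally show ?thesis unfolding c_def .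
  qed
  have lim: "(\<lambda>n. L / real n) \<longlonglongrightarrow> 0" by (rule lim_const_over_n)
  have "(\<lambda>n. (1 + L / real n / (\<rho> - L / real n))\<^sup>2 / 2 * (I + L / real n * L)) \<longlonglongrightarrow> (1 + 0 / (\<rho> - 0))\<^sup>2 / 2 * (I + 0 * L)"
    by (intro tendsto_intros lim) (use \<rho> in auto)
  moreover have "eventually (\<lambda>n. measure lebesgue K \<le> (1 + L / real n / (\<rho> - L / real n))\<^sup>2 / 2 * (I + L / real n * L)) sequentially"
    using order_tendstoD(2)[OF lim \<rho>(1)] eventually_gt_at_top[of 0]
    by eventually_elim (use main in blast)
  ultimately have "measure lebesgue K \<le> (1 + 0 / (\<rho> - 0))\<^sup>2 / 2 * (I + 0 * L)"
    by (rule tendsto_lowerbound) simp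
  then show ?thesis by simp
qed

end

section \<open>Closed solutions of the rolling system\<close>

text \<open>Near \<open>x\<close> both \<open>f y / f x\<close> and the increment of
  \<open>\<alpha>\<close> stay within the principal branch, so the continuous lift coincides there
  with one built from \<open>Ln\<close>, which is differentiable.\<close>

lemma DERIV_angle_lift:
  fixes f :: "real \<Rightarrow> complex" and \<alpha> :: "real \<Rightarrow> real"
  assumes f: "(f has_vector_derivative f') (at x)" "f x \<noteq> 0"
    and \<alpha>: "isCont \<alpha> x" "\<And>y. f y = of_real (norm (f y)) * cis (\<alpha> y)"
  shows "(\<alpha> has_real_derivative wedge (f x) f' / (norm (f x))\<^sup>2) (at x)"
proof -
  define \<beta> where "\<beta> y = \<alpha> x + Im (Ln (f y / f x))" for y
  have cf: "isCont f x" using f(1) has_vector_derivative_continuous by blast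
  have "((\<lambda>y. f y / f x) has_vector_derivative f' / f x) (at x)"
    by (rule has_vector_derivative_divide[OF f(1)])
  moreover have "(Ln has_field_derivative 1) (at (f x / f x))"
    using has_field_derivative_Ln[of 1] f(2) by simp
  ultimately have "((Ln \<circ> (\<lambda>y. f y / f x)) has_vector_derivative f' / f x * 1) (at x)"
    by (rule field_vector_diff_chain_at)
  then have "((\<lambda>y. Im (Ln (f y / f x))) has_vector_derivative Im (f' / f x)) (at x)"
    using bounded_linear.has_vector_derivative[OF bounded_linear_Im] by (fastforce simp: o_def)
  then have d\<beta>: "(\<beta> has_real_derivative Im (f' / f x)) (at x)"
    unfolding \<beta>_def has_real_derivative_iff_has_vector_derivative
    using has_vector_derivative_add[OF has_vector_derivative_const] by fastforce
  have "Im (f' / f x) = wedge (f x) f' / (norm (f x))\<^sup>2"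
    by (simp add: wedge_def complex_div_cnj[of f'] mult.commute)
  moreover have "eventually (\<lambda>y. \<beta> y = \<alpha> y) (nhds x)"
  proof -
    have 1: "eventually (\<lambda>y. dist (\<alpha> y) (\<alpha> x) < pi) (nhds x)"
      using \<alpha>(1) pi_gt_zero unfolding isCont_def by (intro tendstoD) (simp_all add: tendsto_at_iff_tendsto_nhds)
    have 2: "eventually (\<lambda>y. dist (f y) (f x) < norm (f x)) (nhds x)"
      using cf f(2) unfolding isCont_def by (intro tendstoD) (simp_all add: tendsto_at_iff_tendsto_nhds)
    show ?thesis using 1 2
    proof eventually_elim
      case (elim y)
      have fy: "f y \<noteq> 0" using elim(2) by (auto simp: dist_norm)
      have cis: "cis (\<alpha> z) = f z / of_real (norm (f z))" if "f z \<noteq> 0" for z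
        using \<alpha>(2)[of z] that by (metis nonzero_mult_div_cancel_left norm_eq_zero of_real_eq_0_iff)
      have "sgn (f y / f x) = cis (\<alpha> y - \<alpha> x)"
        unfolding cis_divide[symmetric] using cis[OF fy] cis[OF f(2)] by (simp add: sgn_eq norm_divide)
      then have "Arg (f y / f x) = \<alpha> y - \<alpha> x"
        using elim(1) by (intro cis_Arg_unique) (auto simp: dist_real_def)
      then show ?case using fy f(2) by (simp add: \<beta>_def Arg_def)
    qed
  qed
  ultimately show ?thesis
    using d\<beta> by (metis DERIV_cong_ev)
qed

context support_loop
begin

text \<open>Since the multiples of \<open>L\<close> belong to \<open>bad\<close>, the derivatives at
  the two ends of the period never have to be matched.\<close>

lemma has_vector_derivative_periodic_ext:
  fixes f :: "real \<Rightarrow> 'a::real_normed_vector"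
  assumes f: "f L = f 0" "\<And>x. x \<in> {0<..<L} \<Longrightarrow> x \<notin> bad \<Longrightarrow> (f has_vector_derivative f' x) (at x)"
    and x: "x \<notin> bad"
  shows "(periodic_ext L f has_vector_derivative periodic_ext L f' x) (at x)"
proof -
  define n where "n = \<lfloor>x / L\<rfloor>"
  define y where "y = x - of_int n * L"
  have y: "y \<notin> bad" using bad_shift[of x "- n"] x by (simp add: y_def)
  then have "y \<noteq> of_int 0 * L" by (auto simp: bad_def)
  then have y0: "0 < y" "y < L" using frac_interval[OF L, of x] by (auto simp: y_def n_def)
  have "(f has_vector_derivative f' y) (at y)"
    using f(2)[of y] y y0 by simp
  moreover have "((\<lambda>s. s - of_int n * L) has_vector_derivative 1) (at x)"
    using has_vector_derivative_diff[OF has_vector_derivative_id has_vector_derivative_const] by simp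
  ultimately have "((\<lambda>s. f (s - of_int n * L)) has_vector_derivative 1 *\<^sub>R f' y) (at x)"
    using vector_diff_chain_at[of "\<lambda>s. s - of_int n * L" 1 x f "f' y"]
    by (simp add: o_def y_def)
  then have "(periodic_ext L f has_vector_derivative 1 *\<^sub>R f' y) (at x)"
  proof (rule has_vector_derivative_transform_within_open)
    show "open {of_int n * L<..<of_int (n + 1) * L}" by simp
    show "x \<in> {of_int n * L<..<of_int (n + 1) * L}" using y0 by (auto simp: y_def algebra_simps)
    show "f (s - of_int n * L) = periodic_ext L f s" if "s \<in> {of_int n * L<..<of_int (n + 1) * L}" for s
      using periodic_ext_eq[OF L f(1), of s n] that by simp
  qed
  then show ?thesis by (simp add: periodic_ext_def y_def n_def)
qed

text \<open>Otherwise the curve would stay on a line of direction \<open>cis c\<close>. Being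
  closed, it would run along it in both senses, and the origin would lie at positive distance to the
  left of both.\<close>

lemma tangent_nondegenerate:
  assumes E: "countable E"
  shows "\<exists>x \<in> {0<..<L} - E. sin (\<phi> (x0 + x) - c) \<noteq> 0"
proof (rule ccontr)
  assume "\<not> ?thesis"
  then have s0: "sin (\<phi> (x0 + x) - c) = 0" if "x \<in> {0<..<L} - E" for x using that by blast
  define D where "D = E \<union> {x. x0 + x \<in> bad}"
  have D: "countable D"
  proof -
    have "{x. x0 + x \<in> bad} = (\<lambda>y. y - x0) ` bad" by (auto simp: image_iff intro!: bexI[of _ "x0 + _"])
    then show ?thesis using E countable_bad by (simp add: D_def)
  qed
  have dg: "((\<lambda>x. g (x0 + x)) has_vector_derivative cis (\<phi> (x0 + x))) (at x)" if "x \<notin> D" for x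
  proof -
    have "(g has_vector_derivative cis (\<phi> (x0 + x))) (at (x0 + x))"
      using that by (intro has_vector_derivative_g) (simp add: D_def)
    moreover have "((\<lambda>s. x0 + s) has_vector_derivative 1) (at x)"
      using has_vector_derivative_add[OF has_vector_derivative_const has_vector_derivative_id] by simp
    ultimately show ?thesis using vector_diff_chain_at[of "\<lambda>s. x0 + s" 1 x g] by (simp add: o_def)
  qed
  have cg: "continuous_on S (\<lambda>x. g (x0 + x))" for S
    by (intro continuous_on_compose2[OF g(1)] continuous_intros) auto
  have w: "wedge (cis c) (g (x0 + x)) = wedge (cis c) (g x0)" if x: "x \<in> {0..L}" for x
  proof -
    have "wedge (cis c) (g (x0 + x)) = wedge (cis c) (g (x0 + 0))"
    proof (rule constant_off_countable[OF _ D, where f = "\<lambda>x. wedge (cis c) (g (x0 + x))"])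
      show "0 \<le> x" using x by simp
      show "continuous_on {0..x} (\<lambda>x. wedge (cis c) (g (x0 + x)))"
        unfolding wedge_def by (intro continuous_intros cg)
      fix y assume y: "y \<in> {0<..<x} - D"
      have "((\<lambda>y. cnj (cis c) * g (x0 + y)) has_vector_derivative cnj (cis c) * cis (\<phi> (x0 + y))) (at y)"
        using y dg by (intro has_vector_derivative_mult_right) auto
      then have "((\<lambda>y. wedge (cis c) (g (x0 + y))) has_vector_derivative wedge (cis c) (cis (\<phi> (x0 + y)))) (at y)"
        unfolding wedge_def by (rule bounded_linear.has_vector_derivative[OF bounded_linear_Im])
      then show "((\<lambda>y. wedge (cis c) (g (x0 + y))) has_vector_derivative 0) (at y)"
        using s0[of y] y x by (simp add: wedge_cis D_def)
    qed
    then show ?thesis by simp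
  qed
  have dq: "((\<lambda>y. Re (cnj (cis c) * g (x0 + y))) has_vector_derivative cos (\<phi> (x0 + y) - c)) (at y)"
    if "y \<notin> D" for y
  proof -
    have "((\<lambda>y. cnj (cis c) * g (x0 + y)) has_vector_derivative cnj (cis c) * cis (\<phi> (x0 + y))) (at y)"
      using that dg by (intro has_vector_derivative_mult_right) auto
    then have "((\<lambda>y. Re (cnj (cis c) * g (x0 + y))) has_vector_derivative Re (cnj (cis c) * cis (\<phi> (x0 + y)))) (at y)"
      by (rule bounded_linear.has_vector_derivative[OF bounded_linear_Re])
    then show ?thesis by (simp add: cos_diff mult.commute)
  qed
  have cq: "continuous_on {0..L} (\<lambda>y. Re (cnj (cis c) * g (x0 + y)) * s - y)" for s
    by (intro continuous_intros cg)
  have L0: "0 \<le> L" using L by simp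
  \<comment> \<open>If the motion along the line never turned back, its speed would be 1 in one
    direction throughout, and the curve could not close up.\<close>
  have ex: "\<exists>x \<in> {0<..<L} - D. cos (\<phi> (x0 + x) - c) * s < 0" if s: "s = 1 \<or> s = -1" for s
  proof (rule ccontr)
    assume "\<not> ?thesis"
    then have nn: "0 \<le> cos (\<phi> (x0 + x) - c) * s" if "x \<in> {0<..<L} - D" for x
      using that by (meson not_less)
    have "Re (cnj (cis c) * g (x0 + 0)) * s - 0 \<le> Re (cnj (cis c) * g (x0 + L)) * s - L"
    proof (rule nondecreasing_off_countable[OF L0 D cq])
      show "((\<lambda>y. Re (cnj (cis c) * g (x0 + y)) * s - y) has_vector_derivative cos (\<phi> (x0 + x) - c) * s - 1) (at x)"
        if "x \<in> {0<..<L} - D" for x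
        using that by (intro has_vector_derivative_diff has_vector_derivative_mult_left dq has_vector_derivative_id) auto
      show "0 \<le> cos (\<phi> (x0 + x) - c) * s - 1" if x: "x \<in> {0<..<L} - D" for x
      proof -
        have "(cos (\<phi> (x0 + x) - c) * s)\<^sup>2 = 1"
        proof -
          have "sin (\<phi> (x0 + x) - c) = 0" using s0[of x] x by (simp add: D_def)
          then have "(cos (\<phi> (x0 + x) - c))\<^sup>2 = 1"
            using sin_cos_squared_add[of "\<phi> (x0 + x) - c"] by simp
          then show ?thesis using s by (auto simp: power_mult_distrib)
        qed
        then show ?thesis using nn[OF x] by (simp add: power2_eq_1_iff)
      qed
    qed
    then show False using g(2)[of x0] L by simp
  qed
  have pm: "s * wedge (cis c) (g x0) \<ge> \<rho>" if x: "x \<in> {0<..<L} - D" "cos (\<phi> (x0 + x) - c) * s < 0" and s: "s = 1 \<or> s = -1" for x s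
  proof -
    have sx: "sin (\<phi> (x0 + x) - c) = 0" using s0[of x] x by (simp add: D_def)
    have "(cos (\<phi> (x0 + x) - c))\<^sup>2 = 1" using sin_cos_squared_add[of "\<phi> (x0 + x) - c"] sx by simp
    then have cx: "cos (\<phi> (x0 + x) - c) = - s" using x s by (auto simp: power2_eq_1_iff)
    have "cis (\<phi> (x0 + x)) = cis c * cis (\<phi> (x0 + x) - c)" by (simp add: cis_mult)
    also have "cis (\<phi> (x0 + x) - c) = of_real (- s)" using sx cx by (simp add: complex_eq_iff)
    finally have "wedge (g (x0 + x)) (cis (\<phi> (x0 + x))) = - s * wedge (g (x0 + x)) (cis c)"
      by (simp add: wedge_simps mult.commute[of "cis c"])
    also have "\<dots> = s * wedge (cis c) (g (x0 + x))" using wedge_commute[of "cis c" "g (x0 + x)"] by simp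
    also have "wedge (cis c) (g (x0 + x)) = wedge (cis c) (g x0)" using w[of x] x by simp
    finally show ?thesis using \<rho>(2)[of "x0 + x"] by (simp add: cis_\<phi>)
  qed
  show False using ex[of 1] ex[of "-1"] pm[of _ 1] pm[of _ "-1"] \<rho>(1) by fastforce
qed

text \<open>The origin is never to the right of a tangent of \<open>V\<close>: \<open>x0\<close> is
  made the base point and the tangent there the horizontal axis, so that
  \<open>Im (t * V x0)\<close> becomes the height of the lowest point. If \<epsilon> and this height
  both vanish, only the weak inequality is claimed, and it is trivial.\<close>

lemma rolling_positive:
  fixes V :: "real \<Rightarrow> complex" and C :: "real \<Rightarrow> real"
  assumes cont: "continuous_on UNIV V" "continuous_on UNIV C"
    and per: "\<And>x. V (x + L) = V x" "\<And>x. C (x + L) = C x"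
    and der: "\<And>x. x \<notin> bad \<Longrightarrow> (V has_vector_derivative of_real (C x) * cis (\<phi> x)) (at x)"
      "\<And>x. x \<notin> bad \<Longrightarrow> (C has_vector_derivative Re (cnj (V x) * cis (\<phi> x))) (at x)"
    and C: "\<And>x. 0 < C x" "\<And>x. (C x)\<^sup>2 = \<epsilon> + (norm (V x))\<^sup>2" and \<epsilon>: "0 \<le> \<epsilon>"
  shows "0 \<le> wedge (V x0) (cis (\<phi> x0))" "0 < \<epsilon> \<Longrightarrow> 0 < wedge (V x0) (cis (\<phi> x0))"
proof -
  define t where "t = cnj (cis (\<phi> x0))"
  define \<psi> where "\<psi> x = \<phi> (x0 + x) - \<phi> x0" for x
  define D where "D = {x. x0 + x \<in> bad}"
  have D: "countable D"
  proof -
    have "D = (\<lambda>y. y - x0) ` bad" by (auto simp: D_def image_iff intro!: bexI[of _ "x0 + _"])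
    then show ?thesis using countable_bad by simp
  qed
  have tcis: "t * cis (\<phi> (x0 + x)) = cis (\<psi> x)" for x
    by (simp add: t_def \<psi>_def cis_cnj cis_mult)
  have shift: "((\<lambda>s. x0 + s) has_vector_derivative 1) (at x)" for x
    using has_vector_derivative_add[OF has_vector_derivative_const has_vector_derivative_id] by simp
  have dg: "((\<lambda>x. t * g (x0 + x)) has_vector_derivative cis (\<psi> x)) (at x)" if "x \<notin> D" for x
    using vector_diff_chain_at[OF shift has_vector_derivative_g[of "x0 + x"], THEN has_vector_derivative_mult_right, of t] that
    by (simp add: o_def tcis D_def)
  have dV: "((\<lambda>x. t * V (x0 + x)) has_vector_derivative of_real (C (x0 + x)) * cis (\<psi> x)) (at x)" if "x \<notin> D" for x
    using vector_diff_chain_at[OF shift der(1)[of "x0 + x"], THEN has_vector_derivative_mult_right, of t] that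
    by (simp add: o_def tcis[symmetric] D_def mult_ac)
  have nt: "norm (t * z) = norm z" for z by (simp add: t_def norm_mult)
  have tt: "cnj t * t = 1" by (simp add: t_def cis_cnj cis_mult)
  have dC: "((\<lambda>x. C (x0 + x)) has_vector_derivative Re (t * V (x0 + x)) * cos (\<psi> x) + Im (t * V (x0 + x)) * sin (\<psi> x)) (at x)"
    if "x \<notin> D" for x
  proof -
    have "Re (cnj (V (x0 + x)) * cis (\<phi> (x0 + x))) = Re ((cnj t * t) * (cnj (V (x0 + x)) * cis (\<phi> (x0 + x))))"
      by (simp only: tt mult_1)
    also have "(cnj t * t) * (cnj (V (x0 + x)) * cis (\<phi> (x0 + x))) = cnj (t * V (x0 + x)) * (t * cis (\<phi> (x0 + x)))"
      by (simp only: complex_cnj_mult mult_ac)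
    also have "Re \<dots> = Re (t * V (x0 + x)) * cos (\<psi> x) + Im (t * V (x0 + x)) * sin (\<psi> x)"
      unfolding tcis by (simp add: algebra_simps)
    finally show ?thesis
      using vector_diff_chain_at[OF shift der(2)[of "x0 + x"]] that by (simp add: o_def D_def)
  qed
  have cs: "continuous_on S (\<lambda>x. f (x0 + x))" if "continuous_on UNIV f" for f :: "real \<Rightarrow> 'b::topological_space" and S
    by (intro continuous_on_compose2[OF that] continuous_intros) auto
  note Re_der = bounded_linear.has_vector_derivative[OF bounded_linear_Re]
  note Im_der = bounded_linear.has_vector_derivative[OF bounded_linear_Im]
  have main: "Im (t * V (x0 + 0)) < 0" if e: "0 < \<epsilon> + (Im (t * V (x0 + 0)))\<^sup>2"
  proof (rule origin_inside_rolling_curve[OF L D, of \<psi> "\<lambda>x. Re (t * g (x0 + x))" "\<lambda>x. Re (t * V (x0 + x))" "\<lambda>x. Im (t * V (x0 + x))" "\<lambda>x. C (x0 + x)" \<epsilon>])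
    show "mono_on {0..L} \<psi>" using monoD[OF mono_\<phi>] by (auto simp: mono_on_def \<psi>_def)
    show "\<psi> x \<le> 2 * pi" if "x \<in> {0..L}" for x
      using monoD[OF mono_\<phi>, of "x0 + x" "x0 + L"] \<phi>_periodic[of x0] that by (simp add: \<psi>_def)
    show "continuous_on {0..L} (\<lambda>x. Re (t * g (x0 + x)))" "continuous_on {0..L} (\<lambda>x. Re (t * V (x0 + x)))"
      "continuous_on {0..L} (\<lambda>x. Im (t * V (x0 + x)))" "continuous_on {0..L} (\<lambda>x. C (x0 + x))"
      by (intro continuous_intros cs g cont)+
    fix x assume x: "x \<in> {0<..<L} - D"
    show "((\<lambda>x. Re (t * g (x0 + x))) has_real_derivative cos (\<psi> x)) (at x)"
      using Re_der[OF dg[of x]] x by (simp add: has_real_derivative_iff_has_vector_derivative)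
    show "((\<lambda>x. Re (t * V (x0 + x))) has_real_derivative C (x0 + x) * cos (\<psi> x)) (at x)"
      using Re_der[OF dV[of x]] x by (simp add: has_real_derivative_iff_has_vector_derivative)
    show "((\<lambda>x. Im (t * V (x0 + x))) has_real_derivative C (x0 + x) * sin (\<psi> x)) (at x)"
      using Im_der[OF dV[of x]] x by (simp add: has_real_derivative_iff_has_vector_derivative)
    show "((\<lambda>x. C (x0 + x)) has_real_derivative Re (t * V (x0 + x)) * cos (\<psi> x) + Im (t * V (x0 + x)) * sin (\<psi> x)) (at x)"
      unfolding has_real_derivative_iff_has_vector_derivative using dC[of x] x by simp
  next
    fix x
    have "(C (x0 + x))\<^sup>2 = \<epsilon> + (norm (t * V (x0 + x)))\<^sup>2" unfolding nt by (rule C)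
    then show "(C (x0 + x))\<^sup>2 = \<epsilon> + (Re (t * V (x0 + x)))\<^sup>2 + (Im (t * V (x0 + x)))\<^sup>2" by (simp only: cmod_power2 add.assoc)
  next
    fix \<delta> :: real and E :: "real set" assume "countable E"
    then show "\<exists>x\<in>{0<..<L} - E. sin (\<psi> x - \<delta>) \<noteq> 0"
      using tangent_nondegenerate[of E x0 "\<phi> x0 + \<delta>"] by (simp add: \<psi>_def diff_diff_eq)
  qed (use \<epsilon> e C g(2)[of x0] per[of x0] in \<open>auto simp: \<psi>_def\<close>)
  have w: "wedge (V x0) (cis (\<phi> x0)) = - Im (t * V (x0 + 0))"
    by (simp add: wedge_def t_def)
  show "0 < wedge (V x0) (cis (\<phi> x0))" if "0 < \<epsilon>"
    using main that by (simp add: w add_pos_nonneg)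
  show "0 \<le> wedge (V x0) (cis (\<phi> x0))"
    using main \<epsilon> by (cases "Im (t * V (x0 + 0)) = 0") (auto simp: w add_nonneg_pos)
qed

theorem rolling_area:
  fixes V :: "real \<Rightarrow> complex" and C :: "real \<Rightarrow> real"
  assumes cont: "continuous_on UNIV V" "continuous_on UNIV C"
    and per: "\<And>x. V (x + L) = V x" "\<And>x. C (x + L) = C x"
    and der: "\<And>x. x \<notin> bad \<Longrightarrow> (V has_vector_derivative of_real (C x) * cis (\<phi> x)) (at x)"
      "\<And>x. x \<notin> bad \<Longrightarrow> (C has_vector_derivative Re (cnj (V x) * cis (\<phi> x))) (at x)"
    and C: "\<And>x. 0 < C x" "\<And>x. (C x)\<^sup>2 = \<epsilon> + (norm (V x))\<^sup>2" and \<epsilon>: "0 \<le> \<epsilon>"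
    and I: "((\<lambda>x. wedge (g x) (cis (\<phi> x))) has_integral I) {0..L}"
  shows "I \<le> 2 * pi"
proof -
  note pos = rolling_positive[OF assms(1-9)]
  \<comment> \<open>For \<epsilon> = 0 this is \<open>norm (V x) = C x > 0\<close>; for \<epsilon> >
    0 it is the strict position of the origin.\<close>
  have Vnz: "V x \<noteq> 0" for x
  proof
    assume V0: "V x = 0"
    then have "0 < \<epsilon>" using C[of x] by auto
    then show False using pos(2)[of x] V0 by (simp add: wedge_def)
  qed
  \<comment> \<open>\<open>g x\<close> lies strictly and \<open>V x\<close> weakly on the same side
    of the line spanned by \<open>\<tau> x\<close>, so they are never opposite.\<close>
  have nR: "V x / g x \<notin> \<real>\<^sub>\<le>\<^sub>0" for x
  proof
    assume "V x / g x \<in> \<real>\<^sub>\<le>\<^sub>0"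
    then obtain s where s: "s \<le> 0" "V x / g x = of_real s" by (auto simp: nonpos_Reals_def)
    then have V: "V x = of_real s * g x" using g_nz[of x] by (simp add: field_simps)
    then have "s < 0" using s Vnz[of x] by (cases "s = 0") auto
    then have "wedge (V x) (cis (\<phi> x)) < 0"
      unfolding V wedge_simps cis_\<phi> using \<rho>(1) \<rho>(2)[of x] by (intro mult_neg_pos) auto
    then show False using pos(1)[of x] by simp
  qed
  \<comment> \<open>The principal angle from \<open>g\<close> to \<open>V\<close> is continuous and
    periodic, so \<open>\<alpha>\<close> inherits the single turn of
    \<open>\<theta>\<close>.\<close>
  define \<alpha> where "\<alpha> x = \<theta> x + Im (Ln (V x / g x))" for x
  have c\<alpha>: "continuous_on UNIV \<alpha>"
    unfolding \<alpha>_def by (intro continuous_intros \<theta>(1) cont g(1)) (use nR g_nz in auto)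
  have V\<alpha>: "V x = of_real (norm (V x)) * cis (\<alpha> x)" for x
  proof -
    have "cis (\<alpha> x) = cis (\<theta> x) * cis (Arg (V x / g x))"
      using Vnz[of x] g_nz[of x] by (simp add: \<alpha>_def Arg_def cis_mult)
    also have "cis (Arg (V x / g x)) = sgn (V x / g x)" by (rule cis_Arg) (use Vnz g_nz in auto)
    also have "\<dots> = V x / g x * of_real (norm (g x)) / of_real (norm (V x))" by (simp add: sgn_eq norm_divide)
    also have "cis (\<theta> x) * \<dots> = V x * (of_real (norm (g x)) * cis (\<theta> x)) / g x / of_real (norm (V x))" by simp
    also have "of_real (norm (g x)) * cis (\<theta> x) = g x" using \<theta>(4)[of x] by (rule sym)
    finally show ?thesis using Vnz[of x] g_nz[of x] by simp
  qed
  have nV: "sqrt ((Re (V x))\<^sup>2 + (Im (V x))\<^sup>2) = norm (V x)" for x by (simp add: cmod_def)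
  have int: "(\<lambda>x. cos (\<phi> x) * f x) integrable_on {0..L}" "(\<lambda>x. sin (\<phi> x) * f x) integrable_on {0..L}"
    if "continuous_on {0..L} f" for f
  proof -
    have "continuous_on {0..L} (\<lambda>x. - \<i> * of_real (f x))" "continuous_on {0..L} (\<lambda>x. complex_of_real (f x))"
      by (intro continuous_intros that)+
    from integrable_tangent[OF this(1)] integrable_tangent[OF this(2)]
    show "(\<lambda>x. cos (\<phi> x) * f x) integrable_on {0..L}" "(\<lambda>x. sin (\<phi> x) * f x) integrable_on {0..L}"
      by (simp_all add: wedge_def mult.commute)
  qed
  note Re_der = bounded_linear.has_vector_derivative[OF bounded_linear_Re]
  note Im_der = bounded_linear.has_vector_derivative[OF bounded_linear_Im]
  have sub: "continuous_on {0..L} f" if "continuous_on UNIV f" for f :: "real \<Rightarrow> 'b::topological_space"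
    using that by (rule continuous_on_subset) simp
  show ?thesis
  proof (rule rolling_area_bound[of L bad "\<lambda>x. Re (g x)" "\<lambda>x. Im (g x)" "\<lambda>x. Re (V x)" "\<lambda>x. Im (V x)" C \<alpha>
        "\<lambda>x. cos (\<phi> x)" "\<lambda>x. sin (\<phi> x)" I, unfolded nV])
    show "continuous_on {0..L} (\<lambda>x. Re (g x))" "continuous_on {0..L} (\<lambda>x. Im (g x))"
      "continuous_on {0..L} (\<lambda>x. Re (V x))" "continuous_on {0..L} (\<lambda>x. Im (V x))"
      by (intro continuous_intros sub g cont)+
    show "continuous_on {0..L} C" "continuous_on {0..L} \<alpha>" by (intro sub cont c\<alpha>)+
    show "Re (g L) = Re (g 0)" "Im (g L) = Im (g 0)" "Re (V L) = Re (V 0)" "Im (V L) = Im (V 0)" "C L = C 0"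
      using g(2)[of 0] per[of 0] by simp_all
    show "\<alpha> L = \<alpha> 0 + 2 * pi" using g(2)[of 0] per[of 0] \<theta>(3)[of 0] by (simp add: \<alpha>_def)
    fix x assume "x \<in> {0<..<L} - bad"
    then have x: "x \<notin> bad" by simp
    show "((\<lambda>x. Re (g x)) has_real_derivative cos (\<phi> x)) (at x)" "((\<lambda>x. Im (g x)) has_real_derivative sin (\<phi> x)) (at x)"
      using Re_der[OF has_vector_derivative_g[OF x]] Im_der[OF has_vector_derivative_g[OF x]]
      by (simp_all add: has_real_derivative_iff_has_vector_derivative)
    show "((\<lambda>x. Re (V x)) has_real_derivative C x * cos (\<phi> x)) (at x)" "((\<lambda>x. Im (V x)) has_real_derivative C x * sin (\<phi> x)) (at x)"
      using Re_der[OF der(1)[OF x]] Im_der[OF der(1)[OF x]]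
      by (simp_all add: has_real_derivative_iff_has_vector_derivative)
    show "(C has_real_derivative Re (V x) * cos (\<phi> x) + Im (V x) * sin (\<phi> x)) (at x)"
      using der(2)[OF x] by (simp add: has_real_derivative_iff_has_vector_derivative)
    show "(\<alpha> has_real_derivative C x * (Re (V x) * sin (\<phi> x) - Im (V x) * cos (\<phi> x)) / (norm (V x))\<^sup>2) (at x)"
    proof -
      have "isCont \<alpha> x" using c\<alpha> by (simp add: continuous_on_eq_continuous_at)
      from DERIV_angle_lift[OF der(1)[OF x] Vnz this V\<alpha>]
      show ?thesis by (simp add: wedge_def algebra_simps)
    qed
    show "0 \<le> Re (V x) * sin (\<phi> x) - Im (V x) * cos (\<phi> x)"
      using pos(1)[of x] by (simp add: wedge_def)
  next
    fix x
    show "0 < cmod (V x)" using Vnz by simp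
    show "cmod (V x) \<le> C x"
      by (rule power2_le_imp_le) (use C[of x] \<epsilon> in auto)
  next
    show "((\<lambda>x. Re (g x) * sin (\<phi> x) - Im (g x) * cos (\<phi> x)) has_integral I) {0..L}"
      using I by (simp add: wedge_def)
  qed (use L countable_bad int in auto)
qed

text \<open>The isometry with matrix entries \<open>a, b\<close> fixes the vector \<open>(Im a, \<i> b)\<close>, of norm \<open>1 - (Re a)\<^sup>2\<close>.\<close>

theorem trace_gt_2:
  fixes A B :: "real \<Rightarrow> complex"
  assumes cont: "continuous_on {0..L} A" "continuous_on {0..L} B" and init: "A 0 = 1" "B 0 = 0"
    and der: "\<And>x. x \<in> {0<..<L} \<Longrightarrow> x \<notin> bad \<Longrightarrow> (A has_vector_derivative cis (\<phi> x) * cnj (B x) / 2) (at x)"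
      "\<And>x. x \<in> {0<..<L} \<Longrightarrow> x \<notin> bad \<Longrightarrow> (B has_vector_derivative cis (\<phi> x) * cnj (A x) / 2) (at x)"
    and det: "\<And>x. x \<in> {0..L} \<Longrightarrow> (norm (A x))\<^sup>2 - (norm (B x))\<^sup>2 = 1"
    and I: "((\<lambda>x. wedge (g x) (cis (\<phi> x))) has_integral I) {0..L}" "2 * pi < I"
  shows "1 < \<bar>Re (A L)\<bar>"
proof (rule ccontr)
  assume "\<not> 1 < \<bar>Re (A L)\<bar>"
  then have tr: "(Re (A L))\<^sup>2 \<le> 1" by (simp add: abs_square_le_1)
  define a where "a = A L"
  define b where "b = B L"
  have ab: "(norm a)\<^sup>2 - (norm b)\<^sup>2 = 1" using det[of L] L by (simp add: a_def b_def)
  then have ab': "a * cnj a - b * cnj b = 1"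
    by (simp only: complex_norm_square[symmetric] of_real_diff[symmetric] of_real_1)
  have le: "(norm b)\<^sup>2 \<le> (Im a)\<^sup>2" using ab tr cmod_power2[of a] unfolding a_def by linarith
  obtain C0 :: real and V0 where CV: "0 < C0" "norm V0 \<le> C0"
    "a\<^sup>2 * V0 + b\<^sup>2 * cnj V0 + 2 * a * b * of_real C0 = V0"
    "((norm a)\<^sup>2 + (norm b)\<^sup>2) * C0 + 2 * Re (a * cnj b * V0) = C0"
  \<comment> \<open>Here the general formula gives the zero vector; but then \<open>b = 0\<close>
    and \<open>a\<close> is 1 or -1, so the isometry is the identity and fixes the timelike vector
    \<open>(1, 0)\<close>.\<close>
  proof (cases "Im a = 0")
    case True
    then have "b = 0" using le by simp
    then have "norm a = 1" using ab by (simp add: power2_eq_1_iff) (smt (verit) norm_ge_zero)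
    then show ?thesis using that[of 1 0] \<open>b = 0\<close> by simp
  next
    case False
    \<comment> \<open>The sign makes the time component positive.\<close>
    define s where "s = sgn (Im a)"
    have s: "s * s = 1" "s * Im a = \<bar>Im a\<bar>" "\<bar>s\<bar> = 1" using False by (auto simp: s_def sgn_if)
    show ?thesis
    proof (rule that[of "s * Im a" "of_real s * (\<i> * b)"])
      show "0 < s * Im a" using False s by simp
      show "norm (of_real s * (\<i> * b)) \<le> s * Im a"
        unfolding s(2) using le s(3) by (simp add: norm_mult power2_le_iff_abs_le abs_le_square_iff)
          (metis abs_norm_cancel abs_le_square_iff)
      have i: "2 * \<i> * of_real (Im a) = a - cnj a" by (simp add: complex_eq_iff)
      have "a\<^sup>2 * (\<i> * b) + b\<^sup>2 * cnj (\<i> * b) + 2 * a * b * of_real (Im a)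
          = \<i> * b * (a\<^sup>2 - b * cnj b - a * (2 * \<i> * of_real (Im a)))"
        by (simp add: algebra_simps power2_eq_square)
      also have "\<dots> = \<i> * b * (a * cnj a - b * cnj b)" unfolding i by (simp add: algebra_simps power2_eq_square)
      also have "\<dots> = \<i> * b" unfolding ab' by simp
      finally have 1: "a\<^sup>2 * (\<i> * b) + b\<^sup>2 * cnj (\<i> * b) + 2 * a * b * of_real (Im a) = \<i> * b" .
      have "a\<^sup>2 * (of_real s * (\<i> * b)) + b\<^sup>2 * cnj (of_real s * (\<i> * b)) + 2 * a * b * of_real (s * Im a)
        = of_real s * (a\<^sup>2 * (\<i> * b) + b\<^sup>2 * cnj (\<i> * b) + 2 * a * b * of_real (Im a))"
        by (simp add: algebra_simps)
      then show "a\<^sup>2 * (of_real s * (\<i> * b)) + b\<^sup>2 * cnj (of_real s * (\<i> * b)) + 2 * a * b * of_real (s * Im a) = of_real s * (\<i> * b)"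
        unfolding 1 .
      have "Re (a * cnj b * (\<i> * b)) = - Im a * (norm b)\<^sup>2"
        unfolding cmod_power2 by (simp add: power2_eq_square algebra_simps)
      then have "Re (a * cnj b * (of_real s * (\<i> * b))) = s * (- Im a * (norm b)\<^sup>2)"
        by (simp add: algebra_simps)
      moreover have "(norm a)\<^sup>2 = 1 + (norm b)\<^sup>2" using ab by simp
      ultimately show "((norm a)\<^sup>2 + (norm b)\<^sup>2) * (s * Im a) + 2 * Re (a * cnj b * (of_real s * (\<i> * b))) = s * Im a"
        by (simp add: algebra_simps)
    qed
  qed
  \<comment> \<open>\<open>C\<close> and \<open>V\<close> are the diagonal and the upper right entry
    of the Hermitian matrix with diagonal \<open>C0\<close> and upper right entry \<open>V0\<close>,
    conjugated by the fundamental matrix \<open>M\<close> as \<open>M H M\<^sup>*\<close>. The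
    determinant \<open>C\<^sup>2 - |V|\<^sup>2\<close> is preserved.\<close>
  define V where "V x = (A x)\<^sup>2 * V0 + (B x)\<^sup>2 * cnj V0 + 2 * A x * B x * of_real C0" for x
  define C where "C x = ((norm (A x))\<^sup>2 + (norm (B x))\<^sup>2) * C0 + 2 * Re (A x * cnj (B x) * V0)" for x
  define \<epsilon> where "\<epsilon> = C0\<^sup>2 - (norm V0)\<^sup>2"
  have \<epsilon>: "0 \<le> \<epsilon>" using CV(2) by (simp add: \<epsilon>_def power_mono)
  have VL: "V L = V 0" "C L = C 0" using CV(3,4) init by (simp_all add: V_def C_def a_def b_def)
  have cV: "continuous_on {0..L} V" and cC: "continuous_on {0..L} C"
    unfolding V_def C_def by (intro continuous_intros cont)+
  \<comment> \<open>The worst phase of the mixed term leaves \<open>C0 (|A| - |B|)\<^sup>2\<close>,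
    which is positive because \<open>|A|\<^sup>2 - |B|\<^sup>2 = 1\<close>.\<close>
  have Cpos: "0 < C x" if x: "x \<in> {0..L}" for x
  proof -
    have "norm (B x) < norm (A x)"
      by (rule power2_less_imp_less) (use det[OF x] in auto)
    then have "0 < (norm (A x) - norm (B x))\<^sup>2" by simp
    then have "0 < C0 * (norm (A x) - norm (B x))\<^sup>2" using CV by simp
    also have "\<dots> = ((norm (A x))\<^sup>2 + (norm (B x))\<^sup>2) * C0 - 2 * (norm (A x) * norm (B x) * C0)"
      by (simp add: power2_eq_square algebra_simps)
    also have "\<dots> \<le> ((norm (A x))\<^sup>2 + (norm (B x))\<^sup>2) * C0 - 2 * (norm (A x) * norm (B x) * norm V0)"
      using mult_left_mono[OF CV(2), of "norm (A x) * norm (B x)"] by simp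
    also have "\<dots> \<le> C x"
      using abs_Re_le_cmod[of "A x * cnj (B x) * V0"] by (simp add: C_def norm_mult)
    finally show ?thesis .
  qed
  have C2: "(C x)\<^sup>2 = \<epsilon> + (norm (V x))\<^sup>2" if x: "x \<in> {0..L}" for x
  proof -
    have e1: "complex_of_real (C x) = (A x * cnj (A x) + B x * cnj (B x)) * of_real C0
        + (A x * cnj (B x) * V0 + cnj (A x) * B x * cnj V0)"
      unfolding C_def by (simp add: complex_norm_square[symmetric] complex_eq_iff) (simp add: algebra_simps)
    have d: "A x * cnj (A x) - B x * cnj (B x) = 1"
      using det[OF x] by (simp only: complex_norm_square[symmetric] of_real_diff[symmetric] of_real_1)
    have "complex_of_real ((C x)\<^sup>2 - (norm (V x))\<^sup>2) = (of_real (C x))\<^sup>2 - V x * cnj (V x)"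
      by (simp add: complex_norm_square[symmetric])
    also have "\<dots> = (A x * cnj (A x) - B x * cnj (B x))\<^sup>2 * ((of_real C0)\<^sup>2 - V0 * cnj V0)"
      unfolding e1 V_def by (simp add: power2_eq_square algebra_simps)
    also have "\<dots> = of_real \<epsilon>"
      unfolding d \<epsilon>_def by (simp add: complex_norm_square[symmetric])
    finally have "(C x)\<^sup>2 - (norm (V x))\<^sup>2 = \<epsilon>" by (simp only: of_real_eq_iff)
    then show ?thesis by simp
  qed
  have dV: "(V has_vector_derivative of_real (C x) * cis (\<phi> x)) (at x)" if x: "x \<in> {0<..<L}" "x \<notin> bad" for x
  proof -
    note dA = der(1)[OF x] and dB = der(2)[OF x]
    have "((\<lambda>x. A x * A x * V0 + B x * B x * cnj V0 + A x * B x * (2 * of_real C0)) has_vector_derivative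
       (A x * (cis (\<phi> x) * cnj (B x) / 2) + cis (\<phi> x) * cnj (B x) / 2 * A x) * V0
       + (B x * (cis (\<phi> x) * cnj (A x) / 2) + cis (\<phi> x) * cnj (A x) / 2 * B x) * cnj V0
       + (A x * (cis (\<phi> x) * cnj (A x) / 2) + cis (\<phi> x) * cnj (B x) / 2 * B x) * (2 * of_real C0)) (at x)"
      by (intro has_vector_derivative_add has_vector_derivative_mult_left has_vector_derivative_mult dA dB)
    moreover have "complex_of_real (C x) = (A x * cnj (A x) + B x * cnj (B x)) * of_real C0
        + (A x * cnj (B x) * V0 + cnj (A x) * B x * cnj V0)"
      unfolding C_def by (simp add: complex_norm_square[symmetric] complex_eq_iff) (simp add: algebra_simps)
    ultimately show ?thesis
      by (simp add: V_def[abs_def] power2_eq_square algebra_simps)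
  qed
  have dC: "(C has_vector_derivative Re (cnj (V x) * cis (\<phi> x))) (at x)" if x: "x \<in> {0<..<L}" "x \<notin> bad" for x
  proof -
    note dA = der(1)[OF x] and dB = der(2)[OF x]
    have "((\<lambda>x. Re (A x * cnj (A x) * of_real C0 + B x * cnj (B x) * of_real C0 + 2 * (A x * cnj (B x) * V0))) has_vector_derivative
       Re ((A x * cnj (cis (\<phi> x) * cnj (B x) / 2) + cis (\<phi> x) * cnj (B x) / 2 * cnj (A x)) * of_real C0
       + (B x * cnj (cis (\<phi> x) * cnj (A x) / 2) + cis (\<phi> x) * cnj (A x) / 2 * cnj (B x)) * of_real C0
       + 2 * ((A x * cnj (cis (\<phi> x) * cnj (A x) / 2) + cis (\<phi> x) * cnj (B x) / 2 * cnj (B x)) * V0))) (at x)"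
      by (intro bounded_linear.has_vector_derivative[OF bounded_linear_Re] has_vector_derivative_add
          has_vector_derivative_mult_left has_vector_derivative_mult_right has_vector_derivative_mult
          bounded_linear.has_vector_derivative[OF bounded_linear_cnj] dA dB)
    moreover have "(\<lambda>x. Re (A x * cnj (A x) * of_real C0 + B x * cnj (B x) * of_real C0 + 2 * (A x * cnj (B x) * V0))) = C"
      by (auto simp: C_def complex_norm_square[symmetric] algebra_simps)
    moreover have "Re ((A x * cnj (cis (\<phi> x) * cnj (B x) / 2) + cis (\<phi> x) * cnj (B x) / 2 * cnj (A x)) * of_real C0
       + (B x * cnj (cis (\<phi> x) * cnj (A x) / 2) + cis (\<phi> x) * cnj (A x) / 2 * cnj (B x)) * of_real C0
       + 2 * ((A x * cnj (cis (\<phi> x) * cnj (A x) / 2) + cis (\<phi> x) * cnj (B x) / 2 * cnj (B x)) * V0))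
       = Re (cnj (V x) * cis (\<phi> x))"
      by (simp add: V_def power2_eq_square algebra_simps)
    ultimately show ?thesis by simp
  qed
  let ?V = "periodic_ext L V" and ?C = "periodic_ext L C"
  have "I \<le> 2 * pi"
  proof (rule rolling_area[of ?V ?C \<epsilon>])
    show "continuous_on UNIV ?V" "continuous_on UNIV ?C"
      by (intro continuous_periodic_ext L cV cC VL)+
    show "?V (x + L) = ?V x" "?C (x + L) = ?C x" for x by (rule periodic_ext_periodic[OF L])+
    have pe: "periodic_ext L (\<lambda>x. cis (\<phi> x)) x = cis (\<phi> x)" for x
      using shift_int_multiple[of "\<lambda>x. cis (\<phi> x)" L 0 x "- \<lfloor>x / L\<rfloor>"] \<tau> by (simp add: cis_\<phi> periodic_ext_def)
    show "(?V has_vector_derivative of_real (?C x) * cis (\<phi> x)) (at x)" if "x \<notin> bad" for x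
      using has_vector_derivative_periodic_ext[OF VL(1) dV that] pe[of x] by (simp add: periodic_ext_def)
    show "(?C has_vector_derivative Re (cnj (?V x) * cis (\<phi> x))) (at x)" if "x \<notin> bad" for x
    proof -
      have "(?C has_vector_derivative periodic_ext L (\<lambda>x. Re (cnj (V x) * cis (\<phi> x))) x) (at x)"
        by (rule has_vector_derivative_periodic_ext[OF VL(2) dC that])
      moreover have "periodic_ext L (\<lambda>x. Re (cnj (V x) * cis (\<phi> x))) x = Re (cnj (?V x) * cis (\<phi> x))"
        using pe[of x] unfolding periodic_ext_def by (simp only:)
      ultimately show ?thesis by (simp only:)
    qed
    show "0 < ?C x" "(?C x)\<^sup>2 = \<epsilon> + (norm (?V x))\<^sup>2" for x
      unfolding periodic_ext_def using frac_interval[OF L, of x] by (intro Cpos C2; simp)+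
  qed (use \<epsilon> I in auto)
  then show False using I(2) by simp
qed

end

section \<open>Motions of the bicycle\<close>

lemma fundamental_solution_det:
  fixes q A B :: "real \<Rightarrow> complex"
  assumes N: "countable N" and cont: "continuous_on {0..L} A" "continuous_on {0..L} B" and init: "A 0 = 1" "B 0 = 0"
    and der: "\<And>x. x \<in> {0<..<L} - N \<Longrightarrow> (A has_vector_derivative q x * cnj (B x) / 2) (at x)"
      "\<And>x. x \<in> {0<..<L} - N \<Longrightarrow> (B has_vector_derivative q x * cnj (A x) / 2) (at x)"
    and x: "x \<in> {0..L}"
  shows "(norm (A x))\<^sup>2 - (norm (B x))\<^sup>2 = 1"
proof -
  have "A x * cnj (A x) - B x * cnj (B x) = A 0 * cnj (A 0) - B 0 * cnj (B 0)"
  proof (rule constant_off_countable[OF _ N, where f = "\<lambda>x. A x * cnj (A x) - B x * cnj (B x)"])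
    show "0 \<le> x" using x by simp
    show "continuous_on {0..x} (\<lambda>x. A x * cnj (A x) - B x * cnj (B x))"
      by (intro continuous_intros continuous_on_subset[OF cont(1)] continuous_on_subset[OF cont(2)]) (use x in auto)
    fix y assume "y \<in> {0<..<x} - N"
    then have y: "y \<in> {0<..<L} - N" using x by auto
    have "((\<lambda>x. A x * cnj (A x) - B x * cnj (B x)) has_vector_derivative
        (A y * cnj (q y * cnj (B y) / 2) + q y * cnj (B y) / 2 * cnj (A y)) -
        (B y * cnj (q y * cnj (A y) / 2) + q y * cnj (A y) / 2 * cnj (B y))) (at y)"
      by (intro has_vector_derivative_diff has_vector_derivative_mult
          bounded_linear.has_vector_derivative[OF bounded_linear_cnj] der y)
    then show "((\<lambda>x. A x * cnj (A x) - B x * cnj (B x)) has_vector_derivative 0) (at y)"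
      by (simp add: algebra_simps)
  qed
  then have "complex_of_real ((norm (A x))\<^sup>2 - (norm (B x))\<^sup>2) = of_real 1"
    unfolding of_real_diff complex_norm_square init by simp
  then show ?thesis by (simp only: of_real_eq_iff)
qed

lemma abs_continuous_on_lipschitz:
  assumes "\<And>x y. a \<le> x \<Longrightarrow> x \<le> y \<Longrightarrow> y \<le> b \<Longrightarrow> norm (u y - u x) \<le> B * (y - x)" "0 < B"
  shows "abs_continuous_on a b u"
  unfolding abs_continuous_on_def
proof (intro allI impI)
  fix e :: real assume e: "0 < e"
  show "\<exists>\<delta>>0. \<forall>d T. d division_of T \<and> T \<subseteq> {a..b} \<and> (\<Sum>k\<in>d. Sup k - Inf k) < \<delta> \<longrightarrow>
        (\<Sum>k\<in>d. norm (u (Sup k) - u (Inf k))) < e"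
  proof (intro exI[of _ "e / B"] conjI allI impI)
    show "0 < e / B" using e assms(2) by simp
    fix d T assume d: "d division_of T \<and> T \<subseteq> {a..b} \<and> (\<Sum>k\<in>d. Sup k - Inf k) < e / B"
    have "(\<Sum>k\<in>d. norm (u (Sup k) - u (Inf k))) \<le> (\<Sum>k\<in>d. B * (Sup k - Inf k))"
    proof (rule sum_mono)
      fix k assume k: "k \<in> d"
      obtain s t where st: "k = {s..t}" using division_ofD(4)[of d T k] d k by auto
      have "k \<noteq> {}" "k \<subseteq> {a..b}" using division_ofD(2,3)[of d T k] d k by auto
      then show "norm (u (Sup k) - u (Inf k)) \<le> B * (Sup k - Inf k)" using st assms(1)[of s t] by auto
    qed
    also have "\<dots> = B * (\<Sum>k\<in>d. Sup k - Inf k)" by (rule sum_distrib_left[symmetric])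
    also have "\<dots> < e" using d assms(2) by (simp add: field_simps)
    finally show "(\<Sum>k\<in>d. norm (u (Sup k) - u (Inf k))) < e" .
  qed
qed

text \<open>Numerator and denominator of the fractional linear action satisfy
  \<open>n' = q d / 2\<close> and \<open>d' = cnj q n / 2\<close>, so the quotient solves the
  Riccati equation \<open>u' = (q - cnj q u\<^sup>2) / 2\<close>. On the unit circle, where
  \<open>n = v cnj d\<close> keeps it, this is the bicycle equation.\<close>

lemma bicycle_motion_of_fundamental_solution:
  fixes \<gamma> q A B :: "real \<Rightarrow> complex"
  assumes L: "0 < L" and N: "countable N"
    and q: "\<And>x. x \<in> {0<..<L} - N \<Longrightarrow> (\<gamma> has_vector_derivative q x) (at x)" "\<And>x. norm (q x) \<le> 1"
    and cont: "continuous_on {0..L} A" "continuous_on {0..L} B"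
    and der: "\<And>x. x \<in> {0<..<L} - N \<Longrightarrow> (A has_vector_derivative q x * cnj (B x) / 2) (at x)"
      "\<And>x. x \<in> {0<..<L} - N \<Longrightarrow> (B has_vector_derivative q x * cnj (A x) / 2) (at x)"
    and det: "\<And>x. x \<in> {0..L} \<Longrightarrow> (norm (A x))\<^sup>2 - (norm (B x))\<^sup>2 = 1"
    and v: "norm v = 1"
  shows "bicycle_motion \<gamma> L (\<lambda>x. (A x * v + B x) / (cnj (B x) * v + cnj (A x)))"
proof -
  define n where "n x = A x * v + B x" for x
  define d where "d x = cnj (B x) * v + cnj (A x)" for x
  define u where "u x = n x / d x" for x
  have vv: "v * cnj v = 1" using v by (simp add: complex_norm_square[symmetric])
  have nd: "n x = v * cnj (d x)" for x
    using vv by (simp add: n_def d_def algebra_simps)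
  have d0: "d x \<noteq> 0" if x: "x \<in> {0..L}" for x
  proof
    assume "d x = 0"
    then have "norm (cnj (B x) * v) = norm (cnj (A x))"
      unfolding d_def by (metis add_eq_0_iff norm_minus_cancel)
    then show False using det[OF x] v by (simp add: norm_mult)
  qed
  have nu: "norm (u x) = 1" if x: "x \<in> {0..L}" for x
    using d0[OF x] v by (simp add: u_def nd norm_divide norm_mult)
  have cu: "continuous_on {0..L} u"
    unfolding u_def n_def d_def by (intro continuous_intros cont) (use d0 d_def in auto)
  have du: "(u has_vector_derivative q x - (q x \<bullet> u x) *\<^sub>R u x) (at x)" if x: "x \<in> {0<..<L} - N" for x
  proof -
    have x': "x \<in> {0..L}" using x by auto
    have dn: "(n has_vector_derivative q x * d x / 2) (at x)"
    proof -
      have "(n has_vector_derivative q x * cnj (B x) / 2 * v + q x * cnj (A x) / 2) (at x)"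
        unfolding n_def by (intro has_vector_derivative_add has_vector_derivative_mult_left der x)
      then show ?thesis by (simp add: d_def algebra_simps add_divide_distrib)
    qed
    have dd: "(d has_vector_derivative cnj (q x) * n x / 2) (at x)"
    proof -
      have "(d has_vector_derivative cnj (q x * cnj (A x) / 2) * v + cnj (q x * cnj (B x) / 2)) (at x)"
        unfolding d_def by (intro has_vector_derivative_add has_vector_derivative_mult_left
          bounded_linear.has_vector_derivative[OF bounded_linear_cnj] der x)
      then show ?thesis by (simp add: n_def algebra_simps add_divide_distrib)
    qed
    have "((\<lambda>x. inverse (d x)) has_vector_derivative (cnj (q x) * n x / 2) * - (inverse (d x * d x))) (at x)"
      using field_vector_diff_chain_at[OF dd DERIV_inverse[OF d0[OF x']]]
      by (simp add: o_def power2_eq_square)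
    note dprod = has_vector_derivative_mult[OF dn this]
    have "(\<lambda>x. n x * inverse (d x)) = u" by (simp add: fun_eq_iff u_def divide_inverse)
    with dprod have "(u has_vector_derivative n x * ((cnj (q x) * n x / 2) * - (inverse (d x * d x))) + q x * d x / 2 * inverse (d x)) (at x)"
      by (simp only:)
    moreover have "n x * ((cnj (q x) * n x / 2) * - (inverse (d x * d x))) + q x * d x / 2 * inverse (d x)
        = (q x - cnj (q x) * u x * u x) / 2"
    proof -
      have "q x * d x / 2 * inverse (d x) = q x / 2" using d0[OF x'] by simp
      moreover have "u x = n x * inverse (d x)" by (simp add: u_def divide_inverse)
      moreover have "m * (c * m / 2 * - (i * i)) + p / 2 = (p - c * (m * i) * (m * i)) / 2" for m c i p :: complex
        by (simp add: diff_divide_distrib mult_ac)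
      ultimately show ?thesis by (simp only: inverse_mult_distrib)
    qed
    moreover have "(q x - cnj (q x) * u x * u x) / 2 = q x - (q x \<bullet> u x) *\<^sub>R u x"
    proof -
      have uu: "u x * cnj (u x) = 1" using nu[OF x'] by (simp add: complex_norm_square[symmetric])
      have "2 * complex_of_real (q x \<bullet> u x) = cnj (q x) * u x + q x * cnj (u x)"
        by (simp add: inner_complex_def complex_eq_iff)
      then have "2 * ((q x \<bullet> u x) *\<^sub>R u x) = (cnj (q x) * u x + q x * cnj (u x)) * u x"
        by (simp add: scaleR_conv_of_real mult.assoc[symmetric])
      also have "\<dots> = cnj (q x) * u x * u x + q x * (u x * cnj (u x))" by (simp add: algebra_simps)
      finally have "2 * ((q x \<bullet> u x) *\<^sub>R u x) = cnj (q x) * u x * u x + q x" unfolding uu by simp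
      then show ?thesis by (simp add: field_simps)
    qed
    ultimately show ?thesis by simp
  qed
  have "norm (u y - u x) \<le> 2 * (y - x)" if xy: "0 \<le> x" "x \<le> y" "y \<le> L" for x y
  proof (rule lipschitz_off_countable[OF xy(2) N])
    show "continuous_on {x..y} u" using xy by (auto intro: continuous_on_subset[OF cu])
    fix z assume z: "z \<in> {x<..<y} - N"
    then have z': "z \<in> {0<..<L} - N" "z \<in> {0..L}" using xy by auto
    show "(u has_vector_derivative q z - (q z \<bullet> u z) *\<^sub>R u z) (at z)" by (rule du[OF z'(1)])
    have "\<bar>q z \<bullet> u z\<bar> \<le> norm (q z) * norm (u z)" by (rule Cauchy_Schwarz_ineq2)
    then have "\<bar>q z \<bullet> u z\<bar> \<le> 1" using nu[OF z'(2)] q(2)[of z] by simp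
    then show "norm (q z - (q z \<bullet> u z) *\<^sub>R u z) \<le> 2"
      using norm_triangle_ineq4[of "q z" "(q z \<bullet> u z) *\<^sub>R u z"] nu[OF z'(2)] q(2)[of z] by simp
  qed simp
  then have ac: "abs_continuous_on 0 L u" by (rule abs_continuous_on_lipschitz) auto
  have "AE x in lebesgue. x \<notin> N"
    using countable_imp_negligible[OF N] by (simp add: negligible_iff_null_sets AE_not_in)
  then have "AE x in lebesgue. x \<in> {0<..<L} \<longrightarrow> \<gamma> differentiable (at x) \<and>
     (u has_vector_derivative vector_derivative \<gamma> (at x) - (vector_derivative \<gamma> (at x) \<bullet> u x) *\<^sub>R u x) (at x)"
  proof eventually_elim
    case (elim x)
    show ?case
    proof
      assume "x \<in> {0<..<L}"
      then have x: "x \<in> {0<..<L} - N" using elim by simp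
      then show "\<gamma> differentiable (at x) \<and>
         (u has_vector_derivative vector_derivative \<gamma> (at x) - (vector_derivative \<gamma> (at x) \<bullet> u x) *\<^sub>R u x) (at x)"
        using du[OF x] q(1)[OF x] vector_derivative_at[OF q(1)[OF x]] differentiableI_vector by auto
    qed
  qed
  then have "bicycle_motion \<gamma> L u"
    unfolding bicycle_motion_def using ac nu by auto
  then show ?thesis by (simp add: u_def[abs_def] n_def d_def)
qed

text \<open>For two motions, \<open>1 - u \<bullet> v\<close> satisfies a linear differential equation.\<close>

lemma bicycle_motion_unique:
  assumes L: "0 < L" and N: "countable N"
    and q: "\<And>x. x \<in> {0<..<L} - N \<Longrightarrow> (\<gamma> has_vector_derivative q x) (at x)" "\<And>x. norm (q x) \<le> 1"
    and u: "bicycle_motion \<gamma> L u" and v: "bicycle_motion \<gamma> L v" and init: "u 0 = v 0"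
  shows "u L = v L"
proof -
  define w where "w x = 1 - u x \<bullet> v x" for x
  \<comment> \<open>\<open>w\<close> satisfies \<open>w' = - (q \<bullet> (u + v)) w\<close>, with a
    coefficient of absolute value at most 2. The exponential factor therefore makes \<open>f\<close>
    nonincreasing, while \<open>f\<close> starts at 0 and cannot be negative.\<close>
  define f where "f x = w x * exp (- 2 * x)" for x
  have n1: "norm (u x) = 1" "norm (v x) = 1" if "x \<in> {0..L}" for x
    using u v that by (auto simp: bicycle_motion_def)
  have cs: "\<bar>u x \<bullet> v y\<bar> \<le> 1" if "x \<in> {0..L}" "y \<in> {0..L}" for x y
    using Cauchy_Schwarz_ineq2[of "u x" "v y"] n1 that by simp
  have w0: "0 \<le> w x" "w x \<le> 2" if "x \<in> {0..L}" for x
    using cs[OF that that] by (auto simp: w_def)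
  have step: "\<bar>f y - f x\<bar> \<le> norm (u y - u x) + norm (v y - v x) + 4 * (y - x)"
    if xy: "0 \<le> x" "x \<le> y" "y \<le> L" for x y
  proof -
    have m: "x \<in> {0..L}" "y \<in> {0..L}" using xy by auto
    have "w x - w y = (u y - u x) \<bullet> v y + u x \<bullet> (v y - v x)"
      by (simp add: w_def inner_diff_left inner_diff_right)
    then have "\<bar>w y - w x\<bar> \<le> \<bar>(u y - u x) \<bullet> v y\<bar> + \<bar>u x \<bullet> (v y - v x)\<bar>" by linarith
    also have "\<dots> \<le> norm (u y - u x) + norm (v y - v x)"
      using Cauchy_Schwarz_ineq2[of "u y - u x" "v y"] Cauchy_Schwarz_ineq2[of "u x" "v y - v x"] n1 m by simp
    finally have 1: "\<bar>w y - w x\<bar> \<le> norm (u y - u x) + norm (v y - v x)" .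
    have ex: "1 - 2 * (y - x) \<le> exp (- 2 * (y - x))" using exp_ge_add_one_self[of "- 2 * (y - x)"] by linarith
    have e1: "exp (- 2 * y) \<le> exp (- 2 * x)" "exp (- 2 * x) \<le> 1" using xy by auto
    have "exp (- 2 * x) - exp (- 2 * y) = exp (- 2 * x) * (1 - exp (- 2 * (y - x)))"
      by (simp add: algebra_simps flip: exp_add)
    also have "\<dots> \<le> 1 * (2 * (y - x))" using ex e1 xy by (intro mult_mono) auto
    finally have 2: "\<bar>exp (- 2 * y) - exp (- 2 * x)\<bar> \<le> 2 * (y - x)" using e1 by simp
    have "f y - f x = (w y - w x) * exp (- 2 * y) + w x * (exp (- 2 * y) - exp (- 2 * x))"
      by (simp add: f_def algebra_simps)
    also have "\<bar>\<dots>\<bar> \<le> \<bar>w y - w x\<bar> * exp (- 2 * y) + w x * \<bar>exp (- 2 * y) - exp (- 2 * x)\<bar>"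
      using w0[OF m(1)] by (intro order_trans[OF abs_triangle_ineq]) (simp add: abs_mult)
    also have "\<dots> \<le> \<bar>w y - w x\<bar> * 1 + 2 * (2 * (y - x))"
      using w0[OF m(1)] e1 2 by (intro add_mono mult_mono) auto
    finally show ?thesis using 1 by simp
  qed
  have ac: "\<exists>\<delta>>0. \<forall>d T. d division_of T \<and> T \<subseteq> {0..L} \<and> (\<Sum>k\<in>d. Sup k - Inf k) < \<delta> \<longrightarrow>
        (\<Sum>k\<in>d. \<bar>f (Sup k) - f (Inf k)\<bar>) < e" if e: "0 < e" for e
  proof -
    have e3: "0 < e / 3" using e by simp
    obtain d1 where d1: "0 < d1" "\<And>d T. d division_of T \<Longrightarrow> T \<subseteq> {0..L} \<Longrightarrow> (\<Sum>k\<in>d. Sup k - Inf k) < d1 \<Longrightarrow>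
        (\<Sum>k\<in>d. norm (u (Sup k) - u (Inf k))) < e / 3"
      using u e3 unfolding bicycle_motion_def abs_continuous_on_def by meson
    obtain d2 where d2: "0 < d2" "\<And>d T. d division_of T \<Longrightarrow> T \<subseteq> {0..L} \<Longrightarrow> (\<Sum>k\<in>d. Sup k - Inf k) < d2 \<Longrightarrow>
        (\<Sum>k\<in>d. norm (v (Sup k) - v (Inf k))) < e / 3"
      using v e3 unfolding bicycle_motion_def abs_continuous_on_def by meson
    show ?thesis
    \<comment> \<open>The bound in \<open>step\<close> multiplies lengths by 4, and this part has to
      stay below a third of \<open>e\<close>.\<close>
    proof (intro exI[of _ "min (min d1 d2) (e / 12)"] conjI allI impI)
      show "0 < min (min d1 d2) (e / 12)" using d1 d2 e by simp
      fix d T assume "d division_of T \<and> T \<subseteq> {0..L} \<and> (\<Sum>k\<in>d. Sup k - Inf k) < min (min d1 d2) (e / 12)"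
      then have d: "d division_of T" "T \<subseteq> {0..L}" and s: "(\<Sum>k\<in>d. Sup k - Inf k) < d1"
        "(\<Sum>k\<in>d. Sup k - Inf k) < d2" "(\<Sum>k\<in>d. Sup k - Inf k) < e / 12" by auto
      have "(\<Sum>k\<in>d. \<bar>f (Sup k) - f (Inf k)\<bar>) \<le>
          (\<Sum>k\<in>d. norm (u (Sup k) - u (Inf k)) + norm (v (Sup k) - v (Inf k)) + 4 * (Sup k - Inf k))"
      proof (rule sum_mono)
        fix k assume k: "k \<in> d"
        obtain s t where st: "k = {s..t}" using division_ofD(4)[OF d(1) k] by auto
        have "k \<noteq> {}" "k \<subseteq> {0..L}" using division_ofD(2,3)[OF d(1) k] d(2) by auto
        then show "\<bar>f (Sup k) - f (Inf k)\<bar> \<le> norm (u (Sup k) - u (Inf k)) + norm (v (Sup k) - v (Inf k)) + 4 * (Sup k - Inf k)"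
          using st step[of s t] by auto
      qed
      also have "\<dots> = (\<Sum>k\<in>d. norm (u (Sup k) - u (Inf k))) + (\<Sum>k\<in>d. norm (v (Sup k) - v (Inf k)))
          + 4 * (\<Sum>k\<in>d. Sup k - Inf k)"
        by (simp add: sum.distrib sum_distrib_left)
      also have "\<dots> < e" using d1(2)[OF d s(1)] d2(2)[OF d s(2)] s(3) by linarith
      finally show "(\<Sum>k\<in>d. \<bar>f (Sup k) - f (Inf k)\<bar>) < e" .
    qed
  qed
  have ae: "AE x in lebesgue. x \<notin> N \<and> (x \<in> {0<..<L} \<longrightarrow>
      (u has_vector_derivative vector_derivative \<gamma> (at x) - (vector_derivative \<gamma> (at x) \<bullet> u x) *\<^sub>R u x) (at x) \<and>
      (v has_vector_derivative vector_derivative \<gamma> (at x) - (vector_derivative \<gamma> (at x) \<bullet> v x) *\<^sub>R v x) (at x))"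
  proof -
    have "AE x in lebesgue. x \<notin> N"
      using countable_imp_negligible[OF N] by (simp add: negligible_iff_null_sets AE_not_in)
    moreover have "AE x in lebesgue. x \<in> {0<..<L} \<longrightarrow> \<gamma> differentiable (at x) \<and>
      (w has_vector_derivative vector_derivative \<gamma> (at x) - (vector_derivative \<gamma> (at x) \<bullet> w x) *\<^sub>R w x) (at x)"
      if "bicycle_motion \<gamma> L w" for w
      using that by (simp only: bicycle_motion_def)
    from this[OF u] this[OF v] calculation show ?thesis by eventually_elim auto
  qed
  obtain Z where Z: "Z \<in> null_sets lebesgue" "\<And>x. x \<notin> Z \<Longrightarrow> x \<notin> N \<and> (x \<in> {0<..<L} \<longrightarrow>
      (u has_vector_derivative vector_derivative \<gamma> (at x) - (vector_derivative \<gamma> (at x) \<bullet> u x) *\<^sub>R u x) (at x) \<and>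
      (v has_vector_derivative vector_derivative \<gamma> (at x) - (vector_derivative \<gamma> (at x) \<bullet> v x) *\<^sub>R v x) (at x))"
    using ae unfolding completion.AE_iff_null_sets by auto
  have "f L \<le> f 0"
  proof (rule nonincreasing_of_absolutely_continuous[OF _ _ ac])
    show "0 \<le> L" using L by simp
    show "negligible Z" using Z(1) by (simp add: negligible_iff_null_sets)
    fix x assume x: "x \<in> {0<..<L} - Z"
    then have x': "x \<in> {0..L}" "x \<in> {0<..<L} - N" using Z(2)[of x] by auto
    have g: "vector_derivative \<gamma> (at x) = q x" by (rule vector_derivative_at[OF q(1)[OF x'(2)]])
    have du: "(u has_vector_derivative q x - (q x \<bullet> u x) *\<^sub>R u x) (at x)"
      and dv: "(v has_vector_derivative q x - (q x \<bullet> v x) *\<^sub>R v x) (at x)"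
      using Z(2)[of x] x g by auto
    have "((\<lambda>x. u x \<bullet> v x) has_vector_derivative (u x \<bullet> (q x - (q x \<bullet> v x) *\<^sub>R v x) + (q x - (q x \<bullet> u x) *\<^sub>R u x) \<bullet> v x)) (at x)"
      by (rule bounded_bilinear.has_vector_derivative[OF bounded_bilinear_inner du dv])
    then have "((\<lambda>x. u x \<bullet> v x) has_real_derivative (q x \<bullet> (u x + v x)) * w x) (at x)"
      by (simp add: has_real_derivative_iff_has_vector_derivative w_def inner_diff_left inner_diff_right
          inner_add_right inner_commute algebra_simps)
    then have dw: "(w has_real_derivative - ((q x \<bullet> (u x + v x)) * w x)) (at x)"
      unfolding w_def[abs_def] by (auto intro!: derivative_eq_intros simp: w_def)
    have "(f has_real_derivative (- ((q x \<bullet> (u x + v x)) * w x) * exp (- 2 * x) + (- 2 * exp (- 2 * x)) * w x)) (at x)"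
      unfolding f_def[abs_def] by (auto intro!: derivative_eq_intros dw)
    moreover have "- ((q x \<bullet> (u x + v x)) * w x) * exp (- 2 * x) + (- 2 * exp (- 2 * x)) * w x
        = - ((q x \<bullet> (u x + v x) + 2) * (w x * exp (- 2 * x)))"
      by (simp add: algebra_simps)
    moreover have "0 \<le> (q x \<bullet> (u x + v x) + 2) * (w x * exp (- 2 * x))"
    proof -
      have "\<bar>q x \<bullet> u x\<bar> \<le> 1" "\<bar>q x \<bullet> v x\<bar> \<le> 1"
        using Cauchy_Schwarz_ineq2[of "q x" "u x"] Cauchy_Schwarz_ineq2[of "q x" "v x"] n1[OF x'(1)] q(2)[of x] by auto
      then have "0 \<le> q x \<bullet> (u x + v x) + 2" by (simp add: inner_add_right)
      then show ?thesis using w0[OF x'(1)] by simp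
    qed
    ultimately show "\<exists>D\<le>0. (f has_vector_derivative D) (at x)"
      by (intro exI[of _ "- ((q x \<bullet> (u x + v x) + 2) * (w x * exp (- 2 * x)))"])
         (simp add: has_real_derivative_iff_has_vector_derivative)
  qed
  also have "f 0 = 0"
    using n1(2)[of 0] L by (simp add: f_def w_def init power2_norm_eq_inner[symmetric])
  finally have "w L \<le> 0" by (simp add: f_def mult_le_0_iff)
  then have "1 \<le> u L \<bullet> v L" by (simp add: w_def)
  moreover have "(norm (u L - v L))\<^sup>2 = (norm (u L))\<^sup>2 + (norm (v L))\<^sup>2 - 2 * (u L \<bullet> v L)"
    by (simp add: power2_norm_eq_inner inner_diff_left inner_diff_right inner_commute)
  ultimately have "(norm (u L - v L))\<^sup>2 \<le> 0" using n1[of L] L by simp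
  then show ?thesis by simp
qed

text \<open>The fixed points are the roots of a quadratic equation. Multiplied by
  \<open>cnj b\<close>, with the square completed, its discriminant is
  \<open>|b|\<^sup>2 - (Im a)\<^sup>2 = (Re a)\<^sup>2 - 1 > 0\<close>; both roots have modulus 1
  because \<open>(Im a)\<^sup>2 + D\<^sup>2 = |b|\<^sup>2\<close>.\<close>

theorem hyperbolic_monodromy:
  fixes \<gamma> q A B :: "real \<Rightarrow> complex"
  assumes L: "0 < L" and N: "countable N"
    and q: "\<And>x. x \<in> {0<..<L} - N \<Longrightarrow> (\<gamma> has_vector_derivative q x) (at x)" "\<And>x. norm (q x) \<le> 1"
    and cont: "continuous_on {0..L} A" "continuous_on {0..L} B" and init: "A 0 = 1" "B 0 = 0"
    and der: "\<And>x. x \<in> {0<..<L} - N \<Longrightarrow> (A has_vector_derivative q x * cnj (B x) / 2) (at x)"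
      "\<And>x. x \<in> {0<..<L} - N \<Longrightarrow> (B has_vector_derivative q x * cnj (A x) / 2) (at x)"
    and tr: "1 < \<bar>Re (A L)\<bar>"
  shows "hyperbolic_on_circle (bicycle_monodromy \<gamma> L)"
proof -
  note det = fundamental_solution_det[OF N cont init der]
  define a where "a = A L"
  define b where "b = B L"
  have ab: "(norm a)\<^sup>2 - (norm b)\<^sup>2 = 1" using det[of L] L by (simp add: a_def b_def)
  define M where "M v = (a * v + b) / (cnj b * v + cnj a)" for v
  have mono: "bicycle_monodromy \<gamma> L v = M v" if v: "v \<in> sphere 0 1" for v
  proof -
    define u where "u x = (A x * v + B x) / (cnj (B x) * v + cnj (A x))" for x
    have u: "bicycle_motion \<gamma> L u"
      unfolding u_def[abs_def]
      by (rule bicycle_motion_of_fundamental_solution[OF L N q cont der det]) (use v in auto)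
    have u0: "u 0 = v" "u L = M v" by (simp_all add: u_def init M_def a_def b_def)
    \<comment> \<open>The definite description is meaningful because a motion with given start
      exists and its end is unique.\<close>
    show ?thesis unfolding bicycle_monodromy_def
    proof (rule the_equality)
      show "\<exists>u. bicycle_motion \<gamma> L u \<and> u 0 = v \<and> u L = M v" using u u0 by blast
      show "w = M v" if "\<exists>u. bicycle_motion \<gamma> L u \<and> u 0 = v \<and> u L = w" for w
        using that bicycle_motion_unique[OF L N q u] u0 by metis
    qed
  qed
  define m where "m = Im a"
  define D where "D = sqrt ((norm b)\<^sup>2 - m\<^sup>2)"
  have bm: "m\<^sup>2 < (norm b)\<^sup>2"
  proof -
    have "1 < (Re a)\<^sup>2" using tr unfolding a_def by (metis abs_square_less_1 abs_square_eq_1 linorder_neqE_linordered_idom order.asym order_less_irrefl)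
    then show ?thesis using ab unfolding cmod_power2[of a] m_def by simp
  qed
  then have D: "0 < D" "D\<^sup>2 = (norm b)\<^sup>2 - m\<^sup>2" by (auto simp: D_def)
  have b0: "b \<noteq> 0" using bm by auto
  define v1 where "v1 = (\<i> * of_real m + of_real D) / cnj b"
  define v2 where "v2 = (\<i> * of_real m - of_real D) / cnj b"
  have fixed: "M v = v \<longleftrightarrow> v = v1 \<or> v = v2" if v: "v \<in> sphere 0 1" for v
  proof -
    have d0: "cnj b * v + cnj a \<noteq> 0"
    proof
      assume "cnj b * v + cnj a = 0"
      then have "norm (cnj b * v) = norm (cnj a)" by (metis add_eq_0_iff norm_minus_cancel)
      then show False using ab v by (simp add: norm_mult)
    qed
    have "M v = v \<longleftrightarrow> a * v + b = v * (cnj b * v + cnj a)" using d0 by (simp add: M_def field_simps)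
    also have "\<dots> \<longleftrightarrow> cnj b * (a * v + b) = cnj b * (v * (cnj b * v + cnj a))" using b0 by simp
    also have "\<dots> \<longleftrightarrow> (cnj b * v - \<i> * of_real m)\<^sup>2 = (of_real D)\<^sup>2"
    proof -
      have D2: "(complex_of_real D)\<^sup>2 = b * cnj b - (of_real m)\<^sup>2"
        using D(2) by (simp add: complex_norm_square flip: of_real_power)
      have i: "a - cnj a = 2 * \<i> * of_real m" by (simp add: m_def complex_eq_iff)
      have e: "cnj b * (v * (cnj b * v + cnj a)) - cnj b * (a * v + b) = (cnj b * v)\<^sup>2 - cnj b * v * (a - cnj a) - b * cnj b"
        by (simp add: algebra_simps power2_eq_square)
      have "(cnj b * v - \<i> * of_real m)\<^sup>2 - (of_real D)\<^sup>2 = cnj b * (v * (cnj b * v + cnj a)) - cnj b * (a * v + b)"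
        unfolding e i D2 by (simp add: power2_eq_square algebra_simps)
      then show ?thesis by (metis eq_iff_diff_eq_0)
    qed
    also have "\<dots> \<longleftrightarrow> cnj b * v - \<i> * of_real m = of_real D \<or> cnj b * v - \<i> * of_real m = - of_real D"
      by (rule power2_eq_iff)
    also have "\<dots> \<longleftrightarrow> v = v1 \<or> v = v2"
      using b0 by (auto simp: v1_def v2_def field_simps)
    finally show ?thesis .
  qed
  have "norm v1 = 1" "norm v2 = 1"
  proof -
    have "(norm (\<i> * of_real m + complex_of_real D))\<^sup>2 = (norm b)\<^sup>2" "(norm (\<i> * of_real m - complex_of_real D))\<^sup>2 = (norm b)\<^sup>2"
      using D(2) by (simp_all add: cmod_power2[of "_ + _"] cmod_power2[of "_ - _"])
    then have "norm (\<i> * of_real m + complex_of_real D) = norm b" "norm (\<i> * of_real m - complex_of_real D) = norm b"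
      by (metis norm_ge_zero power2_eq_imp_eq)+
    then show "norm v1 = 1" "norm v2 = 1" using b0 by (simp_all add: v1_def v2_def norm_divide)
  qed
  then have fx: "{v \<in> sphere 0 1. bicycle_monodromy \<gamma> L v = v} = {v1, v2}"
    using mono fixed by auto
  have ne: "v1 \<noteq> v2" using D b0 by (auto simp: v1_def v2_def)
  \<comment> \<open>The circle has more than two points, for instance 1, -1 and
    \<open>\<i>\<close>.\<close>
  have "\<exists>v\<in>sphere 0 1. bicycle_monodromy \<gamma> L v \<noteq> v"
  proof (rule ccontr)
    assume "\<not> ?thesis"
    then have "sphere 0 1 = {v1, v2}" using fx by auto
    moreover have "{1, -1, \<i>} \<subseteq> sphere (0::complex) 1" by auto
    ultimately have "card {1, -1, \<i>} \<le> card {v1, v2}" by (metis card_mono finite.emptyI finite_insert)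
    moreover have "card {1, -1, \<i>} = 3" by (simp add: complex_eq_iff)
    ultimately show False using card_insert_le_m1[of 2 "{v2}" v1] by simp
  qed
  then show ?thesis
    unfolding hyperbolic_on_circle_def fx using ne by simp
qed

section \<open>The theorem\<close>

text \<open>\<open>f\<close> will be the identity or the conjugation, according to the orientation
  of the original curve; both preserve areas, so the bound applies to the original region.\<close>

lemma (in support_loop) exists_hyperbolic_fundamental_solution:
  assumes f: "linear f" "\<And>a b. \<bar>wedge (f a) (f b)\<bar> = \<bar>wedge a b\<bar>"
    and K: "compact K" "\<And>k. k \<in> K \<Longrightarrow> \<exists>r x. 0 \<le> r \<and> r \<le> 1 \<and> x \<in> {0..L} \<and> k = f (of_real r * g x)"
    and area: "pi < measure lebesgue K"
  obtains A B where "continuous_on {0..L} A" "continuous_on {0..L} B" "A 0 = 1" "B 0 = 0"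
    "\<And>x. x \<in> {0<..<L} - bad \<Longrightarrow> (A has_vector_derivative cis (\<phi> x) * cnj (B x) / 2) (at x)"
    "\<And>x. x \<in> {0<..<L} - bad \<Longrightarrow> (B has_vector_derivative cis (\<phi> x) * cnj (A x) / 2) (at x)"
    "1 < \<bar>Re (A L)\<bar>"
proof -
  have n1: "norm (cis (\<phi> x)) \<le> 1" and L0: "0 \<le> L" for x using L by simp_all
  obtain A B where AB: "continuous_on {0..L} A" "continuous_on {0..L} B" "A 0 = 1" "B 0 = 0"
    "\<And>x. x \<in> {0<..<L} \<Longrightarrow> isCont (\<lambda>x. cis (\<phi> x)) x \<Longrightarrow> (A has_vector_derivative cis (\<phi> x) * cnj (B x) / 2) (at x)"
    "\<And>x. x \<in> {0<..<L} \<Longrightarrow> isCont (\<lambda>x. cis (\<phi> x)) x \<Longrightarrow> (B has_vector_derivative cis (\<phi> x) * cnj (A x) / 2) (at x)"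
    using fundamental_solution[OF borel_measurable_cis_\<phi> n1 L0] by blast
  have der: "(A has_vector_derivative cis (\<phi> x) * cnj (B x) / 2) (at x)"
    "(B has_vector_derivative cis (\<phi> x) * cnj (A x) / 2) (at x)" if "x \<in> {0<..<L}" "x \<notin> bad" for x
    using AB(5,6)[OF that(1) isCont_cis_\<phi>[OF that(2)]] by auto
  define I where "I = integral {0..L} (\<lambda>x. wedge (g x) (cis (\<phi> x)))"
  have I: "((\<lambda>x. wedge (g x) (cis (\<phi> x))) has_integral I) {0..L}"
    unfolding I_def by (rule integrable_integral[OF integrable_tangent[OF continuous_g]])
  have "2 * pi < I" using area_le[OF f K I] area by simp
  have "1 < \<bar>Re (A L)\<bar>"
  proof (rule trace_gt_2[OF AB(1-4) der _ I \<open>2 * pi < I\<close>])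
    show "(norm (A x))\<^sup>2 - (norm (B x))\<^sup>2 = 1" if "x \<in> {0..L}" for x
      by (rule fundamental_solution_det[OF countable_bad AB(1-4) _ _ that]) (use der in auto)
  qed
  then show ?thesis using that[of A B] AB(1-4) der by auto
qed

theorem theorem4p1:
  fixes K :: "complex set" and \<gamma> :: "real \<Rightarrow> complex" and L :: real
  assumes "compact K" and "convex K" and "interior K \<noteq> {}"
    and "closed_arclength_parametrization \<gamma> L (frontier K)"
    and "measure lebesgue K > pi"
  shows "hyperbolic_on_circle (bicycle_monodromy \<gamma> L)"
proof -
  obtain c where c: "c \<in> interior K" using assms(3) by blast
  \<comment> \<open>An interior point is moved to the origin, which support loops require; the
    translation leaves the tangents, and with them the motions, unchanged.\<close>
  define K' where "K' = (+) (- c) ` K"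
  define \<gamma>' where "\<gamma>' x = - c + \<gamma> x" for x
  have K': "compact K'" "convex K'" "0 \<in> interior K'"
  proof -
    show "compact K'" "convex K'"
      unfolding K'_def by (intro compact_translation convex_translation assms(1,2))+
    show "0 \<in> interior K'"
      unfolding K'_def interior_translation using c by (intro image_eqI[of _ _ c]) auto
  qed
  have fr: "frontier K' = (+) (- c) ` frontier K" unfolding K'_def by (rule frontier_translation)
  have param: "closed_arclength_parametrization \<gamma>' L (frontier K')"
  proof -
    have "curve_length \<gamma>' s t = curve_length \<gamma> s t" for s t
      by (rule curve_length_cong) (simp add: \<gamma>'_def)
    moreover have "\<gamma>' ` S = (+) (- c) ` \<gamma> ` S" for S by (simp add: image_image \<gamma>'_def)
    moreover have "continuous_on {0..L} \<gamma>'" if "continuous_on {0..L} \<gamma>"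
      unfolding \<gamma>'_def by (intro continuous_intros that)
    ultimately show ?thesis
      using assms(4) by (simp add: closed_arclength_parametrization_def fr inj_on_def \<gamma>'_def)
  qed
  have area: "pi < measure lebesgue K'"
    unfolding K'_def measure_translation by (rule assms(5))
  have L: "0 < L" using assms(4) by (simp add: closed_arclength_parametrization_def)
  obtain g \<theta> \<tau> \<rho> where sl: "support_loop L g \<theta> \<tau> \<rho>"
    and orient: "(\<forall>x\<in>{0..L}. g x = \<gamma>' x) \<or> (\<forall>x\<in>{0..L}. g x = cnj (\<gamma>' x))"
    using convex_curve_support_loop[OF K' param] by blast
  interpret support_loop L g \<theta> \<tau> \<rho> by (rule sl)
  \<comment> \<open>The region is star-shaped about its interior point 0: the ray through
    \<open>k\<close> leaves it at a point of the curve, not before \<open>k\<close>.\<close>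
  have cover: "\<exists>r x. 0 \<le> r \<and> r \<le> 1 \<and> x \<in> {0..L} \<and> k = of_real r * \<gamma>' x" if k: "k \<in> K'" for k
  proof (cases "k = 0")
    case True
    then show ?thesis using L by (intro exI[of _ 0]) auto
  next
    case False
    obtain d where d: "0 < d" "0 + d *\<^sub>R k \<in> frontier K'"
      using ray_to_frontier[OF compact_imp_bounded[OF K'(1)] K'(3) False] by metis
    have "1 \<le> d"
    proof (rule ccontr)
      assume "\<not> 1 \<le> d"
      then have "k - (1 - d) *\<^sub>R (k - 0) \<in> interior K'"
        using d(1) by (intro mem_interior_convex_shrink[OF K'(2,3) k]) auto
      then show False using d(2) by (simp add: frontier_def algebra_simps)
    qed
    have "d *\<^sub>R k \<in> \<gamma>' ` {0..L}"
      using d(2) param by (simp add: closed_arclength_parametrization_def)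
    then obtain x where x: "x \<in> {0..L}" "d *\<^sub>R k = \<gamma>' x" by blast
    have "k = of_real (1 / d) * \<gamma>' x"
      unfolding x(2)[symmetric] using d(1) by (simp add: scaleR_conv_of_real)
    then show ?thesis using x d(1) \<open>1 \<le> d\<close> by (intro exI[of _ "1 / d"] exI[of _ x]) auto
  qed
  from orient show ?thesis
  proof
    assume eq: "\<forall>x\<in>{0..L}. g x = \<gamma>' x"
    have cov: "\<exists>r x. 0 \<le> r \<and> r \<le> 1 \<and> x \<in> {0..L} \<and> k = (\<lambda>z. z) (of_real r * g x)" if k: "k \<in> K'" for k
    proof -
      obtain r x where "0 \<le> r" "r \<le> 1" "x \<in> {0..L}" "k = of_real r * \<gamma>' x"
        using cover[OF k] by blast
      then show ?thesis using eq by (intro exI[of _ r] exI[of _ x]) simp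
    qed
    obtain A B where AB: "continuous_on {0..L} A" "continuous_on {0..L} B" "A 0 = 1" "B 0 = 0"
      "\<And>x. x \<in> {0<..<L} - bad \<Longrightarrow> (A has_vector_derivative cis (\<phi> x) * cnj (B x) / 2) (at x)"
      "\<And>x. x \<in> {0<..<L} - bad \<Longrightarrow> (B has_vector_derivative cis (\<phi> x) * cnj (A x) / 2) (at x)"
      "1 < \<bar>Re (A L)\<bar>"
      by (rule exists_hyperbolic_fundamental_solution[OF linear_ident _ K'(1) cov area]) auto
    have "(\<gamma> has_vector_derivative cis (\<phi> x)) (at x)" if x: "x \<in> {0<..<L} - bad" for x
    proof (rule has_vector_derivative_transform_within_open[of "\<lambda>x. c + g x" _ _ "{0<..<L}"])
      show "((\<lambda>x. c + g x) has_vector_derivative cis (\<phi> x)) (at x)"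
        using has_vector_derivative_add[OF has_vector_derivative_const has_vector_derivative_g[of x]] x by simp
      show "c + g y = \<gamma> y" if "y \<in> {0<..<L}" for y using eq that by (simp add: \<gamma>'_def)
    qed (use x in auto)
    then show ?thesis
      using hyperbolic_monodromy[OF L countable_bad _ _ AB] by simp
  next
    assume eq: "\<forall>x\<in>{0..L}. g x = cnj (\<gamma>' x)"
    have cov: "\<exists>r x. 0 \<le> r \<and> r \<le> 1 \<and> x \<in> {0..L} \<and> k = cnj (of_real r * g x)" if k: "k \<in> K'" for k
    proof -
      obtain r x where "0 \<le> r" "r \<le> 1" "x \<in> {0..L}" "k = of_real r * \<gamma>' x"
        using cover[OF k] by blast
      then show ?thesis using eq by (intro exI[of _ r] exI[of _ x]) simp
    qed
    obtain A B where AB: "continuous_on {0..L} A" "continuous_on {0..L} B" "A 0 = 1" "B 0 = 0"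
      "\<And>x. x \<in> {0<..<L} - bad \<Longrightarrow> (A has_vector_derivative cis (\<phi> x) * cnj (B x) / 2) (at x)"
      "\<And>x. x \<in> {0<..<L} - bad \<Longrightarrow> (B has_vector_derivative cis (\<phi> x) * cnj (A x) / 2) (at x)"
      "1 < \<bar>Re (A L)\<bar>"
      by (rule exists_hyperbolic_fundamental_solution[OF bounded_linear.linear[OF bounded_linear_cnj] _ K'(1) cov area])
         (auto simp: wedge_simps)
    note cnj_der = bounded_linear.has_vector_derivative[OF bounded_linear_cnj]
    have \<gamma>: "(\<gamma> has_vector_derivative cnj (cis (\<phi> x))) (at x)" if x: "x \<in> {0<..<L} - bad" for x
    proof (rule has_vector_derivative_transform_within_open[of "\<lambda>x. c + cnj (g x)" _ _ "{0<..<L}"])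
      show "((\<lambda>x. c + cnj (g x)) has_vector_derivative cnj (cis (\<phi> x))) (at x)"
        using has_vector_derivative_add[OF has_vector_derivative_const cnj_der[OF has_vector_derivative_g[of x]]] x by simp
      show "c + cnj (g y) = \<gamma> y" if "y \<in> {0<..<L}" for y using eq that by (simp add: \<gamma>'_def)
    qed (use x in auto)
    \<comment> \<open>Conjugating the system turns the tangents of the mirror image into those of
      \<open>\<gamma>\<close>; the real part of \<open>A L\<close> is unaffected.\<close>
    show ?thesis
    proof (rule hyperbolic_monodromy[OF L countable_bad \<gamma>])
      show "continuous_on {0..L} (\<lambda>x. cnj (A x))" "continuous_on {0..L} (\<lambda>x. cnj (B x))"
        by (intro continuous_intros AB)+
      fix x assume x: "x \<in> {0<..<L} - bad"
      show "((\<lambda>x. cnj (A x)) has_vector_derivative cnj (cis (\<phi> x)) * cnj (cnj (B x)) / 2) (at x)"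
        using cnj_der[OF AB(5)[OF x]] by simp
      show "((\<lambda>x. cnj (B x)) has_vector_derivative cnj (cis (\<phi> x)) * cnj (cnj (A x)) / 2) (at x)"
        using cnj_der[OF AB(6)[OF x]] by simp
    qed (use AB in auto)
  qed
qed

end
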